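(* Let $\Phi:\mathcal{L}(\mathcal{H})\to\mathcal{L}(\mathcal{K})$ be a quantum channel. Suppose that a $C^*$-algebra $\mathscr{A}$ that is transmittable via $\Phi$ satisfies $$\mathbb{M}_d(\mathbb{C})^{\oplus c_d(\Phi)}\leq\mathscr{A}\qquad\text{for every }d\in\{1,\ldots,d_{\max}(\Phi)\}.$$ Then $N_d(\Phi)\geq0$ for every $d\in\{1,\ldots,d_{\max}(\Phi)\}$, and $$\mathscr{A}\cong\mathscr{A}_{\mathrm{cap}}(\Phi).$$
   Context: All Hilbert spaces are finite-dimensional and complex; all $C^*$-algebras are finite-dimensional and nonzero. $\mathcal{L}(\mathcal{H})$ is the algebra of linear operators on $\mathcal{H}$. A quantum channel is a linear, completely positive, trace-preserving map $\Phi:\mathcal{L}(\mathcal{H})\to\mathcal{L}(\mathcal{K})$; its adjoint $\Phi^*$ is defined by $\mathrm{Tr}(Y\Phi(X))=\mathrm{Tr}(\Phi^*(Y)X)$. $\cong$ denotes $*$-isomorphism. Embedding: $\mathscr{A}\leq\mathscr{B}$ means there is an injective (not necessarily unital) $*$-homomorphism $\mathscr{A}\to\mathscr{B}$. Correctability: a $*$-subalgebra $\mathscr{A}\subseteq\mathcal{L}(\mathcal{H})$ with unit projection $P$ (possibly $P\neq 1_{\mathcal{H}}$) is correctable for $\Phi$ if, with $C=P\mathcal{H}$, $V:C\to\mathcal{H}$ the inclusion and $\Phi|_C(Y)=\Phi(VYV^* )$, there is a channel $\mathcal{D}:\mathcal{L}(\mathcal{K})\to\mathcal{L}(C)$ with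 $(\mathcal{D}\circ\Phi|_C)^*(X)=X$ for all $X\in V^*\mathscr{A}V$. $\mathscr{A}$ is transmittable via $\Phi$ if there is an injective $*$-homomorphism $\pi:\mathscr{A}\to\mathcal{L}(\mathcal{H})$ whose image is correctable for $\Phi$. Hybrid capacities: $d_{\max}(\Phi)=\max\{d\in\mathbb{N}:\mathbb{M}_d(\mathbb{C})\text{ is transmittable via }\Phi\}$, and for $1\le d\le d_{\max}(\Phi)$, $c_d(\Phi)=\max\{c\in\mathbb{N}:\mathbb{M}_d(\mathbb{C})^{\oplus c}\text{ is transmittable via }\Phi\}$. Define integers recursively (descending in $d$) by $N_{d_{\max}(\Phi)}(\Phi)=c_{d_{\max}(\Phi)}(\Phi)$ and $$N_d(\Phi)=c_d(\Phi)-\sum_{m=d+1}^{d_{\max}(\Phi)}N_m(\Phi)\left\lfloor\frac{m}{d}\right\rfloor,\qquad 1\leq d<d_{\max}(\Phi).$$ When all $N_d(\Phi)\ge0$, the capacity algebra is $\mathscr{A}_{\mathrm{cap}}(\Phi)=\bigoplus_{d=1}^{d_{\max}(\Phi)}\mathbb{M}_d(\mathbb{C})^{\oplus N_d(\Phi)}$, with summands of zero multiplicity omitted. *)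

theory Defs
  imports "Jordan_Normal_Form.Schur_Decomposition"
begin

section \<open>Finite-dimensional C*-algebras\<close>

text \<open>
  The field \<open>one\<close> inherited from the record \<open>module\<close> plays no role: neither the C*-algebra axioms
  nor homomorphisms refer to it.
\<close>

record 'a star_algebra = "(complex, 'a) module" +
  star :: "'a \<Rightarrow> 'a"

text \<open>
  The C*-norm is asserted to exist instead of being part of the record. It is unique on a given
  *-algebra, nothing below mentions it, and it is automatically complete in finite dimension.
\<close>

locale fin_dim_cstar_algebra = vectorspace "class_ring :: complex ring" A
  for A :: "'a star_algebra" (structure) +
  assumes finite_dimensional: "vectorspace.fin_dim (class_ring :: complex ring) A"
    and nonzero: "carrier A \<noteq> {\<zero>}"
    and mult_closed: "x \<in> carrier A \<Longrightarrow> y \<in> carrier A \<Longrightarrow> x \<otimes> y \<in> carrier A"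
    and mult_assoc: "x \<in> carrier A \<Longrightarrow> y \<in> carrier A \<Longrightarrow> z \<in> carrier A \<Longrightarrow>
      (x \<otimes> y) \<otimes> z = x \<otimes> (y \<otimes> z)"
    and mult_distrib_left: "x \<in> carrier A \<Longrightarrow> y \<in> carrier A \<Longrightarrow> z \<in> carrier A \<Longrightarrow>
      x \<otimes> (y \<oplus> z) = x \<otimes> y \<oplus> x \<otimes> z"
    and mult_distrib_right: "x \<in> carrier A \<Longrightarrow> y \<in> carrier A \<Longrightarrow> z \<in> carrier A \<Longrightarrow>
      (x \<oplus> y) \<otimes> z = x \<otimes> z \<oplus> y \<otimes> z"
    and smult_mult_left: "x \<in> carrier A \<Longrightarrow> y \<in> carrier A \<Longrightarrow>
      (a \<odot>\<^bsub>A\<^esub> x) \<otimes> y = a \<odot>\<^bsub>A\<^esub> (x \<otimes> y)"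
    and smult_mult_right: "x \<in> carrier A \<Longrightarrow> y \<in> carrier A \<Longrightarrow>
      x \<otimes> (a \<odot>\<^bsub>A\<^esub> y) = a \<odot>\<^bsub>A\<^esub> (x \<otimes> y)"
    and star_closed: "x \<in> carrier A \<Longrightarrow> star A x \<in> carrier A"
    and star_star: "x \<in> carrier A \<Longrightarrow> star A (star A x) = x"
    and star_add: "x \<in> carrier A \<Longrightarrow> y \<in> carrier A \<Longrightarrow> star A (x \<oplus> y) = star A x \<oplus> star A y"
    and star_smult: "x \<in> carrier A \<Longrightarrow> star A (a \<odot>\<^bsub>A\<^esub> x) = cnj a \<odot>\<^bsub>A\<^esub> star A x"
    and star_mult: "x \<in> carrier A \<Longrightarrow> y \<in> carrier A \<Longrightarrow> star A (x \<otimes> y) = star A y \<otimes> star A x"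
    and cstar_norm: "\<exists>N :: 'a \<Rightarrow> real.
      (\<forall>x\<in>carrier A. 0 \<le> N x \<and> (N x = 0 \<longleftrightarrow> x = \<zero>)) \<and>
      (\<forall>x\<in>carrier A. \<forall>a. N (a \<odot>\<^bsub>A\<^esub> x) = cmod a * N x) \<and>
      (\<forall>x\<in>carrier A. \<forall>y\<in>carrier A. N (x \<oplus> y) \<le> N x + N y) \<and>
      (\<forall>x\<in>carrier A. \<forall>y\<in>carrier A. N (x \<otimes> y) \<le> N x * N y) \<and>
      (\<forall>x\<in>carrier A. N (star A x \<otimes> x) = (N x)\<^sup>2)"

definition star_hom :: "'a star_algebra \<Rightarrow> 'b star_algebra \<Rightarrow> ('a \<Rightarrow> 'b) \<Rightarrow> bool" where
  "star_hom A B f \<longleftrightarrow>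
     (\<forall>x\<in>carrier A. f x \<in> carrier B) \<and>
     (\<forall>x\<in>carrier A. \<forall>y\<in>carrier A. f (x \<oplus>\<^bsub>A\<^esub> y) = f x \<oplus>\<^bsub>B\<^esub> f y) \<and>
     (\<forall>x\<in>carrier A. \<forall>a. f (a \<odot>\<^bsub>A\<^esub> x) = a \<odot>\<^bsub>B\<^esub> f x) \<and>
     (\<forall>x\<in>carrier A. \<forall>y\<in>carrier A. f (x \<otimes>\<^bsub>A\<^esub> y) = f x \<otimes>\<^bsub>B\<^esub> f y) \<and>
     (\<forall>x\<in>carrier A. f (star A x) = star B (f x))"

definition star_embeds :: "'a star_algebra \<Rightarrow> 'b star_algebra \<Rightarrow> bool" where
  "star_embeds A B \<longleftrightarrow> (\<exists>f. star_hom A B f \<and> inj_on f (carrier A))"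

definition star_isomorphic :: "'a star_algebra \<Rightarrow> 'b star_algebra \<Rightarrow> bool" where
  "star_isomorphic A B \<longleftrightarrow> (\<exists>f. star_hom A B f \<and> bij_betw f (carrier A) (carrier B))"

text \<open>The algebra of \<open>n \<times> n\<close> matrices, that is, the operators on \<open>\<complex>\<^sup>n\<close>.\<close>

definition matrix_algebra :: "nat \<Rightarrow> complex mat star_algebra" where
  "matrix_algebra n =
     \<lparr>carrier = carrier_mat n n, monoid.mult = (*), one = 1\<^sub>m n, zero = 0\<^sub>m n n, add = (+),
      module.smult = (\<cdot>\<^sub>m), star = mat_adjoint\<rparr>"

text \<open>The direct sum of the algebras \<open>matrix_algebra d\<close>, with \<open>d\<close> running through a list.\<close>

definition matrix_algebra_sum :: "nat list \<Rightarrow> complex mat list star_algebra" where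
  "matrix_algebra_sum ds =
     \<lparr>carrier = {Xs. list_all2 (\<lambda>X d. X \<in> carrier_mat d d) Xs ds},
      monoid.mult = map2 (*), one = map (\<lambda>d. 1\<^sub>m d) ds, zero = map (\<lambda>d. 0\<^sub>m d d) ds, add = map2 (+),
      module.smult = (\<lambda>a. map (\<lambda>X. a \<cdot>\<^sub>m X)), star = map mat_adjoint\<rparr>"

section \<open>Quantum channels\<close>

text \<open>
  Hilbert spaces are \<open>\<complex>\<^sup>n\<close>. A linear map from the operators on \<open>\<complex>\<^sup>n\<close> to those on \<open>\<complex>\<^sup>m\<close> is a function
  on complex matrices of which only the restriction to \<open>carrier_mat n n\<close> matters.
\<close>

definition mat_trace :: "complex mat \<Rightarrow> complex" where
  "mat_trace X = (\<Sum>i<dim_row X. X $$ (i, i))"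

text \<open>The order on \<open>complex\<close> makes \<open>0 \<le> z\<close> mean that \<open>z\<close> is real and nonnegative.\<close>

definition positive_semidefinite :: "nat \<Rightarrow> complex mat \<Rightarrow> bool" where
  "positive_semidefinite n X \<longleftrightarrow>
     X \<in> carrier_mat n n \<and> (\<forall>v\<in>carrier_vec n. 0 \<le> (X *\<^sub>v v) \<bullet>c v)"

definition mat_linear :: "nat \<Rightarrow> nat \<Rightarrow> (complex mat \<Rightarrow> complex mat) \<Rightarrow> bool" where
  "mat_linear n m \<Phi> \<longleftrightarrow>
     (\<forall>X\<in>carrier_mat n n. \<Phi> X \<in> carrier_mat m m) \<and>
     (\<forall>X\<in>carrier_mat n n. \<forall>Y\<in>carrier_mat n n. \<Phi> (X + Y) = \<Phi> X + \<Phi> Y) \<and>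
     (\<forall>X\<in>carrier_mat n n. \<forall>a. \<Phi> (a \<cdot>\<^sub>m X) = a \<cdot>\<^sub>m \<Phi> X)"

text \<open>
  \<open>ampliation k n m \<Phi>\<close> is the tensor product of the identity on \<open>k \<times> k\<close> matrices with \<open>\<Phi>\<close>: it applies
  \<open>\<Phi>\<close> to each of the \<open>n \<times> n\<close> blocks of a \<open>kn \<times> kn\<close> matrix.
\<close>

definition mat_block :: "nat \<Rightarrow> complex mat \<Rightarrow> nat \<Rightarrow> nat \<Rightarrow> complex mat" where
  "mat_block n X a b = mat n n (\<lambda>(i, j). X $$ (a * n + i, b * n + j))"

definition ampliation ::
    "nat \<Rightarrow> nat \<Rightarrow> nat \<Rightarrow> (complex mat \<Rightarrow> complex mat) \<Rightarrow> complex mat \<Rightarrow> complex mat" where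
  "ampliation k n m \<Phi> X =
     mat (k * m) (k * m) (\<lambda>(i, j). \<Phi> (mat_block n X (i div m) (j div m)) $$ (i mod m, j mod m))"

definition completely_positive :: "nat \<Rightarrow> nat \<Rightarrow> (complex mat \<Rightarrow> complex mat) \<Rightarrow> bool" where
  "completely_positive n m \<Phi> \<longleftrightarrow>
     (\<forall>k X. positive_semidefinite (k * n) X \<longrightarrow> positive_semidefinite (k * m) (ampliation k n m \<Phi> X))"

definition quantum_channel :: "nat \<Rightarrow> nat \<Rightarrow> (complex mat \<Rightarrow> complex mat) \<Rightarrow> bool" where
  "quantum_channel n m \<Phi> \<longleftrightarrow>
     mat_linear n m \<Phi> \<and> completely_positive n m \<Phi> \<and>
     (\<forall>X\<in>carrier_mat n n. mat_trace (\<Phi> X) = mat_trace X)"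

definition adjoint_map ::
    "nat \<Rightarrow> nat \<Rightarrow> (complex mat \<Rightarrow> complex mat) \<Rightarrow> complex mat \<Rightarrow> complex mat" where
  "adjoint_map n m \<Phi> Y =
     (THE Z. Z \<in> carrier_mat n n \<and>
        (\<forall>X\<in>carrier_mat n n. mat_trace (Y * \<Phi> X) = mat_trace (Z * X)))"

section \<open>Correctable and transmittable algebras\<close>

definition star_subalgebra :: "nat \<Rightarrow> complex mat set \<Rightarrow> bool" where
  "star_subalgebra n S \<longleftrightarrow>
     S \<subseteq> carrier_mat n n \<and> 0\<^sub>m n n \<in> S \<and>
     (\<forall>X\<in>S. \<forall>Y\<in>S. X + Y \<in> S) \<and>
     (\<forall>X\<in>S. \<forall>a. a \<cdot>\<^sub>m X \<in> S) \<and>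
     (\<forall>X\<in>S. \<forall>Y\<in>S. X * Y \<in> S) \<and>
     (\<forall>X\<in>S. mat_adjoint X \<in> S)"

text \<open>
  The space \<open>C = P \<complex>\<^sup>n\<close> is identified with \<open>\<complex>\<^sup>r\<close> by an orthonormal basis, so that the inclusion of \<open>C\<close>
  becomes an \<open>n \<times> r\<close> isometry \<open>V\<close> with range projection \<open>P\<close>. Two choices of \<open>V\<close> differ by a unitary
  of \<open>\<complex>\<^sup>r\<close>, hence correctability does not depend on the choice.
\<close>

definition correctable ::
    "nat \<Rightarrow> nat \<Rightarrow> (complex mat \<Rightarrow> complex mat) \<Rightarrow> complex mat set \<Rightarrow> bool" where
  "correctable n m \<Phi> S \<longleftrightarrow>
     star_subalgebra n S \<and>
     (\<exists>P\<in>S. (\<forall>X\<in>S. P * X = X \<and> X * P = X) \<and>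
       (\<exists>r V. V \<in> carrier_mat n r \<and> mat_adjoint V * V = 1\<^sub>m r \<and> V * mat_adjoint V = P \<and>
         (\<exists>D. quantum_channel m r D \<and>
           (\<forall>X\<in>(\<lambda>Z. mat_adjoint V * Z * V) ` S.
              adjoint_map r r (D \<circ> (\<lambda>Y. \<Phi> (V * Y * mat_adjoint V))) X = X))))"

definition transmittable ::
    "nat \<Rightarrow> nat \<Rightarrow> (complex mat \<Rightarrow> complex mat) \<Rightarrow> 'a star_algebra \<Rightarrow> bool" where
  "transmittable n m \<Phi> A \<longleftrightarrow>
     (\<exists>f. star_hom A (matrix_algebra n) f \<and> inj_on f (carrier A) \<and>
          correctable n m \<Phi> (f ` carrier A))"

section \<open>Hybrid capacities and the capacity algebra\<close>

text \<open>
  All C*-algebras are nonzero, so the maxima range over \<open>d \<ge> 1\<close> and \<open>c \<ge> 1\<close>. The sets are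
  finite because a transmittable algebra embeds into \<open>matrix_algebra n\<close>.
\<close>

definition d_max :: "nat \<Rightarrow> nat \<Rightarrow> (complex mat \<Rightarrow> complex mat) \<Rightarrow> nat" where
  "d_max n m \<Phi> = Max {d. 1 \<le> d \<and> transmittable n m \<Phi> (matrix_algebra d)}"

definition hybrid_capacity :: "nat \<Rightarrow> nat \<Rightarrow> (complex mat \<Rightarrow> complex mat) \<Rightarrow> nat \<Rightarrow> nat" where
  "hybrid_capacity n m \<Phi> d =
     Max {c. 1 \<le> c \<and> transmittable n m \<Phi> (matrix_algebra_sum (replicate c d))}"

text \<open>At \<open>d = d_max n m \<Phi>\<close> the sum is empty, which is the base case of the recursion.\<close>

function capacity_multiplicity ::
    "nat \<Rightarrow> nat \<Rightarrow> (complex mat \<Rightarrow> complex mat) \<Rightarrow> nat \<Rightarrow> int" where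
  "capacity_multiplicity n m \<Phi> d =
     int (hybrid_capacity n m \<Phi> d) -
     (\<Sum>k\<in>{d<..d_max n m \<Phi>}. capacity_multiplicity n m \<Phi> k * int (k div d))"
  by pat_completeness auto
termination
  by (relation "measure (\<lambda>(n, m, \<Phi>, d). d_max n m \<Phi> - d)") auto

declare capacity_multiplicity.simps [simp del]

definition capacity_algebra ::
    "nat \<Rightarrow> nat \<Rightarrow> (complex mat \<Rightarrow> complex mat) \<Rightarrow> complex mat list star_algebra" where
  "capacity_algebra n m \<Phi> =
     matrix_algebra_sum
       (concat (map (\<lambda>d. replicate (nat (capacity_multiplicity n m \<Phi> d)) d)
                    [1..<Suc (d_max n m \<Phi>)]))"

end

(*
  The algebra A is a *-subalgebra S of a full matrix algebra. A decomposition of the unit of S into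
  as many orthogonal projections as possible consists of minimal projections p, for which
  p S p is the set of multiples of p; partial isometries between them provide matrix units, and S is
  a direct sum of full matrix algebras M_(s_1), ..., M_(s_k). Counting orthogonal idempotents
  shows that c copies of M_d embed into S if and only if c is at most the sum of the s_i div d.
  A subalgebra of a transmittable algebra is transmittable: the decoder is followed by the
  compression to the smaller code space, and a pure state is put where the compression loses trace.
  Hence every s_i is at most d_max and c_d is the sum of the s_i div d for all d up to d_max.
  Descending induction on d turns this into N_d = card {i. s_i = d}.
*)

theory Submission
  imports Defs
begin

text \<open>The bound on the number of copies rests on a left action: for every class of equivalent
  minimal projections, S acts by left multiplication on a space spanned by s_i elements, and each
  copy of M_d that acts nontrivially there contributes d independent elements. Passing to
  subalgebras is delicate because embeddings need not preserve units. The code space shrinks from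
  the range of P to that of a smaller unit Q, and compression alone does not preserve the trace.
  Sending the lost part to a pure state adds, on the side of observables, only a multiple of P - Q.
  This lies in the larger algebra because both units do, so the old decoder recovers it, and it
  vanishes on the range of Q. The embedding hypothesis gives the upper bound on c_d, and maximality
  of c_d gives the lower one. The maxima run over positive numbers, however, so the sum of the s_i
  div d must first be known to be positive: the hypothesis at d_max provides some s_i that is at
  least d_max, and this settles every smaller d.\<close>

section \<open>Finitely supported matrices\<close>

text \<open>Finitely supported infinite matrices form a ring without unit that contains the matrices of all
  sizes, so that the sums and algebraic simplification of the ring classes become available.\<close>

typedef fmat = "{f :: nat \<Rightarrow> nat \<Rightarrow> complex. \<exists>n. \<forall>i j. n \<le> i \<or> n \<le> j \<longrightarrow> f i j = 0}"
  morphisms entry Abs_fmat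
  by (rule exI[of _ "\<lambda>_ _. 0"]) auto

setup_lifting type_definition_fmat

definition supported :: "nat \<Rightarrow> nat \<Rightarrow> fmat \<Rightarrow> bool" where
  "supported n m x \<longleftrightarrow> (\<forall>i j. n \<le> i \<or> m \<le> j \<longrightarrow> entry x i j = 0)"

lemma fmat_eqI: "(\<And>i j. entry x i j = entry y i j) \<Longrightarrow> x = y"
  by (metis entry_inject ext)

lemma ex_supported: "\<exists>n. supported n n x"
  unfolding supported_def using entry[of x] by simp

lemma supported_mono: "supported n m x \<Longrightarrow> n \<le> n' \<Longrightarrow> m \<le> m' \<Longrightarrow> supported n' m' x"
  unfolding supported_def by (meson le_trans)

lemma entry_Abs_fmat: "(\<And>i j. n \<le> i \<or> n \<le> j \<Longrightarrow> f i j = 0) \<Longrightarrow> entry (Abs_fmat f) = f"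
  by (subst Abs_fmat_inverse) auto

instantiation fmat :: "{minus, uminus, ab_group_add}"
begin
lift_definition zero_fmat :: fmat is "\<lambda>_ _. 0" by auto
lift_definition plus_fmat :: "fmat \<Rightarrow> fmat \<Rightarrow> fmat" is "\<lambda>f g i j. f i j + g i j"
proof -
  fix f g :: "nat \<Rightarrow> nat \<Rightarrow> complex"
  assume "\<exists>n. \<forall>i j. n \<le> i \<or> n \<le> j \<longrightarrow> f i j = 0" "\<exists>n. \<forall>i j. n \<le> i \<or> n \<le> j \<longrightarrow> g i j = 0"
  then obtain n m where "\<forall>i j. n \<le> i \<or> n \<le> j \<longrightarrow> f i j = 0" "\<forall>i j. m \<le> i \<or> m \<le> j \<longrightarrow> g i j = 0"
    by auto
  then show "\<exists>n. \<forall>i j. n \<le> i \<or> n \<le> j \<longrightarrow> f i j + g i j = 0"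
    by (intro exI[of _ "max n m"]) auto
qed
lift_definition uminus_fmat :: "fmat \<Rightarrow> fmat" is "\<lambda>f i j. - f i j" by auto
definition minus_fmat :: "fmat \<Rightarrow> fmat \<Rightarrow> fmat" where "minus_fmat x y = x + - y"
instance
proof
  fix a b c :: fmat
  show "a + b + c = a + (b + c)" "a + b = b + a" "0 + a = a" "- a + a = 0"
    by (transfer; auto simp: add_ac)+
qed (rule minus_fmat_def)
end

lemma entry_zero [simp]: "entry 0 i j = 0"
  and entry_plus [simp]: "entry (x + y) i j = entry x i j + entry y i j"
  and entry_uminus [simp]: "entry (- x) i j = - entry x i j"
  by (transfer; simp)+

lemma entry_minus [simp]: "entry (x - y) i j = entry x i j - entry y i j"
  by (simp only: minus_fmat_def entry_plus entry_uminus) simp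

lemma entry_sum [simp]: "entry (sum f A) i j = (\<Sum>a\<in>A. entry (f a) i j)"
  by (induction A rule: infinite_finite_induct) auto

definition fdim :: "fmat \<Rightarrow> nat" where "fdim x = (SOME n. supported n n x)"

lemma supported_fdim: "supported (fdim x) (fdim x) x"
  unfolding fdim_def using ex_supported by (rule someI_ex)

instantiation fmat :: ring
begin
definition times_fmat :: "fmat \<Rightarrow> fmat \<Rightarrow> fmat" where
  "times_fmat x y = Abs_fmat (\<lambda>i j. \<Sum>k<fdim x. entry x i k * entry y k j)"

lemma entry_times_fdim: "entry (x * y) i j = (\<Sum>k<fdim x. entry x i k * entry y k j)"
proof -
  have "entry (x * y) = (\<lambda>i j. \<Sum>k<fdim x. entry x i k * entry y k j)"
    unfolding times_fmat_def
    by (rule entry_Abs_fmat[of "max (fdim x) (fdim y)"])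
       (use supported_fdim[of x] supported_fdim[of y] in \<open>auto simp: supported_def intro!: sum.neutral\<close>)
  then show ?thesis by simp
qed

text \<open>Past column \<open>n\<close> the entries of \<open>x\<close> vanish, so this sum and the
  one up to \<open>fdim x\<close> both agree with the sum up to the larger bound. The product is
  thereby freed from the arbitrary choice in \<open>fdim\<close>.\<close>

lemma entry_times: "supported a n x \<Longrightarrow> entry (x * y) i j = (\<Sum>k<n. entry x i k * entry y k j)"
proof -
  assume n: "supported a n x"
  have "(\<Sum>k<n. entry x i k * entry y k j) = (\<Sum>k<max n (fdim x). entry x i k * entry y k j)"
    by (rule sum.mono_neutral_left) (use n in \<open>auto simp: supported_def\<close>)
  also have "\<dots> = (\<Sum>k<fdim x. entry x i k * entry y k j)"
    by (rule sum.mono_neutral_right) (use supported_fdim[of x] in \<open>auto simp: supported_def\<close>)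
  finally show ?thesis by (simp add: entry_times_fdim)
qed

lemma common_support: "\<exists>n. \<forall>x\<in>set xs. supported n n x"
proof -
  have "supported (Max (fdim ` set xs)) (Max (fdim ` set xs)) x" if "x \<in> set xs" for x
    by (rule supported_mono[OF supported_fdim]) (use that in auto)
  then show ?thesis by blast
qed

instance
proof
  fix a b c :: fmat
  obtain n where n: "supported n n a" "supported n n b" "supported n n c"
    using common_support[of "[a, b, c]"] by auto
  have ab: "supported n n (a * b)"
    using n unfolding supported_def by (auto simp: entry_times[OF n(1)])
  have apb: "supported n n (a + b)"
    using n unfolding supported_def by auto
  show "a * b * c = a * (b * c)"
  proof (rule fmat_eqI)
    fix i j
    have "entry (a * b * c) i j = (\<Sum>l<n. \<Sum>k<n. entry a i k * entry b k l * entry c l j)"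
      by (simp add: entry_times[OF ab] entry_times[OF n(1)] sum_distrib_right)
    also have "\<dots> = (\<Sum>k<n. \<Sum>l<n. entry a i k * entry b k l * entry c l j)"
      by (rule sum.swap)
    also have "\<dots> = entry (a * (b * c)) i j"
      by (simp add: entry_times[OF n(2)] entry_times[OF n(1)] sum_distrib_left mult.assoc)
    finally show "entry (a * b * c) i j = entry (a * (b * c)) i j" .
  qed
  show "(a + b) * c = a * c + b * c"
    by (rule fmat_eqI) (simp add: entry_times[OF n(1)] entry_times[OF n(2)] entry_times[OF apb]
        algebra_simps sum.distrib)
  show "a * (b + c) = a * b + a * c"
    by (rule fmat_eqI) (simp add: entry_times[OF n(1)] algebra_simps sum.distrib)
qed
end

lift_definition scale :: "complex \<Rightarrow> fmat \<Rightarrow> fmat" (infixr "*\<^sub>C" 75) is "\<lambda>c f i j. c * f i j"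
  by auto

lift_definition adj :: "fmat \<Rightarrow> fmat" is "\<lambda>f i j. cnj (f j i)"
  by auto

lift_definition munit :: "nat \<Rightarrow> nat \<Rightarrow> fmat" is "\<lambda>a b i j. if i = a \<and> j = b then 1 else 0"
proof -
  fix a b :: nat
  show "\<exists>n. \<forall>i j. n \<le> i \<or> n \<le> j \<longrightarrow> (if i = a \<and> j = b then 1 else 0) = (0::complex)"
    by (rule exI[of _ "Suc (max a b)"]) auto
qed

lemma entry_scale [simp]: "entry (c *\<^sub>C x) i j = c * entry x i j"
  and entry_adj [simp]: "entry (adj x) i j = cnj (entry x j i)"
  and entry_munit: "entry (munit a b) i j = (if i = a \<and> j = b then 1 else 0)"
  by (transfer; simp)+

interpretation fmat: vector_space scale
  by unfold_locales (auto intro!: fmat_eqI simp: algebra_simps)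

lemma supported_zero [simp]: "supported n m 0"
  and supported_add: "supported n m x \<Longrightarrow> supported n m y \<Longrightarrow> supported n m (x + y)"
  and supported_scale: "supported n m x \<Longrightarrow> supported n m (c *\<^sub>C x)"
  and supported_adj: "supported n m x \<Longrightarrow> supported m n (adj x)"
  and supported_munit: "a < n \<Longrightarrow> b < m \<Longrightarrow> supported n m (munit a b)"
  by (auto simp: supported_def entry_munit)

lemma supported_times: "supported n k x \<Longrightarrow> supported l m y \<Longrightarrow> supported n m (x * y)"
  unfolding supported_def using entry_times_fdim by (auto intro!: sum.neutral)

lemma supported_sum: "(\<And>a. a \<in> A \<Longrightarrow> supported n m (f a)) \<Longrightarrow> supported n m (sum f A)"
  by (simp add: supported_def)

lemma scale_mult_left [simp]: "c *\<^sub>C x * y = c *\<^sub>C (x * y)"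
proof (rule fmat_eqI)
  fix i j
  obtain n where "supported n n x" using ex_supported by auto
  then show "entry (c *\<^sub>C x * y) i j = entry (c *\<^sub>C (x * y)) i j"
    by (simp add: entry_times[of n n] supported_scale sum_distrib_left mult.assoc)
qed

lemma scale_mult_right [simp]: "x * c *\<^sub>C y = c *\<^sub>C (x * y)"
  by (rule fmat_eqI) (simp add: entry_times_fdim sum_distrib_left mult.left_commute)

lemma adj_adj [simp]: "adj (adj x) = x"
  and adj_zero [simp]: "adj 0 = 0"
  and adj_add [simp]: "adj (x + y) = adj x + adj y"
  and adj_diff [simp]: "adj (x - y) = adj x - adj y"
  and adj_scale [simp]: "adj (c *\<^sub>C x) = cnj c *\<^sub>C adj x"
  and adj_munit [simp]: "adj (munit a b) = munit b a"
  and adj_sum [simp]: "adj (sum f A) = (\<Sum>a\<in>A. adj (f a))"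
  by (auto intro!: fmat_eqI simp: entry_munit)

lemma adj_times [simp]: "adj (x * y) = adj y * adj x"
proof (rule fmat_eqI)
  fix i j
  obtain n where n: "supported n n x" "supported n n y"
    using common_support[of "[x, y]"] by auto
  show "entry (adj (x * y)) i j = entry (adj y * adj x) i j"
    by (simp add: entry_times[OF n(1)] entry_times[OF supported_adj[OF n(2)]] mult.commute)
qed

lemma adj_eq_zero_iff [simp]: "adj x = 0 \<longleftrightarrow> x = 0"
  by (metis adj_adj adj_zero)

lemma entry_adj_times_self:
  assumes "supported n n x"
  shows "entry (adj x * x) j j = of_real (\<Sum>k<n. (cmod (entry x k j))\<^sup>2)"
  unfolding entry_times[OF supported_adj[OF assms]] of_real_sum
  by (intro sum.cong) (simp_all add: complex_norm_square[symmetric] mult.commute)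

text \<open>A diagonal entry of \<open>adj x * x\<close> is the sum of the squared moduli in a
  column of \<open>x\<close>. Comparing such entries later shows that a scalar relating two products
  of this form is positive.\<close>

lemma adj_times_self_pos:
  assumes "x \<noteq> 0"
  obtains j r where "entry (adj x * x) j j = of_real r" "r > 0"
proof -
  obtain n where n: "supported n n x" using ex_supported by auto
  obtain i j where ij: "entry x i j \<noteq> 0"
    using assms by (metis entry_zero fmat_eqI)
  with n have "i < n" by (auto simp: supported_def simp flip: not_le)
  with ij have "(\<Sum>k<n. (cmod (entry x k j))\<^sup>2) > 0"
    by (intro sum_pos2[of _ i]) auto
  then show thesis by (rule that[OF entry_adj_times_self[OF n]])
qed

lemma adj_times_self_nonneg: obtains r where "entry (adj x * x) j j = of_real r" "r \<ge> 0"
proof -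
  obtain n where n: "supported n n x" using ex_supported by auto
  show thesis by (rule that[OF entry_adj_times_self[OF n]]) (auto intro: sum_nonneg)
qed

lemma adj_times_self_eq_0_iff [simp]: "adj x * x = 0 \<longleftrightarrow> x = 0"
proof
  assume "adj x * x = 0"
  show "x = 0"
  proof (rule ccontr)
    assume "x \<noteq> 0"
    then obtain j r where "entry (adj x * x) j j = of_real r" "r > 0"
      by (rule adj_times_self_pos)
    with \<open>adj x * x = 0\<close> show False by simp
  qed
qed simp

lemma entry_times_munit: "entry (x * munit a b) i j = (if j = b then entry x i a else 0)"
proof -
  obtain n where n: "supported n n x" using ex_supported by auto
  then have "supported n (max n (Suc a)) x" by (rule supported_mono) auto
  then show ?thesis by (auto simp: entry_times entry_munit if_distrib[of "\<lambda>c. _ * c"] cong: if_cong)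
qed

lemma entry_munit_times: "entry (munit a b * x) i j = (if i = a then entry x b j else 0)"
proof -
  have "supported (Suc a) (Suc b) (munit a b)" by (rule supported_munit) auto
  then show ?thesis by (auto simp: entry_times entry_munit if_distrib[of "\<lambda>c. c * _"] cong: if_cong)
qed

lemma munit_times_munit: "munit a b * munit c d = (if b = c then munit a d else 0)"
  by (rule fmat_eqI) (simp add: entry_munit_times entry_munit)

lemma fmat_expand:
  assumes "supported n m x"
  shows "x = (\<Sum>i<n. \<Sum>j<m. entry x i j *\<^sub>C munit i j)"
proof (rule fmat_eqI)
  fix i j
  have "entry (\<Sum>i<n. \<Sum>j<m. entry x i j *\<^sub>C munit i j) i j
      = (\<Sum>a<n. \<Sum>b<m. if b = j then (if a = i then entry x i j else 0) else 0)"
    by (simp only: entry_sum entry_scale) (intro sum.cong; auto simp: entry_munit)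
  also have "\<dots> = (if i < n \<and> j < m then entry x i j else 0)"
    by (cases "j < m") simp_all
  also have "\<dots> = entry x i j"
    using assms by (auto simp: supported_def not_less)
  finally show "entry x i j = entry (\<Sum>i<n. \<Sum>j<m. entry x i j *\<^sub>C munit i j) i j" by simp
qed

subsection \<open>Conversion from and to the matrices of the library\<close>

definition of_mat :: "complex mat \<Rightarrow> fmat" where
  "of_mat A = Abs_fmat (\<lambda>i j. if i < dim_row A \<and> j < dim_col A then A $$ (i, j) else 0)"

definition to_mat :: "nat \<Rightarrow> nat \<Rightarrow> fmat \<Rightarrow> complex mat" where
  "to_mat n m x = mat n m (\<lambda>(i, j). entry x i j)"

lemma entry_of_mat [simp]:
  "entry (of_mat A) i j = (if i < dim_row A \<and> j < dim_col A then A $$ (i, j) else 0)"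
  unfolding of_mat_def by (subst entry_Abs_fmat[of "max (dim_row A) (dim_col A)"]) auto

lemma to_mat_carrier [simp]: "to_mat n m x \<in> carrier_mat n m"
  and dim_to_mat [simp]: "dim_row (to_mat n m x) = n" "dim_col (to_mat n m x) = m"
  and index_to_mat [simp]: "i < n \<Longrightarrow> j < m \<Longrightarrow> to_mat n m x $$ (i, j) = entry x i j"
  by (auto simp: to_mat_def)

lemma supported_of_mat: "A \<in> carrier_mat n m \<Longrightarrow> supported n m (of_mat A)"
  by (auto simp: supported_def)

lemma to_mat_of_mat [simp]: "A \<in> carrier_mat n m \<Longrightarrow> to_mat n m (of_mat A) = A"
  by (rule eq_matI) auto

lemma of_mat_to_mat [simp]: "supported n m x \<Longrightarrow> of_mat (to_mat n m x) = x"
  by (rule fmat_eqI) (auto simp: supported_def not_less)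

lemma mat_adjoint_carrier [simp]: "A \<in> carrier_mat n m \<Longrightarrow> mat_adjoint A \<in> carrier_mat m n"
  and dim_mat_adjoint [simp]: "dim_row (mat_adjoint A) = dim_col A" "dim_col (mat_adjoint A) = dim_row A"
  by (auto simp: mat_adjoint_def)

lemma index_mat_adjoint [simp]:
  fixes A :: "complex mat"
  shows "i < dim_col A \<Longrightarrow> j < dim_row A \<Longrightarrow> mat_adjoint A $$ (i, j) = cnj (A $$ (j, i))"
  by (simp add: mat_adjoint_def mat_of_rows_def)

lemma of_mat_add: "A \<in> carrier_mat n m \<Longrightarrow> B \<in> carrier_mat n m \<Longrightarrow> of_mat (A + B) = of_mat A + of_mat B"
  and of_mat_zero [simp]: "of_mat (0\<^sub>m n m) = 0"
  and of_mat_smult [simp]: "of_mat (c \<cdot>\<^sub>m A) = c *\<^sub>C of_mat A"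
  and of_mat_adjoint [simp]: "of_mat (mat_adjoint A) = adj (of_mat A)"
  by (rule fmat_eqI, auto)+

lemma of_mat_mult:
  assumes "A \<in> carrier_mat n m" "B \<in> carrier_mat m l"
  shows "of_mat (A * B) = of_mat A * of_mat B"
proof (rule fmat_eqI)
  fix i j
  show "entry (of_mat (A * B)) i j = entry (of_mat A * of_mat B) i j"
    using assms by (auto simp: entry_times[OF supported_of_mat[OF assms(1)]] scalar_prod_def
      atLeast0LessThan intro!: sum.cong)
qed

lemma of_mat_inject: "A \<in> carrier_mat n m \<Longrightarrow> B \<in> carrier_mat n m \<Longrightarrow> of_mat A = of_mat B \<longleftrightarrow> A = B"
  by (metis to_mat_of_mat)

subsection \<open>Orthogonal idempotents\<close>

text \<open>The elements \<open>w i * y\<close> picked for the indices \<open>i\<close> are fixed by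
  their own idempotent and killed by the others, hence linearly independent. Only left
  multiplication matters, so \<open>B\<close> may span any space that every idempotent
  reaches.\<close>

lemma orthogonal_idempotents_bound:
  assumes I: "finite I" and B: "finite B"
    and idem: "\<And>i. i \<in> I \<Longrightarrow> w i * w i = w i"
    and orth: "\<And>i j. i \<in> I \<Longrightarrow> j \<in> I \<Longrightarrow> i \<noteq> j \<Longrightarrow> w i * w j = 0"
    and ex: "\<And>i. i \<in> I \<Longrightarrow> \<exists>y. w i * y \<noteq> 0 \<and> w i * y \<in> fmat.span B"
  shows "card I \<le> card B"
proof -
  from ex obtain y where y: "\<And>i. i \<in> I \<Longrightarrow> w i * y i \<noteq> 0 \<and> w i * y i \<in> fmat.span B"
    by metis
  define z where "z i = w i * y i" for i
  have wz: "w i * z j = (if i = j then z i else 0)" if "i \<in> I" "j \<in> I" for i j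
    using that idem orth by (simp add: z_def mult.assoc[symmetric])
  have inj: "inj_on z I"
  proof (rule inj_onI)
    fix i j assume ij: "i \<in> I" "j \<in> I" "z i = z j"
    then show "i = j" using wz[of i j] wz[of i i] y[of i] by (auto simp: z_def split: if_splits)
  qed
  have "fmat.independent (z ` I)"
  proof (rule fmat.independent_if_scalars_zero)
    fix f x assume s: "(\<Sum>x\<in>z ` I. f x *\<^sub>C x) = 0" and "x \<in> z ` I"
    then obtain i where i: "i \<in> I" "x = z i" by auto
    have "0 = w i * (\<Sum>x\<in>z ` I. f x *\<^sub>C x)" using s by simp
    also have "\<dots> = (\<Sum>j\<in>I. f (z j) *\<^sub>C (w i * z j))"
      by (simp add: sum.reindex[OF inj] sum_distrib_left)
    also have "\<dots> = (\<Sum>j\<in>I. if j = i then f (z i) *\<^sub>C z i else 0)"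
      using i by (intro sum.cong) (auto simp: wz)
    also have "\<dots> = f x *\<^sub>C x" using i I by simp
    finally show "f x = 0" using y[OF i(1)] i by (simp add: z_def)
  qed (use I in auto)
  moreover have "z ` I \<subseteq> fmat.span B" using y by (auto simp: z_def)
  ultimately have "card (z ` I) \<le> card B"
    using fmat.independent_span_bound[OF B] by blast
  then show ?thesis by (simp add: card_image[OF inj])
qed

text \<open>Right multiplication by \<open>munit b 0\<close> moves column \<open>b\<close> into
  column \<open>0\<close>, so each nonzero idempotent reaches the \<open>n\<close>-dimensional space
  of one-column matrices.\<close>

lemma orthogonal_idempotents_card_le:
  assumes I: "finite I"
    and sup: "\<And>i. i \<in> I \<Longrightarrow> supported n n (w i)"
    and idem: "\<And>i. i \<in> I \<Longrightarrow> w i * w i = w i" and nz: "\<And>i. i \<in> I \<Longrightarrow> w i \<noteq> 0"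
    and orth: "\<And>i j. i \<in> I \<Longrightarrow> j \<in> I \<Longrightarrow> i \<noteq> j \<Longrightarrow> w i * w j = 0"
  shows "card I \<le> n"
proof -
  have "card I \<le> card ((\<lambda>k. munit k 0) ` {..<n})"
  proof (rule orthogonal_idempotents_bound[OF I _ idem orth])
    fix i assume i: "i \<in> I"
    obtain a b where ab: "entry (w i) a b \<noteq> 0"
      using nz[OF i] by (metis entry_zero fmat_eqI)
    have s: "supported n 1 (w i * munit b 0)"
      by (rule supported_times[OF sup[OF i] supported_munit[of b "Suc b"]]) auto
    have "w i * munit b 0 \<noteq> 0"
      using ab by (metis entry_times_munit entry_zero)
    moreover have "w i * munit b 0 \<in> fmat.span ((\<lambda>k. munit k 0) ` {..<n})"
      by (subst fmat_expand[OF s])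
         (auto intro!: fmat.span_sum fmat.span_scale intro: fmat.span_base)
    ultimately show "\<exists>y. w i * y \<noteq> 0 \<and> w i * y \<in> fmat.span ((\<lambda>k. munit k 0) ` {..<n})"
      by blast
  qed auto
  also have "\<dots> \<le> n" using card_image_le[of "{..<n}"] by (metis card_lessThan finite_lessThan)
  finally show ?thesis .
qed

section \<open>Matrix units in star algebras of matrices\<close>

text \<open>The ring has no unit, so the constant term of a polynomial needs a substitute:
  \<open>b\<close> takes this role, and the value is \<open>f(x) b\<close>, computed by Horner's
  scheme. In the application \<open>b\<close> is a projection that acts as a unit on
  \<open>x\<close>.\<close>

definition peval :: "complex poly \<Rightarrow> fmat \<Rightarrow> fmat \<Rightarrow> fmat" where
  "peval f x b = fold_coeffs (\<lambda>a y. a *\<^sub>C b + x * y) f 0"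

lemma peval_0 [simp]: "peval 0 x b = 0"
  by (simp add: peval_def)

lemma peval_pCons [simp]: "peval (pCons a f) x b = a *\<^sub>C b + x * peval f x b"
proof (cases "f = 0")
  case True
  then show ?thesis by (cases "a = 0") (simp_all add: peval_def)
qed (simp add: peval_def)

lemma peval_add [simp]: "peval (f + g) x b = peval f x b + peval g x b"
  by (induction f g rule: poly_induct2) (simp_all add: algebra_simps fmat.scale_left_distrib)

lemma peval_smult [simp]: "peval (smult c f) x b = c *\<^sub>C peval f x b"
  by (induction f) (simp_all add: fmat.scale_right_distrib)

lemma peval_sum: "peval (sum f A) x b = (\<Sum>a\<in>A. peval (f a) x b)"
  by (induction A rule: infinite_finite_induct) simp_all

lemma peval_linear_factor: "peval ([:- l, 1:] * f) x b = x * peval f x b - l *\<^sub>C peval f x b"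
  using peval_add[of "smult (- l) f" "pCons 0 f" x b] peval_smult[of "- l" f x b]
  by (simp del: peval_add peval_smult)

lemma supported_peval: "supported n n x \<Longrightarrow> supported n n b \<Longrightarrow> supported n n (peval f x b)"
  by (induction f) (auto intro: supported_add supported_scale supported_times)

text \<open>The \<open>card B + 1\<close> elements \<open>x^i b\<close> lie in a space spanned by
  \<open>card B\<close> matrix units, and a linear relation between them is a polynomial.\<close>

lemma ex_annihilating_poly:
  assumes "supported n n x" "supported n n b"
  shows "\<exists>f. f \<noteq> 0 \<and> peval f x b = 0"
proof (rule ccontr)
  assume none: "\<not> ?thesis"
  define B where "B = (\<lambda>(i, j). munit i j) ` ({..<n} \<times> {..<n})"
  define y where "y i = peval (monom 1 i) x b" for i
  let ?I = "{..card B}"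
  have y: "peval (monom c i) x b = c *\<^sub>C y i" for c i
    using peval_smult[of c "monom 1 i" x b] by (simp add: y_def smult_monom)
  \<comment> \<open>Independence is a property of a set, so the powers must be seen to be distinct;
    a coincidence would already be an annihilating polynomial.\<close>
  have "peval (monom 1 i - monom 1 j) x b = y i - y j" for i j
    using peval_add[of "monom 1 i - monom 1 j" "monom 1 j" x b] by (simp add: y_def algebra_simps)
  then have inj: "inj_on y ?I"
    using none by (intro inj_onI) (metis eq_iff_diff_eq_0 monom_eq_iff' zero_neq_one)
  have "fmat.independent (y ` ?I)"
  proof (rule fmat.independent_if_scalars_zero)
    fix u z assume s: "(\<Sum>z\<in>y ` ?I. u z *\<^sub>C z) = 0" and "z \<in> y ` ?I"
    then obtain i where i: "i \<in> ?I" "z = y i" by auto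
    let ?f = "\<Sum>i\<in>?I. monom (u (y i)) i"
    have "peval ?f x b = 0"
      using s by (simp add: peval_sum y sum.reindex[OF inj])
    then have "?f = 0" using none by blast
    then have "coeff ?f i = 0" by simp
    then show "u z = 0" using i by (simp add: coeff_sum)
  qed auto
  moreover have "y ` ?I \<subseteq> fmat.span B"
  proof clarify
    fix i
    have "supported n n (y i)" unfolding y_def using assms by (rule supported_peval)
    from fmat_expand[OF this] show "y i \<in> fmat.span B"
      by (metis (no_types, lifting) B_def SigmaI case_prod_conv fmat.span_base fmat.span_scale
          fmat.span_sum imageI)
  qed
  ultimately have "card (y ` ?I) \<le> card B"
    using fmat.independent_span_bound[of B] by (auto simp: B_def)
  then show False by (simp add: card_image[OF inj])
qed

text \<open>A root gives \<open>f = (X - l) g\<close>. Either \<open>g\<close> still annihilates and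
  has smaller degree, or \<open>g(x) b\<close> is nonzero and an eigenvector for
  \<open>l\<close>.\<close>

lemma ex_peval_eigenvector:
  assumes "f \<noteq> 0" "b \<noteq> 0" "peval f x b = 0"
  shows "\<exists>g l. peval g x b \<noteq> 0 \<and> x * peval g x b = l *\<^sub>C peval g x b"
  using assms
proof (induction "degree f" arbitrary: f rule: less_induct)
  case less
  show ?case
  proof (cases "degree f = 0")
    case True
    then obtain c where "f = [:c:]" by (rule degree_eq_zeroE)
    with less.prems show ?thesis by simp
  next
    case False
    then obtain l where "poly f l = 0"
      using fundamental_theorem_of_algebra constant_degree by metis
    then obtain g where g: "f = [:- l, 1:] * g" by (metis dvdE poly_eq_0_iff_dvd)
    show ?thesis
    proof (cases "peval g x b = 0")
      case True
      have "g \<noteq> 0" using g less.prems by auto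
      then have "degree f = Suc (degree g)" unfolding g by (subst degree_mult_eq) auto
      then show ?thesis using less.hyps[of g] True \<open>g \<noteq> 0\<close> less.prems by auto
    next
      case False
      then show ?thesis
        using less.prems(3) unfolding g peval_linear_factor by (metis eq_iff_diff_eq_0)
    qed
  qed
qed

lemma peval_commute: "z * x = x * z \<Longrightarrow> z * b = b * z \<Longrightarrow> z * peval f x b = peval f x b * z"
proof (induction f)
  case (pCons a f)
  then have "z * (x * peval f x b) = x * peval f x b * z"
    by (metis mult.assoc)
  with pCons.prems show ?case by (simp add: algebra_simps)
qed simp

lemma peval_times_eigenvector: "x * c = l *\<^sub>C c \<Longrightarrow> b * c = c \<Longrightarrow> peval f x b * c = poly f l *\<^sub>C c"
  by (induction f) (simp_all add: algebra_simps fmat.scale_left_distrib)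

text \<open>By normality \<open>adj q * q\<close> is idempotent as well, and
  \<open>d = q - adj q * q\<close> satisfies \<open>adj d * d = 0\<close>. Hence \<open>q\<close>
  equals the self-adjoint \<open>adj q * q\<close>.\<close>

lemma normal_idempotent_self_adjoint:
  assumes q: "q * q = q" and n: "adj q * q = q * adj q"
  shows "adj q = q"
proof -
  have a: "adj q * adj q = adj q" using q by (metis adj_times)
  have aq: "adj q * (adj q * q) = adj q * q" "adj q * q * q = adj q * q"
    using a q by (simp_all add: mult.assoc flip: mult.assoc[of "adj q" "adj q" q])
  have "adj q * q * (adj q * q) = adj q * (q * adj q) * q" by (simp add: mult.assoc)
  also have "\<dots> = adj q * q" by (simp add: n[symmetric]) (simp add: aq q mult.assoc)
  finally have "adj (q - adj q * q) * (q - adj q * q) = 0"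
    using aq by (simp add: left_diff_distrib right_diff_distrib)
  then have "q = adj q * q" by (simp del: adj_diff)
  then show ?thesis by (metis adj_adj adj_times)
qed

section \<open>Star algebras of matrices with a unit of their own\<close>

locale matrix_star_algebra =
  fixes n :: nat and S :: "fmat set" and P :: fmat
  assumes supp: "x \<in> S \<Longrightarrow> supported n n x"
    and zero_in [simp, intro]: "0 \<in> S"
    and add_in [intro]: "x \<in> S \<Longrightarrow> y \<in> S \<Longrightarrow> x + y \<in> S"
    and scale_in [intro]: "x \<in> S \<Longrightarrow> c *\<^sub>C x \<in> S"
    and times_in [intro]: "x \<in> S \<Longrightarrow> y \<in> S \<Longrightarrow> x * y \<in> S"
    and adj_in [intro]: "x \<in> S \<Longrightarrow> adj x \<in> S"
    and unit_in [simp, intro]: "P \<in> S"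
    and unit_left: "x \<in> S \<Longrightarrow> P * x = x"
    and unit_right: "x \<in> S \<Longrightarrow> x * P = x"
begin

lemma diff_in [intro]: "x \<in> S \<Longrightarrow> y \<in> S \<Longrightarrow> x - y \<in> S"
  using add_in[of x "(-1) *\<^sub>C y"] scale_in[of y "-1"] by simp

lemma sum_in: "(\<And>a. a \<in> A \<Longrightarrow> f a \<in> S) \<Longrightarrow> sum f A \<in> S"
  by (induction A rule: infinite_finite_induct) auto

lemma peval_in: "x \<in> S \<Longrightarrow> b \<in> S \<Longrightarrow> peval f x b \<in> S"
  by (induction f) auto

lemma adj_unit: "adj P = P"
  using unit_left[of "adj P"] by (metis adj_adj adj_in adj_times unit_in)

lemma unit_idem: "P * P = P"
  by (rule unit_left) simp

definition projections :: "fmat set" where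
  "projections = {p \<in> S. adj p = p \<and> p * p = p \<and> p \<noteq> 0}"

definition minimal :: "fmat \<Rightarrow> bool" where
  "minimal p \<longleftrightarrow> (\<forall>x\<in>S. \<exists>c. p * x * p = c *\<^sub>C p)"

text \<open>The compression \<open>p * z * p\<close> is a combination of two self-adjoint parts;
  were both scalar multiples of \<open>p\<close>, so would it be.\<close>

lemma hermitian_nonscalar:
  assumes p: "p \<in> projections" and nm: "\<not> minimal p"
  obtains x where "x \<in> S" "adj x = x" "p * x = x" "x * p = x" "\<And>c. x \<noteq> c *\<^sub>C p"
proof -
  from p have pS: "p \<in> S" "adj p = p" "p * p = p" by (auto simp: projections_def)
  from nm obtain z where z: "z \<in> S" "\<And>c. p * z * p \<noteq> c *\<^sub>C p" by (auto simp: minimal_def)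
  define y where "y = p * z * p"
  have y: "y \<in> S" "p * y = y" "y * p = y" "p * adj y = adj y" "adj y * p = adj y"
    using pS z by (auto simp: y_def mult.assoc) (simp_all add: mult.assoc[symmetric])
  define h k where "h = y + adj y" and "k = \<i> *\<^sub>C (y - adj y)"
  have yhk: "y = (1/2) *\<^sub>C h + (- \<i>/2) *\<^sub>C k"
    by (rule fmat_eqI) (simp add: h_def k_def field_simps)
  moreover have "h \<in> S" "adj h = h" "p * h = h" "h * p = h"
    using y by (auto simp: h_def algebra_simps)
  moreover have "k \<in> S" "adj k = k" "p * k = k" "k * p = k"
    using y by (auto simp: k_def algebra_simps intro!: fmat_eqI)
  moreover have False if "h = c *\<^sub>C p" "k = d *\<^sub>C p" for c d
    using z(2)[of "(1/2) * c + (- \<i>/2) * d"] yhk unfolding that y_def[symmetric]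
    by (simp add: fmat.scale_left_distrib fmat.scale_left_diff_distrib)
  ultimately show thesis using that[of h] that[of k] by blast
qed

text \<open>An eigenvector \<open>b\<close> of multiplication by a self-adjoint \<open>x\<close> is sought inside the algebra generated by
  \<open>x\<close>; it is normal with \<open>b * b\<close> a nonzero multiple of \<open>b\<close>, so a multiple of it is a spectral projection.\<close>

lemma split_projection:
  assumes p: "p \<in> projections" and nm: "\<not> minimal p"
  obtains q where "q \<in> projections" "q \<noteq> p" "p * q = q" "q * p = q"
proof -
  from p have pS: "p \<in> S" "adj p = p" "p * p = p" "p \<noteq> 0" by (auto simp: projections_def)
  obtain x where x: "x \<in> S" "adj x = x" "p * x = x" "x * p = x" "\<And>c. x \<noteq> c *\<^sub>C p"
    using hermitian_nonscalar[OF p nm] by blast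
  obtain f where "f \<noteq> 0" "peval f x p = 0"
    using ex_annihilating_poly[OF supp[OF x(1)] supp[OF pS(1)]] by blast
  then obtain g l where g: "peval g x p \<noteq> 0" "x * peval g x p = l *\<^sub>C peval g x p"
    using ex_peval_eigenvector pS by blast
  define b where "b = peval g x p"
  have bS: "b \<in> S" and b0: "b \<noteq> 0" and xb: "x * b = l *\<^sub>C b"
    using g x pS by (auto simp: b_def peval_in)
  have pb: "p * b = b"
    unfolding b_def by (induction g) (simp_all add: algebra_simps pS x(3) flip: mult.assoc)
  have bp: "b * p = b"
    using peval_commute[of p x p g] x pS pb by (simp add: b_def)
  have bx: "b * x = x * b"
    using peval_commute[of x x p g] x by (simp add: b_def)
  have "x * adj b = adj b * x"
    using arg_cong[OF bx, of adj] x(2) by simp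
  moreover have "p * adj b = adj b * p"
    using arg_cong[OF pb, of adj] arg_cong[OF bp, of adj] pS by simp
  ultimately have normal: "adj b * b = b * adj b"
    unfolding b_def using peval_commute[of "adj (peval g x p)" x p g] by simp
  define m where "m = poly g l"
  have bb: "b * b = m *\<^sub>C b"
    using peval_times_eigenvector[OF xb pb] by (simp add: b_def m_def)
  \<comment> \<open>Normality excludes nilpotency: \<open>b * b = 0\<close> would give
    \<open>adj y * y = 0\<close> for \<open>y = adj b * b\<close>, hence
    \<open>b = 0\<close>.\<close>
  have "m \<noteq> 0"
  proof
    assume "m = 0"
    then have "b * b = 0" using bb by simp
    then have "adj (adj b * b) * (adj b * b) = 0"
      using normal by (metis adj_adj adj_times mult.assoc mult_zero_right)
    then show False using b0 by (simp del: adj_times)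
  qed
  define q where "q = (1 / m) *\<^sub>C b"
  have "q * q = q" using \<open>m \<noteq> 0\<close> by (simp add: q_def bb)
  moreover have "adj q * q = q * adj q" by (simp add: q_def normal mult.commute)
  ultimately have q: "adj q = q" "q * q = q" "q \<in> S" "q \<noteq> 0"
    using normal_idempotent_self_adjoint by (blast, blast) (use bS b0 \<open>m \<noteq> 0\<close> in \<open>auto simp: q_def\<close>)
  \<comment> \<open>If \<open>q\<close> were all of \<open>p\<close>, then \<open>x = x * p\<close>
    would be \<open>l\<close> times \<open>p\<close>, against the choice of
    \<open>x\<close>.\<close>
  have "q \<noteq> p"
  proof
    assume "q = p"
    moreover have "x * q = l *\<^sub>C q" by (simp add: q_def xb)
    ultimately have "x = l *\<^sub>C p" using x(4) by simp
    then show False using x(5) by blast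
  qed
  then show thesis using q pb bp by (intro that[of q]) (auto simp: projections_def q_def)
qed

section \<open>Orthogonal decompositions of the unit and equivalence of minimal projections\<close>

definition decomposition :: "fmat set \<Rightarrow> bool" where
  "decomposition F \<longleftrightarrow> finite F \<and> F \<subseteq> projections \<and>
     (\<forall>p\<in>F. \<forall>q\<in>F. p \<noteq> q \<longrightarrow> p * q = 0) \<and> \<Sum>F = P"

lemma decomposition_card: "decomposition F \<Longrightarrow> card F \<le> n"
  by (rule orthogonal_idempotents_card_le[where w = "\<lambda>p. p"])
     (auto simp: decomposition_def projections_def supp)

text \<open>A non-minimal \<open>p\<close> is replaced by a proper subprojection \<open>q\<close>
  and its complement \<open>p - q\<close>. Both are orthogonal to the other members because these
  are orthogonal to \<open>p\<close>.\<close>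

lemma refine_decomposition:
  assumes F: "decomposition F" and p: "p \<in> F" "\<not> minimal p"
  shows "\<exists>G. decomposition G \<and> card F < card G"
proof -
  have pp: "p \<in> projections" using F p by (auto simp: decomposition_def)
  obtain q where q: "q \<in> projections" "q \<noteq> p" "p * q = q" "q * p = q"
    using split_projection[OF pp p(2)] by blast
  note pr = pp[unfolded projections_def] q(1)[unfolded projections_def]
  let ?r = "p - q"
  let ?G = "insert q (insert ?r (F - {p}))"
  have r: "?r \<in> projections" "p * ?r = ?r" "?r * p = ?r" "q * ?r = 0" "?r * q = 0"
    using pr q by (auto simp: projections_def algebra_simps)
  have orth: "x * y = 0" if "x \<in> F" "y \<in> F" "x \<noteq> y" for x y
    using F that by (auto simp: decomposition_def)
  have qs: "q * s = 0" "s * q = 0" "?r * s = 0" "s * ?r = 0" if "s \<in> F - {p}" for s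
  proof -
    have "p * s = 0" "s * p = 0" using orth that p by auto
    then show "q * s = 0" "s * q = 0" "?r * s = 0" "s * ?r = 0"
      using q r by (metis mult.assoc mult_zero_left mult_zero_right)+
  qed
  \<comment> \<open>A nonzero idempotent is not orthogonal to itself, so the new projections cannot
    occur among the members orthogonal to them, and the cardinality really grows.\<close>
  have notin: "q \<notin> F - {p}" "?r \<notin> F - {p}" "q \<noteq> ?r"
    using qs r pr by (force simp: projections_def)+
  have fin: "finite F" using F by (simp add: decomposition_def)
  have "\<Sum>?G = q + (?r + \<Sum>(F - {p}))" using fin notin by simp
  also have "\<dots> = \<Sum>F" using fin p by (simp add: sum.remove[of F p])
  finally have "\<Sum>?G = P" using F by (simp add: decomposition_def)
  moreover have "?G \<subseteq> projections" using F r q by (auto simp: decomposition_def)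
  moreover have "\<forall>x\<in>?G. \<forall>y\<in>?G. x \<noteq> y \<longrightarrow> x * y = 0"
    using qs r orth by auto
  moreover have "card ?G = Suc (card F)"
    using fin notin p by (simp add: card_Suc_Diff1 del: card_Diff_insert)
  ultimately show ?thesis using fin by (intro exI[of _ ?G]) (auto simp: decomposition_def)
qed

lemma minimal_decomposition: "\<exists>F. decomposition F \<and> (\<forall>p\<in>F. minimal p)"
proof -
  \<comment> \<open>Members of a decomposition are nonzero, so for \<open>P = 0\<close> the start
    has to be the empty set.\<close>
  have "decomposition (if P = 0 then {} else {P})"
    by (auto simp: decomposition_def projections_def adj_unit unit_idem)
  then obtain F where "decomposition F" "\<forall>G. decomposition G \<longrightarrow> card G \<le> card F"
    using ex_has_greatest_nat[of decomposition _ card "Suc n"] decomposition_card by (metis less_Suc_eq_le)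
  then show ?thesis using refine_decomposition by (metis not_less)
qed

text \<open>Polar decomposition with a scalar modulus: for \<open>w = p * x * q\<close>, minimality
  of \<open>q\<close> makes \<open>adj w * w\<close> a multiple \<open>c\<close> of
  \<open>q\<close>, positivity permits division by the square root of \<open>c\<close>, and
  minimality of \<open>p\<close> settles the product in the other order.\<close>

lemma partial_isometry:
  assumes p: "p \<in> projections" "minimal p" and q: "q \<in> projections" "minimal q"
    and x: "x \<in> S" "p * x * q \<noteq> 0"
  shows "\<exists>v\<in>S. p * v = v \<and> v * q = v \<and> v * adj v = p \<and> adj v * v = q"
proof -
  note pr = p(1)[unfolded projections_def] q(1)[unfolded projections_def]
  define w where "w = p * x * q"
  have w: "w \<in> S" "p * w = w" "w * q = w" "w \<noteq> 0"
    using pr x by (auto simp: w_def mult.assoc) (simp add: mult.assoc[symmetric])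
  have "adj w * w = q * (adj x * p * x) * q"
    using pr by (simp add: w_def mult.assoc) (simp add: mult.assoc[symmetric])
  then obtain c where c: "adj w * w = c *\<^sub>C q"
    using q(2) x pr unfolding minimal_def by (metis (no_types, lifting) adj_in mem_Collect_eq times_in)
  \<comment> \<open>Since \<open>q = adj q * q\<close>, some diagonal entry of \<open>q\<close> is
    positive. The same entry of \<open>adj w * w\<close> is nonnegative, so \<open>c\<close> is the
    quotient of two real numbers.\<close>
  obtain j s where s: "entry (adj q * q) j j = of_real s" "s > 0"
    using adj_times_self_pos pr by blast
  obtain r where r: "entry (adj w * w) j j = of_real r" "r \<ge> 0"
    using adj_times_self_nonneg by blast
  have "of_real r = c * of_real s"
    using r s pr unfolding c by simp
  then have cr: "c = of_real (r / s)" using s by simp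
  have "c \<noteq> 0" using c w(4) by (metis adj_times_self_eq_0_iff fmat.scale_zero_left)
  then have rs: "r / s > 0" using cr r s by (simp add: less_le)
  define t where "t = 1 / sqrt (r / s)"
  define v where "v = of_real t *\<^sub>C w"
  have "t * t * (r / s) = 1"
    using rs unfolding t_def by (metis (no_types, lifting) abs_of_pos less_irrefl mult_1 nonzero_eq_divide_eq
        real_sqrt_mult_self times_divide_times_eq)
  then have one: "of_real t * of_real t * c = 1"
    unfolding cr by (metis of_real_1 of_real_mult)
  have v: "v \<in> S" "p * v = v" "v * q = v" using w by (auto simp: v_def)
  have vv: "adj v * v = q"
    using one unfolding v_def by (simp add: c mult.assoc)
  have "adj v * p = adj v" using arg_cong[OF v(2), of adj] pr by simp
  then have "v * adj v = p * (v * adj v) * p"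
    using v(2) by (simp add: mult.assoc) (simp add: mult.assoc[symmetric])
  then obtain d where d: "v * adj v = d *\<^sub>C p"
    using p(2) v(1) unfolding minimal_def by (metis adj_in times_in)
  \<comment> \<open>As \<open>v * adj v = d *\<^sub>C p\<close> is idempotent, \<open>d\<close> is
    \<open>0\<close> or \<open>1\<close>.\<close>
  have "v * adj v * (v * adj v) = v * (adj v * v) * adj v" by (simp add: mult.assoc)
  also have "\<dots> = v * adj v" by (simp add: vv v)
  finally have "d * d = d" using pr unfolding d by simp
  moreover have "d \<noteq> 0"
  proof
    assume "d = 0"
    then have "adj (adj v) * adj v = 0" using d by simp
    then have "v = 0" by (simp del: adj_adj)
    then show False using vv pr by simp
  qed
  ultimately have "v * adj v = p" using d by simp
  then show ?thesis using v vv by blast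
qed

end

text \<open>Here \<open>rep\<close> picks one minimal projection in each equivalence class, and
  \<open>v p\<close> is a partial isometry with source \<open>rep p\<close> and range
  \<open>p\<close>; within a class the \<open>v p * adj (v q)\<close> are matrix units. The elements
  of \<open>F\<close> serve only as labels in the axioms, and the two compression axioms say that
  \<open>S\<close> is block diagonal.\<close>

locale matrix_unit_system = matrix_star_algebra +
  fixes F :: "fmat set" and rep :: "fmat \<Rightarrow> fmat" and v :: "fmat \<Rightarrow> fmat"
  assumes finite_F: "finite F"
    and v_in: "p \<in> F \<Longrightarrow> v p \<in> S"
    and v_orth: "p \<in> F \<Longrightarrow> q \<in> F \<Longrightarrow> p \<noteq> q \<Longrightarrow> adj (v p) * v q = 0"
    and v_norm: "p \<in> F \<Longrightarrow> adj (v p) * v p = rep p"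
    and v_rep: "p \<in> F \<Longrightarrow> v p * rep p = v p"
    and rep_nonzero: "p \<in> F \<Longrightarrow> rep p \<noteq> 0"
    and compress_eq: "x \<in> S \<Longrightarrow> p \<in> F \<Longrightarrow> q \<in> F \<Longrightarrow> rep p = rep q \<Longrightarrow>
      \<exists>c. adj (v p) * x * v q = c *\<^sub>C rep p"
    and compress_neq: "x \<in> S \<Longrightarrow> p \<in> F \<Longrightarrow> q \<in> F \<Longrightarrow> rep p \<noteq> rep q \<Longrightarrow>
      adj (v p) * x * v q = 0"
    and v_sum: "(\<Sum>p\<in>F. v p * adj (v p)) = P"

context matrix_star_algebra
begin

text \<open>The relation \<open>E\<close> joins projections by a nonzero element of
  \<open>S\<close>, which by \<open>partial_isometry\<close> can be replaced by a partial isometry.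
  So \<open>E\<close> is Murray-von Neumann equivalence on \<open>F\<close>.\<close>

theorem ex_matrix_unit_system: "\<exists>F rep v. matrix_unit_system n S P F rep v"
proof -
  obtain F where F: "decomposition F" "\<And>p. p \<in> F \<Longrightarrow> minimal p"
    using minimal_decomposition by blast
  then have pr: "p \<in> S" "adj p = p" "p * p = p" "p \<noteq> 0" "p \<in> projections" if "p \<in> F" for p
    using that by (auto simp: decomposition_def projections_def)
  define E where "E p q \<longleftrightarrow> p \<in> F \<and> q \<in> F \<and> (\<exists>x\<in>S. p * x * q \<noteq> 0)" for p q
  have isom: "\<exists>v\<in>S. p * v = v \<and> v * q = v \<and> v * adj v = p \<and> adj v * v = q" if "E p q" for p q
  proof -
    from that obtain x where "p \<in> F" "q \<in> F" "x \<in> S" "p * x * q \<noteq> 0" by (auto simp: E_def)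
    then show ?thesis by (intro partial_isometry[of p q x] F(2) pr(5))
  qed
  have refl: "E p p" if "p \<in> F" for p
    unfolding E_def using that pr by (auto intro!: bexI[of _ p])
  have sym: "E q p" if "E p q" for p q
  proof -
    from that obtain x where x: "p \<in> F" "q \<in> F" "x \<in> S" "p * x * q \<noteq> 0" by (auto simp: E_def)
    then have "adj (p * x * q) \<noteq> 0" by (simp del: adj_times)
    then have "q * adj x * p \<noteq> 0" using x pr by (simp add: mult.assoc)
    then show ?thesis using x by (auto simp: E_def)
  qed
  \<comment> \<open>A product of nonzero elements may vanish, but for partial isometries with
    matching projections \<open>adj (a * b) * (a * b)\<close> is the nonzero
    \<open>r\<close>.\<close>
  have trans: "E p r" if pq: "E p q" and qr: "E q r" for p q r
  proof -
    obtain a where a: "a \<in> S" "p * a = a" "adj a * a = q" using isom[OF pq] by blast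
    obtain b where b: "b \<in> S" "q * b = b" "b * r = b" "adj b * b = r" using isom[OF qr] by blast
    have "adj (a * b) * (a * b) = adj b * (adj a * a) * b" by (simp add: mult.assoc)
    also have "\<dots> = r" using a b by (simp add: mult.assoc)
    finally have "a * b \<noteq> 0" using qr pr by (auto simp: E_def)
    moreover have "p * (a * b) * r = a * b" using a b by (simp add: mult.assoc) (simp add: mult.assoc[symmetric])
    ultimately show ?thesis using pq qr a b unfolding E_def by (metis times_in)
  qed
  define rep where "rep p = (SOME q. E p q)" for p
  have rep: "E p (rep p)" if "p \<in> F" for p
    unfolding rep_def using refl[OF that] by (rule someI)
  have rep_eq: "rep p = rep q" if "E p q" for p q
  proof -
    \<comment> \<open>Equivalent projections define the same predicate, so the choice operator
      returns the same representative for both.\<close>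
    have "E p = E q" using that sym trans by blast
    then show ?thesis by (simp add: rep_def)
  qed
  have "\<forall>p\<in>F. \<exists>v\<in>S. p * v = v \<and> v * rep p = v \<and> v * adj v = p \<and> adj v * v = rep p"
    using isom rep by blast
  then obtain v where v: "\<And>p. p \<in> F \<Longrightarrow> v p \<in> S" "\<And>p. p \<in> F \<Longrightarrow> p * v p = v p"
    "\<And>p. p \<in> F \<Longrightarrow> v p * rep p = v p" "\<And>p. p \<in> F \<Longrightarrow> v p * adj (v p) = p"
    "\<And>p. p \<in> F \<Longrightarrow> adj (v p) * v p = rep p"
    by metis
  have repF: "rep p \<in> F" if "p \<in> F" for p using rep[OF that] by (simp add: E_def)
  have av: "adj (v p) * p = adj (v p)" "rep p * adj (v p) = adj (v p)" if "p \<in> F" for p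
    using arg_cong[OF v(2)[OF that], of adj] arg_cong[OF v(3)[OF that], of adj] pr[OF that]
      pr[OF repF[OF that]] by simp_all
  \<comment> \<open>Inserting the ranges \<open>p\<close> and \<open>q\<close> shows that
    compressions between inequivalent projections vanish; inserting the sources \<open>rep p\<close>
    and \<open>rep q\<close> makes those within a class scalar by minimality.\<close>
  have comp: "adj (v p) * x * v q = adj (v p) * (p * x * q) * v q" if "p \<in> F" "q \<in> F" for p q x
    using that av v by (simp add: mult.assoc) (simp add: mult.assoc[symmetric])
  have comp': "adj (v p) * x * v q = rep p * (adj (v p) * x * v q) * rep q" if "p \<in> F" "q \<in> F" for p q x
    using that av v by (simp add: mult.assoc) (simp add: mult.assoc[symmetric])
  have "matrix_unit_system n S P F rep v"
  proof unfold_locales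
    show "finite F" using F by (simp add: decomposition_def)
    show "adj (v p) * v q = 0" if "p \<in> F" "q \<in> F" "p \<noteq> q" for p q
    proof -
      have "p * q = 0" using F(1) that by (auto simp: decomposition_def)
      moreover have "adj (v p) * v q = adj (v p) * (p * q) * v q"
        using that av v by (simp add: mult.assoc) (simp add: mult.assoc[symmetric])
      ultimately show ?thesis by simp
    qed
    show "\<exists>c. adj (v p) * x * v q = c *\<^sub>C rep p"
      if "x \<in> S" "p \<in> F" "q \<in> F" "rep p = rep q" for x p q
    proof -
      have "adj (v p) * x * v q \<in> S" using that v by auto
      then show ?thesis
        using comp'[OF that(2,3), of x] F(2)[OF repF[OF that(2)]] that(4) unfolding minimal_def
        by metis
    qed
    show "adj (v p) * x * v q = 0" if "x \<in> S" "p \<in> F" "q \<in> F" "rep p \<noteq> rep q" for x p q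
    proof -
      have "\<not> E p q" using that rep_eq by blast
      then have "p * x * q = 0" using that by (auto simp: E_def)
      then show ?thesis using comp[OF that(2,3), of x] by simp
    qed
    show "(\<Sum>p\<in>F. v p * adj (v p)) = P"
      using F(1) v(4) by (simp add: decomposition_def)
  qed (use v pr repF in auto)
  then show ?thesis by blast
qed

end

section \<open>Embeddings between direct sums of matrix algebras\<close>

text \<open>The field \<open>one\<close> is ignored by homomorphisms; it is filled with an arbitrary value.\<close>

definition fmat_algebra :: "fmat set \<Rightarrow> fmat star_algebra" where
  "fmat_algebra S =
     \<lparr>carrier = S, monoid.mult = (*), one = 0, zero = 0, add = (+), module.smult = (*\<^sub>C), star = adj\<rparr>"

lemma fmat_algebra_simps [simp]:
  "carrier (fmat_algebra S) = S" "x \<otimes>\<^bsub>fmat_algebra S\<^esub> y = x * y" "x \<oplus>\<^bsub>fmat_algebra S\<^esub> y = x + y"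
  "c \<odot>\<^bsub>fmat_algebra S\<^esub> x = c *\<^sub>C x" "star (fmat_algebra S) x = adj x"
  by (simp_all add: fmat_algebra_def)

lemma matrix_algebra_simps [simp]:
  "carrier (matrix_algebra n) = carrier_mat n n" "x \<otimes>\<^bsub>matrix_algebra n\<^esub> y = x * y"
  "x \<oplus>\<^bsub>matrix_algebra n\<^esub> y = x + y" "c \<odot>\<^bsub>matrix_algebra n\<^esub> x = c \<cdot>\<^sub>m x"
  "star (matrix_algebra n) x = mat_adjoint x"
  by (simp_all add: matrix_algebra_def)

lemma matrix_algebra_sum_simps:
  "xs \<in> carrier (matrix_algebra_sum ds) \<longleftrightarrow>
     length xs = length ds \<and> (\<forall>j<length ds. xs ! j \<in> carrier_mat (ds ! j) (ds ! j))"
  "xs \<otimes>\<^bsub>matrix_algebra_sum ds\<^esub> ys = map2 (*) xs ys"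
  "xs \<oplus>\<^bsub>matrix_algebra_sum ds\<^esub> ys = map2 (+) xs ys"
  "c \<odot>\<^bsub>matrix_algebra_sum ds\<^esub> xs = map (\<lambda>x. c \<cdot>\<^sub>m x) xs"
  "star (matrix_algebra_sum ds) xs = map mat_adjoint xs"
  by (auto simp: matrix_algebra_sum_def list_all2_conv_all_nth)

section \<open>Composition and inversion of homomorphisms\<close>

lemma star_hom_comp: "star_hom A B f \<Longrightarrow> star_hom B C g \<Longrightarrow> star_hom A C (g \<circ> f)"
  unfolding star_hom_def by simp

lemma star_embeds_trans:
  assumes "star_embeds A B" "star_embeds B C"
  shows "star_embeds A C"
proof -
  obtain f g where f: "star_hom A B f" "inj_on f (carrier A)"
    and g: "star_hom B C g" "inj_on g (carrier B)"
    using assms by (auto simp: star_embeds_def)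
  have "inj_on (g \<circ> f) (carrier A)"
    using f g by (auto simp: star_hom_def intro!: comp_inj_on inj_on_subset[OF g(2)])
  then show ?thesis using star_hom_comp[OF f(1) g(1)] by (auto simp: star_embeds_def)
qed

lemma star_isomorphic_trans: "star_isomorphic A B \<Longrightarrow> star_isomorphic B C \<Longrightarrow> star_isomorphic A C"
  unfolding star_isomorphic_def using star_hom_comp bij_betw_trans by blast

lemma star_isomorphic_imp_embeds: "star_isomorphic A B \<Longrightarrow> star_embeds A B"
  unfolding star_isomorphic_def star_embeds_def bij_betw_def by auto

text \<open>A record carries no closure axioms and \<open>star_hom\<close> asserts nothing about
  closure of its source. To see that the inverse of a bijective homomorphism respects the
  operations, their results must be known to lie in the carrier.\<close>

definition operations_closed :: "'a star_algebra \<Rightarrow> bool" where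
  "operations_closed A \<longleftrightarrow> (\<forall>x\<in>carrier A. \<forall>y\<in>carrier A. \<forall>c. x \<oplus>\<^bsub>A\<^esub> y \<in> carrier A \<and>
     x \<otimes>\<^bsub>A\<^esub> y \<in> carrier A \<and> c \<odot>\<^bsub>A\<^esub> x \<in> carrier A \<and> star A x \<in> carrier A)"

lemma star_isomorphic_sym:
  assumes A: "operations_closed A" and iso: "star_isomorphic A B"
  shows "star_isomorphic B A"
proof -
  obtain f where f: "star_hom A B f" "bij_betw f (carrier A) (carrier B)"
    using iso by (auto simp: star_isomorphic_def)
  define g where "g = inv_into (carrier A) f"
  have g: "g y \<in> carrier A" "f (g y) = y" if "y \<in> carrier B" for y
    using f(2) that by (auto simp: g_def bij_betw_def inv_into_into f_inv_into_f)
  have gf: "g (f x) = x" if "x \<in> carrier A" for x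
    using f(2) that by (auto simp: g_def bij_betw_def)
  have "star_hom B A g"
    unfolding star_hom_def
  proof (intro conjI ballI allI)
    fix x y c assume x: "x \<in> carrier B" and y: "y \<in> carrier B"
    note * = g[OF x] g[OF y] f(1)[unfolded star_hom_def] A[unfolded operations_closed_def]
    show "g (x \<oplus>\<^bsub>B\<^esub> y) = g x \<oplus>\<^bsub>A\<^esub> g y" using * gf[of "g x \<oplus>\<^bsub>A\<^esub> g y"] by simp
    show "g (x \<otimes>\<^bsub>B\<^esub> y) = g x \<otimes>\<^bsub>A\<^esub> g y" using * gf[of "g x \<otimes>\<^bsub>A\<^esub> g y"] by simp
  next
    fix x c assume x: "x \<in> carrier B"
    note * = g[OF x] f(1)[unfolded star_hom_def] A[unfolded operations_closed_def]
    show "g (c \<odot>\<^bsub>B\<^esub> x) = c \<odot>\<^bsub>A\<^esub> g x" using * gf[of "c \<odot>\<^bsub>A\<^esub> g x"] by simp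
    show "g (star B x) = star A (g x)" using * gf[of "star A (g x)"] by simp
    show "g x \<in> carrier A" using * by simp
  qed
  moreover have "bij_betw g (carrier B) (carrier A)"
    unfolding g_def using f(2) by (rule bij_betw_inv_into)
  ultimately show ?thesis by (auto simp: star_isomorphic_def)
qed

lemma operations_closed_matrix_algebra_sum: "operations_closed (matrix_algebra_sum ds)"
  by (auto simp: operations_closed_def matrix_algebra_sum_simps intro!: add_carrier_mat mult_carrier_mat)

lemma operations_closed_matrix_algebra: "operations_closed (matrix_algebra n)"
  by (auto simp: operations_closed_def)

text \<open>Block sizes are prescribed as a list but known only as a multiset of sizes of classes;
  this arranges the classes in the order of the list.\<close>

lemma ex_preimage_list: "image_mset f M = mset ts \<Longrightarrow> \<exists>rs. mset rs = M \<and> map f rs = ts"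
proof (induction ts arbitrary: M)
  case (Cons t ts)
  then obtain r M' where M: "M = add_mset r M'" "f r = t" "image_mset f M' = mset ts"
    using msed_map_invR[of f M t "mset ts"] by auto
  then obtain rs where "mset rs = M'" "map f rs = ts" using Cons.IH by blast
  with M show ?case by (intro exI[of _ "r # rs"]) simp
qed simp

definition unit_combination :: "(nat \<Rightarrow> nat \<Rightarrow> fmat) \<Rightarrow> nat \<Rightarrow> complex mat \<Rightarrow> fmat" where
  "unit_combination e d X = (\<Sum>k<d. \<Sum>l<d. X $$ (k, l) *\<^sub>C e k l)"

lemma unit_combination_mult:
  assumes e: "\<And>k l k' l'. k < d \<Longrightarrow> l < d \<Longrightarrow> k' < d \<Longrightarrow> l' < d \<Longrightarrow>
      e k l * e k' l' = (if l = k' then e k l' else 0)"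
    and X: "X \<in> carrier_mat d d" and Y: "Y \<in> carrier_mat d d"
  shows "unit_combination e d X * unit_combination e d Y = unit_combination e d (X * Y)"
proof -
  have "unit_combination e d X * unit_combination e d Y =
      (\<Sum>k<d. \<Sum>k'<d. \<Sum>l<d. \<Sum>l'<d. (X $$ (k, l) * Y $$ (k', l')) *\<^sub>C (e k l * e k' l'))"
    by (simp add: unit_combination_def sum_product mult.commute)
  also have "\<dots> = (\<Sum>k<d. \<Sum>k'<d. \<Sum>l<d. if l = k' then
      (\<Sum>l'<d. (X $$ (k, l) * Y $$ (l, l')) *\<^sub>C e k l') else 0)"
    by (intro sum.cong refl) (auto simp: e)
  also have "\<dots> = (\<Sum>k<d. \<Sum>k'<d. \<Sum>l'<d. (X $$ (k, k') * Y $$ (k', l')) *\<^sub>C e k l')"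
    by simp
  also have "\<dots> = (\<Sum>k<d. \<Sum>l'<d. \<Sum>k'<d. (X $$ (k, k') * Y $$ (k', l')) *\<^sub>C e k l')"
    by (rule sum.cong[OF refl], rule sum.swap)
  also have "\<dots> = unit_combination e d (X * Y)"
    unfolding unit_combination_def using X Y
    by (intro sum.cong refl) (auto simp: scalar_prod_def fmat.scale_sum_left atLeast0LessThan)
  finally show ?thesis .
qed

context matrix_unit_system
begin

lemma rep_idem: "p \<in> F \<Longrightarrow> rep p * rep p = rep p"
  using v_norm v_rep by (metis mult.assoc)

text \<open>Peirce decomposition: the unit is inserted on both sides as the sum of the
  \<open>v p * adj (v p)\<close>.\<close>

lemma times_v_expand: "x \<in> S \<Longrightarrow> x = (\<Sum>p\<in>F. \<Sum>q\<in>F. v p * (adj (v p) * x * v q) * adj (v q))"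
proof -
  assume x: "x \<in> S"
  have "x = P * x * P" using x by (simp add: unit_left unit_right)
  also have "\<dots> = (\<Sum>p\<in>F. \<Sum>q\<in>F. (v p * adj (v p)) * x * (v q * adj (v q)))"
    unfolding v_sum[symmetric] by (simp add: sum_distrib_left sum_distrib_right)
      (rule sum.swap)
  finally show ?thesis by (simp add: mult.assoc)
qed

definition block_size :: "fmat \<Rightarrow> nat" where
  "block_size r = card {p \<in> F. rep p = r}"

text \<open>For each \<open>j\<close>, the \<open>\<beta> j k\<close> with \<open>k < ts ! j\<close> are equivalent projections. Different \<open>j\<close> may
  share an equivalence class: this is how several copies of a small matrix algebra are placed along the
  diagonal of a larger one.\<close>

definition mixed_units :: "nat list \<Rightarrow> (nat \<Rightarrow> nat \<Rightarrow> fmat) \<Rightarrow> bool" where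
  "mixed_units ts \<beta> \<longleftrightarrow> inj_on (\<lambda>(j, k). \<beta> j k) (SIGMA j:{..<length ts}. {..<ts ! j}) \<and>
     (\<forall>j<length ts. \<forall>k<ts ! j. \<beta> j k \<in> F \<and> rep (\<beta> j k) = rep (\<beta> j 0))"

definition unit_hom :: "nat list \<Rightarrow> (nat \<Rightarrow> nat \<Rightarrow> fmat) \<Rightarrow> complex mat list \<Rightarrow> fmat" where
  "unit_hom ts \<beta> Xs =
     (\<Sum>j<length ts. unit_combination (\<lambda>k l. v (\<beta> j k) * adj (v (\<beta> j l))) (ts ! j) (Xs ! j))"

context
  fixes ts \<beta>
  assumes \<beta>: "mixed_units ts \<beta>"
begin

lemma mixed_unitsD:
  assumes "j < length ts" "k < ts ! j"
  shows "\<beta> j k \<in> F" "rep (\<beta> j k) = rep (\<beta> j 0)"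
  using \<beta> assms unfolding mixed_units_def by blast+

lemma adj_v_times_v:
  assumes "i < length ts" "k < ts ! i" "j < length ts" "l < ts ! j"
  shows "adj (v (\<beta> i k)) * v (\<beta> j l) = (if i = j \<and> k = l then rep (\<beta> i 0) else 0)"
proof (cases "i = j \<and> k = l")
  case True
  then show ?thesis
    using v_norm[OF mixed_unitsD(1)[OF assms(1,2)]] mixed_unitsD(2)[OF assms(1,2)] by simp
next
  case False
  then have "\<beta> i k \<noteq> \<beta> j l"
    using \<beta> assms unfolding mixed_units_def inj_on_def by auto
  then show ?thesis
    using False v_orth[OF mixed_unitsD(1)[OF assms(1,2)] mixed_unitsD(1)[OF assms(3,4)]] by auto
qed

lemma unit_products:
  assumes "i < length ts" "k < ts ! i" "l < ts ! i" "j < length ts" "k' < ts ! j" "l' < ts ! j"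
  shows "v (\<beta> i k) * adj (v (\<beta> i l)) * (v (\<beta> j k') * adj (v (\<beta> j l'))) =
    (if i = j \<and> l = k' then v (\<beta> i k) * adj (v (\<beta> i l')) else 0)"
proof -
  have "v (\<beta> i k) * adj (v (\<beta> i l)) * (v (\<beta> j k') * adj (v (\<beta> j l'))) =
      v (\<beta> i k) * (adj (v (\<beta> i l)) * v (\<beta> j k')) * adj (v (\<beta> j l'))"
    by (simp add: mult.assoc)
  also have "\<dots> = (if i = j \<and> l = k' then v (\<beta> i k) * rep (\<beta> i k) * adj (v (\<beta> i l')) else 0)"
    using mixed_unitsD(2)[OF assms(1,2)] by (auto simp: adj_v_times_v[OF assms(1,3,4,5)])
  finally show ?thesis using v_rep[OF mixed_unitsD(1)[OF assms(1,2)]] by auto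
qed

lemma unit_hom_in: "unit_hom ts \<beta> Xs \<in> S"
  unfolding unit_hom_def unit_combination_def
  by (intro sum_in scale_in times_in adj_in v_in) (auto dest: mixed_unitsD)

lemma unit_hom_mult:
  assumes X: "Xs \<in> carrier (matrix_algebra_sum ts)" and Y: "Ys \<in> carrier (matrix_algebra_sum ts)"
  shows "unit_hom ts \<beta> (map2 (*) Xs Ys) = unit_hom ts \<beta> Xs * unit_hom ts \<beta> Ys"
proof -
  let ?u = "\<lambda>j. unit_combination (\<lambda>k l. v (\<beta> j k) * adj (v (\<beta> j l))) (ts ! j)"
  have neq: "?u i A * ?u j B = 0" if "i < length ts" "j < length ts" "i \<noteq> j" for i j A B
    unfolding unit_combination_def using that
    by (auto simp: sum_product unit_products intro!: sum.neutral)
  have eq: "?u i A * ?u i B = ?u i (A * B)"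
    if "i < length ts" "A \<in> carrier_mat (ts ! i) (ts ! i)" "B \<in> carrier_mat (ts ! i) (ts ! i)" for i A B
    using that by (intro unit_combination_mult) (auto simp: unit_products)
  have "unit_hom ts \<beta> Xs * unit_hom ts \<beta> Ys =
      (\<Sum>i<length ts. \<Sum>j<length ts. if j = i then ?u i (Xs ! i * Ys ! i) else 0)"
    using X Y unfolding unit_hom_def sum_product
    by (intro sum.cong refl) (auto simp: neq eq matrix_algebra_sum_simps)
  also have "\<dots> = unit_hom ts \<beta> (map2 (*) Xs Ys)"
    using X Y by (simp add: unit_hom_def matrix_algebra_sum_simps)
  finally show ?thesis by simp
qed

lemma unit_hom_adj:
  assumes X: "Xs \<in> carrier (matrix_algebra_sum ts)"
  shows "unit_hom ts \<beta> (map mat_adjoint Xs) = adj (unit_hom ts \<beta> Xs)"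
  unfolding unit_hom_def unit_combination_def adj_sum
proof (rule sum.cong[OF refl])
  fix j assume "j \<in> {..<length ts}"
  with X show "(\<Sum>k<ts ! j. \<Sum>l<ts ! j. map mat_adjoint Xs ! j $$ (k, l) *\<^sub>C (v (\<beta> j k) * adj (v (\<beta> j l)))) =
    (\<Sum>k<ts ! j. \<Sum>l<ts ! j. adj (Xs ! j $$ (k, l) *\<^sub>C (v (\<beta> j k) * adj (v (\<beta> j l)))))"
    by (subst sum.swap) (auto simp: matrix_algebra_sum_simps intro!: sum.cong)
qed

lemma unit_hom_star_hom: "star_hom (matrix_algebra_sum ts) (fmat_algebra S) (unit_hom ts \<beta>)"
  unfolding star_hom_def
proof (intro conjI ballI allI)
  fix Xs Ys assume "Xs \<in> carrier (matrix_algebra_sum ts)" "Ys \<in> carrier (matrix_algebra_sum ts)"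
  then show "unit_hom ts \<beta> (Xs \<oplus>\<^bsub>matrix_algebra_sum ts\<^esub> Ys) =
      unit_hom ts \<beta> Xs \<oplus>\<^bsub>fmat_algebra S\<^esub> unit_hom ts \<beta> Ys"
    by (auto simp: unit_hom_def unit_combination_def matrix_algebra_sum_simps
        fmat.scale_left_distrib simp flip: sum.distrib intro!: sum.cong)
next
  fix Xs c assume "Xs \<in> carrier (matrix_algebra_sum ts)"
  then show "unit_hom ts \<beta> (c \<odot>\<^bsub>matrix_algebra_sum ts\<^esub> Xs) =
      c \<odot>\<^bsub>fmat_algebra S\<^esub> unit_hom ts \<beta> Xs"
    by (auto simp: unit_hom_def unit_combination_def matrix_algebra_sum_simps
        fmat.scale_sum_right intro!: sum.cong)
qed (auto simp: unit_hom_in unit_hom_mult unit_hom_adj matrix_algebra_sum_simps(2-))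

text \<open>These compressions read the matrix entries off the image. Injectivity follows because
  \<open>rep\<close> does not vanish on \<open>F\<close>.\<close>

lemma unit_hom_compress:
  assumes X: "Xs \<in> carrier (matrix_algebra_sum ts)" and j: "j < length ts" "k < ts ! j" "l < ts ! j"
  shows "adj (v (\<beta> j k)) * unit_hom ts \<beta> Xs * v (\<beta> j l) = Xs ! j $$ (k, l) *\<^sub>C rep (\<beta> j 0)"
proof -
  have "adj (v (\<beta> j k)) * unit_hom ts \<beta> Xs * v (\<beta> j l) = (\<Sum>i<length ts. \<Sum>k'<ts ! i. \<Sum>l'<ts ! i.
      Xs ! i $$ (k', l') *\<^sub>C ((adj (v (\<beta> j k)) * v (\<beta> i k')) * (adj (v (\<beta> i l')) * v (\<beta> j l))))"
    by (simp add: unit_hom_def unit_combination_def sum_distrib_left sum_distrib_right mult.assoc)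
  \<comment> \<open>The conditions are nested so that the three sums collapse from the inside, over
    \<open>l'\<close>, \<open>k'\<close> and \<open>i\<close> in turn.\<close>
  also have "\<dots> = (\<Sum>i<length ts. \<Sum>k'<ts ! i. \<Sum>l'<ts ! i.
      if l' = l then if i = j \<and> k' = k then Xs ! j $$ (k, l) *\<^sub>C rep (\<beta> j 0) else 0 else 0)"
  proof -
    have "rep (\<beta> j 0) * rep (\<beta> j 0) = rep (\<beta> j 0)"
      using rep_idem[OF mixed_unitsD(1)[OF j(1,2)]] mixed_unitsD(2)[OF j(1,2)] by simp
    then show ?thesis using j by (intro sum.cong refl) (auto simp: adj_v_times_v)
  qed
  also have "\<dots> = (\<Sum>i<length ts. \<Sum>k'<ts ! i.
      if k' = k then if i = j then Xs ! j $$ (k, l) *\<^sub>C rep (\<beta> j 0) else 0 else 0)"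
    by (intro sum.cong refl) (use j in auto)
  also have "\<dots> = (\<Sum>i<length ts. if i = j then Xs ! j $$ (k, l) *\<^sub>C rep (\<beta> j 0) else 0)"
    by (intro sum.cong refl) (use j in auto)
  also have "\<dots> = Xs ! j $$ (k, l) *\<^sub>C rep (\<beta> j 0)" using j by simp
  finally show ?thesis .
qed

lemma unit_hom_inj: "inj_on (unit_hom ts \<beta>) (carrier (matrix_algebra_sum ts))"
proof (rule inj_onI)
  fix Xs Ys assume XY: "Xs \<in> carrier (matrix_algebra_sum ts)" "Ys \<in> carrier (matrix_algebra_sum ts)"
    and eq: "unit_hom ts \<beta> Xs = unit_hom ts \<beta> Ys"
  have "Xs ! j $$ (k, l) = Ys ! j $$ (k, l)" if j: "j < length ts" "k < ts ! j" "l < ts ! j" for j k l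
  proof -
    have "rep (\<beta> j 0) \<noteq> 0" using rep_nonzero[OF mixed_unitsD(1)[OF j(1,2)]] mixed_unitsD(2)[OF j(1,2)] by simp
    then show ?thesis
      using unit_hom_compress[OF XY(1) j] unit_hom_compress[OF XY(2) j] eq by simp
  qed
  moreover have "Xs ! j \<in> carrier_mat (ts ! j) (ts ! j)" "Ys ! j \<in> carrier_mat (ts ! j) (ts ! j)"
    if "j < length ts" for j
    using XY that by (auto simp: matrix_algebra_sum_simps)
  ultimately have "Xs ! j = Ys ! j" if "j < length ts" for j
    using that by (metis carrier_matD eq_matI)
  then show "Xs = Ys"
    using XY by (intro nth_equalityI) (auto simp: matrix_algebra_sum_simps)
qed

lemma unit_hom_embeds: "star_embeds (matrix_algebra_sum ts) (fmat_algebra S)"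
  using unit_hom_star_hom unit_hom_inj by (auto simp: star_embeds_def)

text \<open>When the \<open>\<beta> j k\<close> exhaust \<open>F\<close> and distinct
  \<open>j\<close> belong to distinct classes, the Peirce components between distinct
  \<open>j\<close> vanish, and the scalars in the remaining ones are the entries of a preimage.
  Summands of size \<open>0\<close> are exempt from the separation, as their
  \<open>\<beta> j 0\<close> is unconstrained.\<close>

lemma unit_hom_surj:
  assumes onto: "F \<subseteq> (\<lambda>(j, k). \<beta> j k) ` (SIGMA j:{..<length ts}. {..<ts ! j})"
    and sep: "\<And>i j. i < length ts \<Longrightarrow> j < length ts \<Longrightarrow> i \<noteq> j \<Longrightarrow> ts ! i \<noteq> 0 \<Longrightarrow> ts ! j \<noteq> 0 \<Longrightarrow>
      rep (\<beta> i 0) \<noteq> rep (\<beta> j 0)"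
    and x: "x \<in> S"
  shows "x \<in> unit_hom ts \<beta> ` carrier (matrix_algebra_sum ts)"
proof -
  let ?I = "SIGMA j:{..<length ts}. {..<ts ! j}"
  have bij: "bij_betw (\<lambda>(j, k). \<beta> j k) ?I F"
    unfolding bij_betw_def
  proof
    show "inj_on (\<lambda>(j, k). \<beta> j k) ?I" using \<beta> by (simp add: mixed_units_def)
    show "(\<lambda>(j, k). \<beta> j k) ` ?I = F" using onto by (auto dest: mixed_unitsD(1))
  qed
  have reindex: "(\<Sum>p\<in>F. f p) = (\<Sum>j<length ts. \<Sum>k<ts ! j. f (\<beta> j k))" for f :: "fmat \<Rightarrow> fmat"
    by (subst sum.reindex_bij_betw[OF bij, symmetric]) (simp add: sum.Sigma split_def)
  have "\<exists>c. \<forall>p\<in>F. \<forall>q\<in>F. rep p = rep q \<longrightarrow> adj (v p) * x * v q = c p q *\<^sub>C rep p"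
    using compress_eq[OF x] by metis
  then obtain c where c: "\<And>p q. p \<in> F \<Longrightarrow> q \<in> F \<Longrightarrow> rep p = rep q \<Longrightarrow>
      adj (v p) * x * v q = c p q *\<^sub>C rep p"
    by blast
  define Xs where "Xs = map (\<lambda>j. mat (ts ! j) (ts ! j) (\<lambda>(k, l). c (\<beta> j k) (\<beta> j l))) [0..<length ts]"
  have "x = (\<Sum>j<length ts. \<Sum>k<ts ! j. \<Sum>i<length ts. \<Sum>l<ts ! i.
      v (\<beta> j k) * (adj (v (\<beta> j k)) * x * v (\<beta> i l)) * adj (v (\<beta> i l)))"
    using times_v_expand[OF x] by (simp add: reindex)
  also have "\<dots> = (\<Sum>j<length ts. \<Sum>k<ts ! j. \<Sum>i<length ts. if i = j then
      (\<Sum>l<ts ! j. c (\<beta> j k) (\<beta> j l) *\<^sub>C (v (\<beta> j k) * adj (v (\<beta> j l)))) else 0)"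
  proof (intro sum.cong refl)
    fix j k i assume "j \<in> {..<length ts}" "k \<in> {..<ts ! j}" "i \<in> {..<length ts}"
    then have jk: "j < length ts" "k < ts ! j" "i < length ts" by auto
    have "v (\<beta> j k) * (adj (v (\<beta> j k)) * x * v (\<beta> i l)) * adj (v (\<beta> i l)) = 0"
      if "i \<noteq> j" "l < ts ! i" for l
    proof -
      have "rep (\<beta> j k) \<noteq> rep (\<beta> i l)"
        using sep[of j i] jk that mixed_unitsD(2)[of j k] mixed_unitsD(2)[of i l] by auto
      then show ?thesis
        using compress_neq[OF x mixed_unitsD(1)[OF jk(1,2)] mixed_unitsD(1)[OF jk(3) that(2)]] by simp
    qed
    moreover have "v (\<beta> j k) * (adj (v (\<beta> j k)) * x * v (\<beta> j l)) * adj (v (\<beta> j l)) =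
        c (\<beta> j k) (\<beta> j l) *\<^sub>C (v (\<beta> j k) * adj (v (\<beta> j l)))" if "l < ts ! j" for l
      using c[OF mixed_unitsD(1)[OF jk(1,2)] mixed_unitsD(1)[OF jk(1) that]]
        v_rep[OF mixed_unitsD(1)[OF jk(1,2)]] mixed_unitsD(2)[OF jk(1,2)] mixed_unitsD(2)[OF jk(1) that]
      by simp
    ultimately show "(\<Sum>l<ts ! i. v (\<beta> j k) * (adj (v (\<beta> j k)) * x * v (\<beta> i l)) * adj (v (\<beta> i l))) =
      (if i = j then (\<Sum>l<ts ! j. c (\<beta> j k) (\<beta> j l) *\<^sub>C (v (\<beta> j k) * adj (v (\<beta> j l)))) else 0)"
      by simp
  qed
  also have "\<dots> = unit_hom ts \<beta> Xs"
    unfolding unit_hom_def unit_combination_def Xs_def by (auto intro!: sum.cong)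
  finally show ?thesis
    by (rule image_eqI) (simp add: matrix_algebra_sum_simps Xs_def)
qed

end

section \<open>The block structure and the number of copies of a matrix algebra\<close>

lemma ex_block_enumeration:
  obtains h where "\<And>r. bij_betw (h r) {..<block_size r} {p \<in> F. rep p = r}"
proof -
  have "\<exists>h. bij_betw h {..<block_size r} {p \<in> F. rep p = r}" for r
    unfolding block_size_def lessThan_atLeast0 using finite_F by (intro ex_bij_betw_nat_finite) auto
  then show thesis using that by metis
qed

text \<open>Every summand receives a whole class, so no class is shared between summands and the
  homomorphism is onto.\<close>

theorem isomorphic_matrix_algebra_sum:
  assumes ts: "mset ts = image_mset block_size (mset_set (rep ` F))"
  shows "star_isomorphic (matrix_algebra_sum ts) (fmat_algebra S)"
proof -
  obtain rs where rs: "mset rs = mset_set (rep ` F)" "map block_size rs = ts"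
    using ex_preimage_list ts by metis
  have set_rs: "set rs = rep ` F"
    using rs(1) finite_F by (metis finite_imageI finite_set_mset_mset_set set_mset_mset)
  have dist: "distinct rs"
    using rs(1) finite_F by (metis count_mset_set(1) count_mset_set(3) distinct_count_atmost_1
        finite_imageI finite_set_mset_mset_set set_mset_mset)
  obtain h where h: "\<And>r. bij_betw (h r) {..<block_size r} {p \<in> F. rep p = r}"
    using ex_block_enumeration by blast
  define \<beta> where "\<beta> j k = h (rs ! j) k" for j k
  have len: "length ts = length rs" "\<And>j. j < length rs \<Longrightarrow> ts ! j = block_size (rs ! j)"
    using rs(2) by auto
  have \<beta>: "\<beta> j k \<in> F" "rep (\<beta> j k) = rs ! j" if "j < length ts" "k < ts ! j" for j k
    using bij_betwE[OF h[of "rs ! j"]] that len by (auto simp: \<beta>_def)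
  have "inj_on (\<lambda>(j, k). \<beta> j k) (SIGMA j:{..<length ts}. {..<ts ! j})"
  proof (rule inj_onI, clarsimp)
    fix i k j l assume *: "i < length ts" "k < ts ! i" "j < length ts" "l < ts ! j" "\<beta> i k = \<beta> j l"
    then have "rs ! i = rs ! j" using \<beta> by metis
    then have "i = j" using dist * len by (simp add: nth_eq_iff_index_eq)
    then show "i = j \<and> k = l"
      using * h[of "rs ! j"] len by (auto simp: \<beta>_def bij_betw_def inj_on_def)
  qed
  moreover have "\<forall>j<length ts. \<forall>k<ts ! j. \<beta> j k \<in> F \<and> rep (\<beta> j k) = rep (\<beta> j 0)"
  proof (intro allI impI)
    fix j k assume "j < length ts" "k < ts ! j"
    then show "\<beta> j k \<in> F \<and> rep (\<beta> j k) = rep (\<beta> j 0)"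
      using \<beta>(1)[of j k] \<beta>(2)[of j k] \<beta>(2)[of j 0] by simp
  qed
  ultimately have m: "mixed_units ts \<beta>" unfolding mixed_units_def by blast
  have "F \<subseteq> (\<lambda>(j, k). \<beta> j k) ` (SIGMA j:{..<length ts}. {..<ts ! j})"
  proof
    fix p assume p: "p \<in> F"
    then have "rep p \<in> set rs" using set_rs by simp
    then obtain j where j: "j < length rs" "rs ! j = rep p" by (auto simp: in_set_conv_nth)
    have "p \<in> h (rep p) ` {..<block_size (rep p)}"
      using h[of "rep p"] p by (auto simp: bij_betw_def)
    then obtain k where "k < block_size (rep p)" "p = h (rep p) k" by auto
    then show "p \<in> (\<lambda>(j, k). \<beta> j k) ` (SIGMA j:{..<length ts}. {..<ts ! j})"
      using j len by (intro image_eqI[of _ _ "(j, k)"]) (auto simp: \<beta>_def)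
  qed
  moreover have "rep (\<beta> i 0) \<noteq> rep (\<beta> j 0)"
    if "i < length ts" "j < length ts" "i \<noteq> j" "ts ! i \<noteq> 0" "ts ! j \<noteq> 0" for i j
    using that \<beta> dist len by (auto simp: nth_eq_iff_index_eq)
  ultimately have "S \<subseteq> unit_hom ts \<beta> ` carrier (matrix_algebra_sum ts)"
    using unit_hom_surj[OF m] by blast
  then have "bij_betw (unit_hom ts \<beta>) (carrier (matrix_algebra_sum ts)) S"
    using unit_hom_inj[OF m] unit_hom_in[OF m] by (auto simp: bij_betw_def)
  then show ?thesis
    using unit_hom_star_hom[OF m] by (auto simp: star_isomorphic_def)
qed

text \<open>A class of \<open>s\<close> projections is cut into \<open>s div d\<close> disjoint
  windows of length \<open>d\<close>, each carrying one copy. For \<open>d = 0\<close> the summands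
  consist of empty matrices and no projection has to be chosen.\<close>

theorem embeds_replicate:
  assumes c: "c \<le> (\<Sum>r\<in>rep ` F. block_size r div d)"
  shows "star_embeds (matrix_algebra_sum (replicate c d)) (fmat_algebra S)"
proof (cases "d = 0")
  case True
  then have "mixed_units (replicate c d) (\<lambda>_ _. 0)"
    by (auto simp: mixed_units_def inj_on_def)
  then show ?thesis by (rule unit_hom_embeds)
next
  case False
  let ?c = "\<Sum>r\<in>rep ` F. block_size r div d"
  let ?ts = "replicate c d"
  let ?J = "SIGMA r:rep ` F. {..<block_size r div d}"
  have "finite ?J" "card ?J = ?c" using finite_F by auto
  then obtain b where b: "bij_betw b {..<?c} ?J"
    using ex_bij_betw_nat_finite[of ?J] by (metis lessThan_atLeast0)
  obtain h where h: "\<And>r. bij_betw (h r) {..<block_size r} {p \<in> F. rep p = r}"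
    using ex_block_enumeration by blast
  \<comment> \<open>The bijection \<open>b\<close> numbers the pairs of a class and a window in it;
    the offset \<open>snd (b i) * d\<close> is where the window of copy \<open>i\<close>
    begins.\<close>
  define \<beta> where "\<beta> i k = h (fst (b i)) (snd (b i) * d + k)" for i k
  have bJ: "snd (b i) < block_size (fst (b i)) div d" if "i < ?c" for i
    using bij_betwE[OF b] that by (auto simp: mem_Times_iff split: prod.splits) (metis (no_types, lifting) SigmaE lessThan_iff prod.sel)
  have lt: "snd (b i) * d + k < block_size (fst (b i))" if "i < ?c" "k < d" for i k
  proof -
    have "snd (b i) * d + k < (snd (b i) + 1) * d" using that by simp
    also have "\<dots> \<le> (block_size (fst (b i)) div d) * d"
      using bJ[OF that(1)] by (intro mult_le_mono1) simp
    also have "\<dots> \<le> block_size (fst (b i))" by simp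
    finally show ?thesis .
  qed
  have \<beta>: "\<beta> i k \<in> F" "rep (\<beta> i k) = fst (b i)" if "i < ?c" "k < d" for i k
    using bij_betwE[OF h[of "fst (b i)"]] lt[OF that] by (auto simp: \<beta>_def)
  have "inj_on (\<lambda>(j, k). \<beta> j k) (SIGMA j:{..<length ?ts}. {..<?ts ! j})"
  proof (rule inj_onI, clarsimp)
    fix i k j l assume "i < c" "k < d" "j < c" "l < d" "\<beta> i k = \<beta> j l"
    then have *: "i < ?c" "k < d" "j < ?c" "l < d" "\<beta> i k = \<beta> j l" using c by auto
    then have f: "fst (b i) = fst (b j)" using \<beta> by metis
    then have "snd (b i) * d + k = snd (b j) * d + l"
      using * h[of "fst (b j)"] lt[OF *(1,2)] lt[OF *(3,4)] by (auto simp: \<beta>_def bij_betw_def inj_on_def)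
    \<comment> \<open>Division with remainder recovers the window and the position inside
      it.\<close>
    then have "(snd (b i) * d + k) div d = (snd (b j) * d + l) div d"
      "(snd (b i) * d + k) mod d = (snd (b j) * d + l) mod d" by simp_all
    then have "snd (b i) = snd (b j)" "k = l" using * by simp_all
    with f have "b i = b j" by (simp add: prod_eq_iff)
    then show "i = j \<and> k = l"
      using inj_onD[OF bij_betw_imp_inj_on[OF b]] *(1,3) \<open>k = l\<close> by simp
  qed
  moreover have "\<forall>j<length ?ts. \<forall>k<?ts ! j. \<beta> j k \<in> F \<and> rep (\<beta> j k) = rep (\<beta> j 0)"
  proof (intro allI impI)
    fix j k assume "j < length ?ts" "k < ?ts ! j"
    then have "j < ?c" "k < d" "0 < d" using c by simp_all
    then show "\<beta> j k \<in> F \<and> rep (\<beta> j k) = rep (\<beta> j 0)" using \<beta> by metis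
  qed
  ultimately have "mixed_units ?ts \<beta>" unfolding mixed_units_def by blast
  then show ?thesis by (rule unit_hom_embeds)
qed

text \<open>The \<open>v q\<close> of one class span a left module over \<open>S\<close>: it plays
  the part of the columns of one block, and at most \<open>block_size (rep p)\<close> elements span
  it.\<close>

lemma times_v_in_span:
  assumes x: "x \<in> S" and p: "p \<in> F"
  shows "x * v p \<in> fmat.span (v ` {q \<in> F. rep q = rep p})"
proof -
  have "x * v p = P * x * v p" using x by (simp add: unit_left)
  also have "\<dots> = (\<Sum>q\<in>F. v q * (adj (v q) * x * v p))"
    unfolding v_sum[symmetric] by (simp add: sum_distrib_right mult.assoc)
  also have "\<dots> \<in> fmat.span (v ` {q \<in> F. rep q = rep p})"
  proof (rule fmat.span_sum)
    fix q assume q: "q \<in> F"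
    show "v q * (adj (v q) * x * v p) \<in> fmat.span (v ` {q \<in> F. rep q = rep p})"
    proof (cases "rep q = rep p")
      case True
      then obtain c where "adj (v q) * x * v p = c *\<^sub>C rep q" using compress_eq[OF x q p] by blast
      then have "v q * (adj (v q) * x * v p) = c *\<^sub>C v q" using v_rep q by simp
      then show ?thesis using True q by (auto intro!: fmat.span_scale intro: fmat.span_base)
    next
      case False
      then show ?thesis using compress_neq[OF x q p] by (simp add: fmat.span_zero)
    qed
  qed
  finally show ?thesis .
qed

end

definition list_unit :: "nat \<Rightarrow> nat \<Rightarrow> nat \<Rightarrow> nat \<Rightarrow> nat \<Rightarrow> complex mat list" where
  "list_unit c d i k l = map (\<lambda>j. mat d d (\<lambda>(a, b). if j = i \<and> a = k \<and> b = l then 1 else 0)) [0..<c]"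

lemma list_unit_carrier: "list_unit c d i k l \<in> carrier (matrix_algebra_sum (replicate c d))"
  by (simp add: list_unit_def matrix_algebra_sum_simps)

text \<open>Zero is written as a scalar multiple by \<open>0\<close> because \<open>star_hom\<close>
  speaks of scalar multiples but not of the field \<open>zero\<close>.\<close>

lemma list_unit_mult:
  assumes "i < c" "l < d"
  shows "list_unit c d i k l \<otimes>\<^bsub>matrix_algebra_sum (replicate c d)\<^esub> list_unit c d i' k' l' =
    (if i = i' \<and> l = k' then list_unit c d i k l' else 0 \<odot>\<^bsub>matrix_algebra_sum (replicate c d)\<^esub> list_unit c d i k l)"
  using assms unfolding matrix_algebra_sum_simps list_unit_def
  by (auto intro!: nth_equalityI eq_matI simp: scalar_prod_def if_distrib[of "\<lambda>x. x * _"] if_distrib[of "\<lambda>x. _ * x"]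
      cong: if_cong intro!: sum.neutral)

lemma matrix_units_of_hom:
  assumes hom: "star_hom (matrix_algebra_sum (replicate c d)) (fmat_algebra S) f"
    and inj: "inj_on f (carrier (matrix_algebra_sum (replicate c d)))"
  obtains u where "\<And>i k l. i < c \<Longrightarrow> k < d \<Longrightarrow> l < d \<Longrightarrow> u i k l \<in> S \<and> u i k l \<noteq> 0"
    "\<And>i k l i' k' l'. i < c \<Longrightarrow> l < d \<Longrightarrow> i' < c \<Longrightarrow> k' < d \<Longrightarrow>
      u i k l * u i' k' l' = (if i = i' \<and> l = k' then u i k l' else 0)"
proof (rule that[of "\<lambda>i k l. f (list_unit c d i k l)"])
  let ?A = "matrix_algebra_sum (replicate c d)"
  note h = hom[unfolded star_hom_def, simplified]
  have zero: "f (0 \<odot>\<^bsub>?A\<^esub> list_unit c d i k l) = 0" for i k l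
    using h list_unit_carrier[of c d i k l] by simp
  show "f (list_unit c d i k l) \<in> S \<and> f (list_unit c d i k l) \<noteq> 0" if "i < c" "k < d" "l < d" for i k l
  proof -
    have "list_unit c d i k l ! i $$ (k, l) \<noteq> (0 \<odot>\<^bsub>?A\<^esub> list_unit c d i k l) ! i $$ (k, l)"
      using that by (simp add: list_unit_def matrix_algebra_sum_simps)
    then have "list_unit c d i k l \<noteq> 0 \<odot>\<^bsub>?A\<^esub> list_unit c d i k l" by metis
    moreover have "0 \<odot>\<^bsub>?A\<^esub> list_unit c d i k l \<in> carrier ?A"
      using list_unit_carrier operations_closed_matrix_algebra_sum by (metis operations_closed_def)
    ultimately have "f (list_unit c d i k l) \<noteq> f (0 \<odot>\<^bsub>?A\<^esub> list_unit c d i k l)"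
      using inj list_unit_carrier by (metis inj_on_def)
    then show ?thesis using zero h list_unit_carrier by simp
  qed
  show "f (list_unit c d i k l) * f (list_unit c d i' k' l') =
      (if i = i' \<and> l = k' then f (list_unit c d i k l') else 0)"
    if "i < c" "l < d" "i' < c" "k' < d" for i k l i' k' l'
    using h list_unit_carrier list_unit_mult[OF that(1,2), of k i' k' l'] zero by metis
qed

text \<open>Each copy moves some \<open>v p\<close> to a nonzero element and is assigned to the
  class of that \<open>p\<close>. All its \<open>d\<close> diagonal units then act nontrivially on
  the span of this class, and those of different copies are orthogonal, so a class of size
  \<open>s\<close> takes at most \<open>s div d\<close> copies.\<close>

theorem (in matrix_unit_system) replicate_embeds_le:
  assumes emb: "star_embeds (matrix_algebra_sum (replicate c d)) (fmat_algebra S)" and d: "d \<ge> 1"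
  shows "c \<le> (\<Sum>r\<in>rep ` F. block_size r div d)"
proof -
  obtain f where "star_hom (matrix_algebra_sum (replicate c d)) (fmat_algebra S) f"
    "inj_on f (carrier (matrix_algebra_sum (replicate c d)))"
    using emb by (auto simp: star_embeds_def)
  from matrix_units_of_hom[OF this] obtain u where
    u: "\<And>i k l. i < c \<Longrightarrow> k < d \<Longrightarrow> l < d \<Longrightarrow> u i k l \<in> S \<and> u i k l \<noteq> 0"
    "\<And>i k l i' k' l'. i < c \<Longrightarrow> l < d \<Longrightarrow> i' < c \<Longrightarrow> k' < d \<Longrightarrow>
      u i k l * u i' k' l' = (if i = i' \<and> l = k' then u i k l' else 0)"
    by metis
  have "\<exists>p\<in>F. u i 0 0 * v p \<noteq> 0" if "i < c" for i
  proof (rule ccontr)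
    assume "\<not> ?thesis"
    moreover have "u i 0 0 = (\<Sum>p\<in>F. u i 0 0 * v p * adj (v p))"
      using u(1)[of i 0 0] that d unit_right[of "u i 0 0"]
      by (simp add: mult.assoc sum_distrib_left v_sum flip: sum_distrib_left)
    ultimately have "u i 0 0 = 0" by simp
    then show False using u(1)[of i 0 0] that d by simp
  qed
  then obtain p where p: "\<And>i. i < c \<Longrightarrow> p i \<in> F" "\<And>i. i < c \<Longrightarrow> u i 0 0 * v (p i) \<noteq> 0" by metis
  define C where "C r = {i. i < c \<and> rep (p i) = r}" for r
  have "card (C r) \<le> block_size r div d" if "r \<in> rep ` F" for r
  proof -
    have "card (C r \<times> {..<d}) \<le> card (v ` {q \<in> F. rep q = r})"
    proof (rule orthogonal_idempotents_bound[where w = "\<lambda>(i, k). u i k k"])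
      show "finite (C r \<times> {..<d})" "finite (v ` {q \<in> F. rep q = r})"
        using finite_F by (auto simp: C_def)
    next
      fix a assume "a \<in> C r \<times> {..<d}"
      then obtain i k where a: "a = (i, k)" "i < c" "k < d" "rep (p i) = r" by (auto simp: C_def)
      \<comment> \<open>The unit \<open>u i k 0\<close> transports a nonzero element to the
        \<open>k\<close>-th diagonal unit, and \<open>u i 0 k\<close> leads back, so the result is
        nonzero.\<close>
      let ?y = "u i k 0 * v (p i)"
      have "u i 0 k * ?y = u i 0 0 * v (p i)"
        using a u(2)[of i k i k 0 0] by (simp flip: mult.assoc)
      then have "?y \<noteq> 0" using p(2) a by (metis mult_zero_right)
      moreover have "u i k k * ?y = ?y"
        using a u(2)[of i k i k k 0] by (simp flip: mult.assoc)
      moreover have "?y \<in> fmat.span (v ` {q \<in> F. rep q = r})"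
        using times_v_in_span[of "u i k 0" "p i"] u(1) a d p(1) by simp
      ultimately show "\<exists>y. (case a of (i, k) \<Rightarrow> u i k k) * y \<noteq> 0 \<and>
          (case a of (i, k) \<Rightarrow> u i k k) * y \<in> fmat.span (v ` {q \<in> F. rep q = r})"
        using a by (intro exI[of _ ?y]) simp
    next
      have C: "i < c" if "i \<in> C r" for i using that by (simp add: C_def)
      fix a b assume "a \<in> C r \<times> {..<d}"
      then obtain i k where a: "a = (i, k)" "i < c" "k < d" using C by auto
      then show "(case a of (i, k) \<Rightarrow> u i k k) * (case a of (i, k) \<Rightarrow> u i k k) = (case a of (i, k) \<Rightarrow> u i k k)"
        using u(2)[of i k i k k k] by simp
      assume "b \<in> C r \<times> {..<d}" and "a \<noteq> b"
      then obtain j l where "b = (j, l)" "j < c" "l < d" using C by auto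
      with a \<open>a \<noteq> b\<close> show "(case a of (i, k) \<Rightarrow> u i k k) * (case b of (i, k) \<Rightarrow> u i k k) = 0"
        using u(2)[of i k j l k l] by auto
    qed
    also have "\<dots> \<le> block_size r"
      unfolding block_size_def using finite_F by (intro card_image_le) auto
    finally have "card (C r) * d \<le> block_size r" by (simp add: card_cartesian_product)
    then have "card (C r) * d div d \<le> block_size r div d" by (rule div_le_mono)
    then show ?thesis using d by simp
  qed
  moreover have "c = (\<Sum>r\<in>rep ` F. card (C r))"
  proof -
    have "{..<c} = (\<Union>r\<in>rep ` F. C r)" using p(1) by (auto simp: C_def)
    then have "c = card (\<Union>r\<in>rep ` F. C r)" by (metis card_lessThan)
    also have "\<dots> = (\<Sum>r\<in>rep ` F. card (C r))"
      using finite_F by (intro card_UN_disjoint) (auto simp: C_def)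
    finally show ?thesis .
  qed
  ultimately show ?thesis by (metis (no_types, lifting) sum_mono)
qed

text \<open>The \<open>c * d\<close> diagonal matrix units are orthogonal idempotents of size
  \<open>n\<close>. This bound makes the sets finite whose maxima define \<open>d_max\<close> and
  \<open>hybrid_capacity\<close>.\<close>

lemma embeds_full_matrix_le:
  assumes emb: "star_embeds (matrix_algebra_sum (replicate c d)) (fmat_algebra {x. supported n n x})"
  shows "c * d \<le> n"
proof -
  obtain f where "star_hom (matrix_algebra_sum (replicate c d)) (fmat_algebra {x. supported n n x}) f"
    "inj_on f (carrier (matrix_algebra_sum (replicate c d)))"
    using emb by (auto simp: star_embeds_def)
  from matrix_units_of_hom[OF this] obtain u where
    u: "\<And>i k l. i < c \<Longrightarrow> k < d \<Longrightarrow> l < d \<Longrightarrow> u i k l \<in> {x. supported n n x} \<and> u i k l \<noteq> 0"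
    "\<And>i k l i' k' l'. i < c \<Longrightarrow> l < d \<Longrightarrow> i' < c \<Longrightarrow> k' < d \<Longrightarrow>
      u i k l * u i' k' l' = (if i = i' \<and> l = k' then u i k l' else 0)"
    by metis
  have "card ({..<c} \<times> {..<d}) \<le> n"
    by (rule orthogonal_idempotents_card_le[where w = "\<lambda>(i, k). u i k k"])
       (use u in \<open>auto split: if_splits\<close>)
  then show ?thesis by (simp add: card_cartesian_product)
qed

section \<open>Traces and adjoint maps\<close>

definition ftrace :: "fmat \<Rightarrow> complex" where
  "ftrace x = (\<Sum>i<fdim x. entry x i i)"

lemma ftrace_eq: "supported n m x \<Longrightarrow> ftrace x = (\<Sum>i<n. entry x i i)"
proof -
  assume n: "supported n m x"
  let ?N = "max n (fdim x)"
  have "(\<Sum>i<n. entry x i i) = (\<Sum>i<?N. entry x i i)"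
    by (rule sum.mono_neutral_left) (use n in \<open>auto simp: supported_def\<close>)
  also have "\<dots> = (\<Sum>i<fdim x. entry x i i)"
    by (rule sum.mono_neutral_right) (use supported_fdim[of x] in \<open>auto simp: supported_def\<close>)
  finally show ?thesis by (simp add: ftrace_def)
qed

lemma ftrace_add [simp]: "ftrace (x + y) = ftrace x + ftrace y"
proof -
  obtain n where "supported n n x" "supported n n y" using common_support[of "[x, y]"] by auto
  then show ?thesis by (simp add: ftrace_eq[of n n] supported_add sum.distrib)
qed

lemma ftrace_scale [simp]: "ftrace (c *\<^sub>C x) = c * ftrace x"
proof -
  obtain n where "supported n n x" using ex_supported by auto
  then show ?thesis by (simp add: ftrace_eq[of n n] supported_scale sum_distrib_left)
qed

lemma ftrace_zero [simp]: "ftrace 0 = 0"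
  using ftrace_scale[of 0 0] by simp

lemma ftrace_sum: "ftrace (sum f A) = (\<Sum>a\<in>A. ftrace (f a))"
  by (induction A rule: infinite_finite_induct) simp_all

lemma ftrace_commute: "ftrace (x * y) = ftrace (y * x)"
proof -
  obtain n where n: "supported n n x" "supported n n y" using common_support[of "[x, y]"] by auto
  then show ?thesis
    by (simp add: ftrace_eq[OF supported_times] entry_times[OF n(1)] entry_times[OF n(2)] mult.commute)
      (rule sum.swap)
qed

lemma ftrace_of_mat: "A \<in> carrier_mat n m \<Longrightarrow> n \<le> m \<Longrightarrow> ftrace (of_mat A) = mat_trace A"
  by (auto simp: ftrace_eq[OF supported_of_mat] mat_trace_def)

lemma mat_trace_times:
  "A \<in> carrier_mat n n \<Longrightarrow> B \<in> carrier_mat n n \<Longrightarrow> mat_trace (A * B) = ftrace (of_mat A * of_mat B)"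
  by (simp add: ftrace_of_mat[of _ n n] flip: of_mat_mult)

lemma ftrace_times_munit: "ftrace (x * munit i j) = entry x j i"
proof -
  obtain n where n: "supported n n x" using ex_supported by auto
  then have "supported n (max n (Suc j)) (x * munit i j)"
    by (rule supported_times) (rule supported_munit[of i "Suc i"], auto)
  from ftrace_eq[OF this] n show ?thesis
    by (auto simp: entry_times_munit supported_def not_less)
qed

abbreviation fid :: "nat \<Rightarrow> fmat" where "fid n \<equiv> of_mat (1\<^sub>m n)"

lemma supported_fid: "supported n n (fid n)"
  by (rule supported_of_mat) simp

lemma fid_times: "supported n m x \<Longrightarrow> fid n * x = x"
  and times_fid: "supported n m x \<Longrightarrow> x * fid m = x"
  using of_mat_mult[of "1\<^sub>m n" n n "to_mat n m x" m] of_mat_mult[of "to_mat n m x" n m "1\<^sub>m m" m]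
  by simp_all

lemma fid_eq_sum: "fid n = (\<Sum>i<n. munit i i)"
  by (rule fmat_eqI) (auto simp: entry_munit intro!: sum.neutral[symmetric])

lemma to_mat_add: "to_mat n m (x + y) = to_mat n m x + to_mat n m y"
  and to_mat_scale: "to_mat n m (c *\<^sub>C x) = c \<cdot>\<^sub>m to_mat n m x"
  by (auto intro!: eq_matI)

lemma to_mat_times:
  "supported n k x \<Longrightarrow> supported k m y \<Longrightarrow> to_mat n m (x * y) = to_mat n k x * to_mat k m y"
  using of_mat_mult[of "to_mat n k x" n k "to_mat k m y" m]
  by (metis mult_carrier_mat of_mat_to_mat to_mat_carrier to_mat_of_mat)

lemma to_mat_adj: "to_mat n m (adj x) = mat_adjoint (to_mat m n x)"
  by (rule eq_matI) auto

section \<open>Duality with respect to the trace\<close>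

lemma linear_functional_expand:
  fixes \<phi> :: "complex mat \<Rightarrow> complex"
  assumes add: "\<And>X Y. X \<in> carrier_mat n n \<Longrightarrow> Y \<in> carrier_mat n n \<Longrightarrow> \<phi> (X + Y) = \<phi> X + \<phi> Y"
    and scale: "\<And>X c. X \<in> carrier_mat n n \<Longrightarrow> \<phi> (c \<cdot>\<^sub>m X) = c * \<phi> X"
    and Z: "Z \<in> carrier_mat n n"
  shows "\<phi> Z = (\<Sum>i<n. \<Sum>j<n. Z $$ (i, j) * \<phi> (to_mat n n (munit i j)))"
proof -
  define \<psi> where "\<psi> x = \<phi> (to_mat n n x)" for x
  have \<psi>: "\<psi> (x + y) = \<psi> x + \<psi> y" "\<psi> (c *\<^sub>C x) = c * \<psi> x" for x y c
    by (simp_all add: \<psi>_def to_mat_add to_mat_scale add scale)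
  have \<psi>0: "\<psi> 0 = 0" using \<psi>(2)[of 0 0] by simp
  have \<psi>_sum: "\<psi> (sum f A) = (\<Sum>a\<in>A. \<psi> (f a))" for f :: "nat \<Rightarrow> fmat" and A
    by (induction A rule: infinite_finite_induct) (simp_all add: \<psi> \<psi>0)
  have "\<phi> Z = \<psi> (of_mat Z)" using Z by (simp add: \<psi>_def)
  also have "\<dots> = (\<Sum>i<n. \<Sum>j<n. entry (of_mat Z) i j * \<psi> (munit i j))"
    by (subst fmat_expand[OF supported_of_mat[OF Z]]) (simp add: \<psi>_sum \<psi> del: entry_of_mat)
  also have "\<dots> = (\<Sum>i<n. \<Sum>j<n. Z $$ (i, j) * \<phi> (to_mat n n (munit i j)))"
    unfolding \<psi>_def using Z by (intro sum.cong) auto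
  finally show ?thesis .
qed

lemma mat_trace_add: "X \<in> carrier_mat n n \<Longrightarrow> Y \<in> carrier_mat n n \<Longrightarrow>
    mat_trace (X + Y) = mat_trace X + mat_trace Y"
  and mat_trace_smult: "X \<in> carrier_mat n n \<Longrightarrow> mat_trace (c \<cdot>\<^sub>m X) = c * mat_trace X"
  by (auto simp: mat_trace_def sum.distrib sum_distrib_left)

lemma mat_trace_eqI:
  assumes X: "X \<in> carrier_mat n n" "X' \<in> carrier_mat n n"
    and eq: "\<And>Z. Z \<in> carrier_mat n n \<Longrightarrow> mat_trace (X * Z) = mat_trace (X' * Z)"
  shows "X = X'"
proof (rule eq_matI)
  fix i j assume "i < dim_row X'" "j < dim_col X'"
  then have ij: "i < n" "j < n" using X by auto
  have "A $$ (i, j) = mat_trace (A * to_mat n n (munit j i))" if "A \<in> carrier_mat n n" for A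
    using that ij by (simp add: mat_trace_times[of _ n] supported_munit ftrace_times_munit)
  then show "X $$ (i, j) = X' $$ (i, j)" using eq X by simp
qed (use X in auto)

text \<open>The trace pairing is nondegenerate, so the description in \<open>adjoint_map\<close> has
  exactly one candidate, and equations for adjoints become trace identities.\<close>

lemma adjoint_map_eq_iff:
  assumes L: "mat_linear n m L" and X: "X \<in> carrier_mat n n" and Y: "Y \<in> carrier_mat m m"
  shows "adjoint_map n m L Y = X \<longleftrightarrow>
    (\<forall>Z\<in>carrier_mat n n. mat_trace (Y * L Z) = mat_trace (X * Z))"
proof -
  let ?Q = "\<lambda>X. X \<in> carrier_mat n n \<and> (\<forall>Z\<in>carrier_mat n n. mat_trace (Y * L Z) = mat_trace (X * Z))"
  \<comment> \<open>Pairing a matrix with the unit in position \<open>(j, i)\<close> returns its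
    entry \<open>(i, j)\<close>, hence the exchanged indices.\<close>
  let ?X = "mat n n (\<lambda>(i, j). mat_trace (Y * L (to_mat n n (munit j i))))"
  note L' = L[unfolded mat_linear_def]
  moreover have "?X \<in> carrier_mat n n" by simp
  moreover have "mat_trace (Y * L Z) = mat_trace (?X * Z)" if Z: "Z \<in> carrier_mat n n" for Z
  proof -
    have "mat_trace (Y * L Z) = (\<Sum>i<n. \<Sum>j<n. Z $$ (i, j) * mat_trace (Y * L (to_mat n n (munit i j))))"
      by (rule linear_functional_expand[of n "\<lambda>Z. mat_trace (Y * L Z)", OF _ _ Z])
        (use L' Y in \<open>auto simp: mult_add_distrib_mat[of _ m m _ m] mat_trace_add[of _ m] mult_smult_distrib[of _ m m _ m]
          mat_trace_smult[of _ m]\<close>)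
    also have "\<dots> = (\<Sum>j<n. \<Sum>i<n. ?X $$ (j, i) * Z $$ (i, j))"
      by (subst sum.swap) (auto intro!: sum.cong)
    also have "\<dots> = mat_trace (?X * Z)"
      using Z by (auto simp: mat_trace_def scalar_prod_def atLeast0LessThan intro!: sum.cong)
    finally show ?thesis .
  qed
  ultimately have Q: "?Q ?X" by blast
  have unique: "X1 = X2" if "?Q X1" "?Q X2" for X1 X2
    by (rule mat_trace_eqI[of _ n]) (use that in auto)
  have "?Q (adjoint_map n m L Y)"
    unfolding adjoint_map_def by (rule theI[of ?Q, OF Q]) (use unique Q in blast)
  then show ?thesis using unique X by blast
qed

section \<open>Kraus maps and composition of channels\<close>

lemma sum_lessThan_times: "(\<Sum>i<k * n. f i) = (\<Sum>a<k. \<Sum>s<n. f (a * n + s))"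
  for f :: "nat \<Rightarrow> 'a :: comm_monoid_add"
proof (induction k)
  case (Suc k)
  have "(\<Sum>i<m + n. f i) = (\<Sum>i<m. f i) + (\<Sum>s<n. f (m + s))" for m
    by (induction n) (simp_all add: add.assoc)
  from this[of "k * n"] Suc show ?case by (simp add: add.commute)
qed simp

section \<open>Quadratic forms, ampliations and Kraus operators\<close>

lemma positive_semidefinite_iff:
  "positive_semidefinite n X \<longleftrightarrow> X \<in> carrier_mat n n \<and>
     (\<forall>f. 0 \<le> (\<Sum>i<n. \<Sum>j<n. cnj (f i) * X $$ (i, j) * f j))"
proof -
  have form: "(X *\<^sub>v v) \<bullet>c v = (\<Sum>i<n. \<Sum>j<n. cnj (v $ i) * X $$ (i, j) * v $ j)"
    if "X \<in> carrier_mat n n" "v \<in> carrier_vec n" for v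
    using that by (auto simp: scalar_prod_def atLeast0LessThan sum_distrib_left sum_distrib_right
        mult.commute mult.left_commute intro!: sum.cong)
  have "(\<forall>v\<in>carrier_vec n. 0 \<le> (\<Sum>i<n. \<Sum>j<n. cnj (v $ i) * X $$ (i, j) * v $ j)) \<longleftrightarrow>
      (\<forall>f. 0 \<le> (\<Sum>i<n. \<Sum>j<n. cnj (f i) * X $$ (i, j) * f j))" (is "?L \<longleftrightarrow> ?R")
  proof
    assume L: ?L
    show ?R
    proof
      fix f
      show "0 \<le> (\<Sum>i<n. \<Sum>j<n. cnj (f i) * X $$ (i, j) * f j)"
        using L[rule_format, of "vec n f"] by simp
    qed
  qed blast
  then show ?thesis unfolding positive_semidefinite_def using form by auto
qed

text \<open>Splitting a row index into block number and position brings the quadratic form into the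
  shape in which the one of an ampliation can be computed.\<close>

lemma positive_semidefinite_block_iff:
  "positive_semidefinite (k * n) X \<longleftrightarrow> X \<in> carrier_mat (k * n) (k * n) \<and>
     (\<forall>g. 0 \<le> (\<Sum>a<k. \<Sum>b<k. \<Sum>s<n. \<Sum>t<n. cnj (g a s) * X $$ (a * n + s, b * n + t) * g b t))"
proof -
  let ?R = "\<lambda>g. \<Sum>a<k. \<Sum>b<k. \<Sum>s<n. \<Sum>t<n. cnj (g a s) * X $$ (a * n + s, b * n + t) * g b t"
  have *: "(\<Sum>i<k * n. \<Sum>j<k * n. cnj (f i) * X $$ (i, j) * f j) = ?R (\<lambda>a s. f (a * n + s))" for f
    unfolding sum_lessThan_times by (rule sum.cong[OF refl], rule sum.swap)
  have eq: "(\<forall>f. 0 \<le> ?R (\<lambda>a s. f (a * n + s))) \<longleftrightarrow> (\<forall>g. 0 \<le> ?R g)"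
  proof
    assume L: "\<forall>f. 0 \<le> ?R (\<lambda>a s. f (a * n + s))"
    show "\<forall>g. 0 \<le> ?R g"
    proof
      fix g
      have "?R g = ?R (\<lambda>a s. (\<lambda>i. g (i div n) (i mod n)) (a * n + s))"
        by (intro sum.cong refl) auto
      also have "0 \<le> \<dots>" using L by (rule spec)
      finally show "0 \<le> ?R g" .
    qed
  next
    assume R: "\<forall>g. 0 \<le> ?R g"
    show "\<forall>f. 0 \<le> ?R (\<lambda>a s. f (a * n + s))"
      by (rule allI) (rule R[THEN spec])
  qed
  show ?thesis unfolding positive_semidefinite_iff * by (intro conj_cong refl eq)
qed

lemma block_index_less: "a < k \<Longrightarrow> s < n \<Longrightarrow> a * n + s < k * (n :: nat)"
proof -
  assume "a < k" "s < n"
  then have "a * n + s < Suc a * n" by simp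
  also have "\<dots> \<le> k * n" using \<open>a < k\<close> by (intro mult_le_mono1) simp
  finally show ?thesis .
qed

lemma ampliation_carrier: "ampliation k n m \<Phi> X \<in> carrier_mat (k * m) (k * m)"
  by (simp add: ampliation_def)

lemma index_ampliation:
  "a < k \<Longrightarrow> b < k \<Longrightarrow> s < m \<Longrightarrow> t < m \<Longrightarrow>
    ampliation k n m \<Phi> X $$ (a * m + s, b * m + t) = \<Phi> (mat_block n X a b) $$ (s, t)"
  by (simp add: ampliation_def block_index_less)

lemma mat_block_carrier [simp]: "mat_block n X a b \<in> carrier_mat n n"
  by (simp add: mat_block_def)

lemma mat_block_ampliation:
  assumes "\<Phi> (mat_block n X a b) \<in> carrier_mat m m" "a < k" "b < k"
  shows "mat_block m (ampliation k n m \<Phi> X) a b = \<Phi> (mat_block n X a b)"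
  using assms by (intro eq_matI) (auto simp: mat_block_def index_ampliation)

lemma quantum_channelD:
  assumes "quantum_channel n m \<Phi>"
  shows "X \<in> carrier_mat n n \<Longrightarrow> \<Phi> X \<in> carrier_mat m m" and "mat_linear n m \<Phi>"
    and "completely_positive n m \<Phi>" and "X \<in> carrier_mat n n \<Longrightarrow> mat_trace (\<Phi> X) = mat_trace X"
  using assms by (auto simp: quantum_channel_def mat_linear_def)

lemma mat_linear_comp: "mat_linear n m \<Phi> \<Longrightarrow> mat_linear m l \<Psi> \<Longrightarrow> mat_linear n l (\<Psi> \<circ> \<Phi>)"
  by (simp add: mat_linear_def)

text \<open>Ampliation is functorial, since the blocks of an ampliation are the images of the
  blocks.\<close>

lemma quantum_channel_comp:
  assumes \<Phi>: "quantum_channel n m \<Phi>" and \<Psi>: "quantum_channel m l \<Psi>"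
  shows "quantum_channel n l (\<Psi> \<circ> \<Phi>)"
proof -
  note car = quantum_channelD(1)[OF \<Phi>] quantum_channelD(1)[OF \<Psi>]
  have "ampliation k n l (\<Psi> \<circ> \<Phi>) X = ampliation k m l \<Psi> (ampliation k n m \<Phi> X)" for k X
  proof (rule eq_matI)
    fix i j assume "i < dim_row (ampliation k m l \<Psi> (ampliation k n m \<Phi> X))"
      "j < dim_col (ampliation k m l \<Psi> (ampliation k n m \<Phi> X))"
    then have "i < k * l" "j < k * l" by (simp_all add: ampliation_def)
    moreover from this have "i div l < k" "j div l < k"
      by (simp_all add: less_mult_imp_div_less)
    ultimately show "ampliation k n l (\<Psi> \<circ> \<Phi>) X $$ (i, j) =
        ampliation k m l \<Psi> (ampliation k n m \<Phi> X) $$ (i, j)"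
      using mat_block_ampliation[of \<Phi> n X "i div l" "j div l" m k] car(1)
      by (simp add: ampliation_def)
  qed (simp_all add: ampliation_def)
  then have "completely_positive n l (\<Psi> \<circ> \<Phi>)"
    using quantum_channelD(3)[OF \<Phi>] quantum_channelD(3)[OF \<Psi>] by (simp add: completely_positive_def)
  then show ?thesis
    using mat_linear_comp quantum_channelD[OF \<Phi>] quantum_channelD[OF \<Psi>]
    by (simp add: quantum_channel_def)
qed

text \<open>The Kraus operators in the usual convention are the \<open>adj (K c)\<close>. With the
  adjoint on the left, \<open>K c\<close> itself can be an isometry from the smaller space into the
  larger, and the trace is preserved when the \<open>K c * adj (K c)\<close> add up to the
  identity.\<close>

definition kraus_map :: "nat \<Rightarrow> (nat \<Rightarrow> fmat) \<Rightarrow> nat \<Rightarrow> complex mat \<Rightarrow> complex mat" where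
  "kraus_map N K m Z = to_mat m m (\<Sum>c<N. adj (K c) * of_mat Z * K c)"

lemma entry_adj_times_times:
  assumes "supported n m x" "supported n n z"
  shows "entry (adj x * z * x) s t = (\<Sum>s'<n. \<Sum>t'<n. cnj (entry x s' s) * entry z s' t' * entry x t' t)"
proof -
  have "entry (adj x * z * x) s t = (\<Sum>t'<n. \<Sum>s'<n. cnj (entry x s' s) * entry z s' t' * entry x t' t)"
    using assms
    by (simp add: entry_times[OF supported_times[OF supported_adj]] entry_times[OF supported_adj] sum_distrib_right)
  then show ?thesis by (subst sum.swap)
qed

lemma sum_swap4:
  fixes f :: "'a \<Rightarrow> 'b \<Rightarrow> 'c \<Rightarrow> 'd \<Rightarrow> 'e :: comm_monoid_add"
  shows "(\<Sum>i\<in>A. \<Sum>j\<in>B. \<Sum>k\<in>C. \<Sum>l\<in>D. f i j k l) = (\<Sum>k\<in>C. \<Sum>l\<in>D. \<Sum>i\<in>A. \<Sum>j\<in>B. f i j k l)"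
proof -
  have "(\<Sum>i\<in>A. \<Sum>j\<in>B. \<Sum>k\<in>C. \<Sum>l\<in>D. f i j k l) = (\<Sum>i\<in>A. \<Sum>k\<in>C. \<Sum>j\<in>B. \<Sum>l\<in>D. f i j k l)"
    by (rule sum.cong[OF refl], rule sum.swap)
  also have "\<dots> = (\<Sum>k\<in>C. \<Sum>i\<in>A. \<Sum>j\<in>B. \<Sum>l\<in>D. f i j k l)"
    by (rule sum.swap)
  also have "\<dots> = (\<Sum>k\<in>C. \<Sum>i\<in>A. \<Sum>l\<in>D. \<Sum>j\<in>B. f i j k l)"
    by (rule sum.cong[OF refl], rule sum.cong[OF refl], rule sum.swap)
  also have "\<dots> = (\<Sum>k\<in>C. \<Sum>l\<in>D. \<Sum>i\<in>A. \<Sum>j\<in>B. f i j k l)"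
    by (rule sum.cong[OF refl], rule sum.swap)
  finally show ?thesis .
qed

text \<open>The quadratic form of the ampliation at \<open>g\<close> is the sum over
  \<open>c\<close> of the quadratic form of \<open>X\<close> at \<open>w c\<close>, the image of
  \<open>g\<close> under the identity tensored with \<open>K c\<close>.\<close>

lemma completely_positive_kraus_map:
  assumes K: "\<And>c. c < N \<Longrightarrow> supported n m (K c)"
  shows "completely_positive n m (kraus_map N K m)"
  unfolding completely_positive_def
proof (intro allI impI)
  fix k X assume X: "positive_semidefinite (k * n) X"
  have "0 \<le> (\<Sum>a<k. \<Sum>b<k. \<Sum>s<m. \<Sum>t<m. cnj (g a s) *
      ampliation k n m (kraus_map N K m) X $$ (a * m + s, b * m + t) * g b t)" for g
  proof -
    define w where "w c a s' = (\<Sum>s<m. entry (K c) s' s * g a s)" for c a s'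
    let ?X = "\<lambda>a b s' t'. X $$ (a * n + s', b * n + t')"
    have "(\<Sum>a<k. \<Sum>b<k. \<Sum>s<m. \<Sum>t<m. cnj (g a s) *
        ampliation k n m (kraus_map N K m) X $$ (a * m + s, b * m + t) * g b t) =
      (\<Sum>a<k. \<Sum>b<k. \<Sum>c<N. \<Sum>s'<n. \<Sum>t'<n. cnj (w c a s') * ?X a b s' t' * w c b t')"
    proof (rule sum.cong[OF refl], rule sum.cong[OF refl])
      fix a b assume "a \<in> {..<k}" "b \<in> {..<k}"
      then have ab: "a < k" "b < k" by auto
      have entry: "ampliation k n m (kraus_map N K m) X $$ (a * m + s, b * m + t) =
          (\<Sum>c<N. \<Sum>s'<n. \<Sum>t'<n. cnj (entry (K c) s' s) * ?X a b s' t' * entry (K c) t' t)"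
        if "s < m" "t < m" for s t
      proof -
        have "ampliation k n m (kraus_map N K m) X $$ (a * m + s, b * m + t) =
            (\<Sum>c<N. entry (adj (K c) * of_mat (mat_block n X a b) * K c) s t)"
          using ab that by (simp add: index_ampliation kraus_map_def)
        also have "\<dots> = (\<Sum>c<N. \<Sum>s'<n. \<Sum>t'<n. cnj (entry (K c) s' s) *
            entry (of_mat (mat_block n X a b)) s' t' * entry (K c) t' t)"
          by (intro sum.cong refl entry_adj_times_times[OF K supported_of_mat]) auto
        also have "\<dots> = (\<Sum>c<N. \<Sum>s'<n. \<Sum>t'<n. cnj (entry (K c) s' s) * ?X a b s' t' * entry (K c) t' t)"
          by (intro sum.cong refl) (simp add: mat_block_def)
        finally show ?thesis .
      qed
      have "(\<Sum>s<m. \<Sum>t<m. cnj (g a s) *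
          ampliation k n m (kraus_map N K m) X $$ (a * m + s, b * m + t) * g b t) =
        (\<Sum>s<m. \<Sum>t<m. \<Sum>c<N. \<Sum>s'<n. \<Sum>t'<n.
          cnj (g a s) * (cnj (entry (K c) s' s) * ?X a b s' t' * entry (K c) t' t) * g b t)"
        by (intro sum.cong refl) (simp add: entry sum_distrib_left sum_distrib_right)
      also have "\<dots> = (\<Sum>s<m. \<Sum>c<N. \<Sum>t<m. \<Sum>s'<n. \<Sum>t'<n.
          cnj (g a s) * (cnj (entry (K c) s' s) * ?X a b s' t' * entry (K c) t' t) * g b t)"
        by (rule sum.cong[OF refl], rule sum.swap)
      also have "\<dots> = (\<Sum>c<N. \<Sum>s<m. \<Sum>t<m. \<Sum>s'<n. \<Sum>t'<n.
          cnj (g a s) * (cnj (entry (K c) s' s) * ?X a b s' t' * entry (K c) t' t) * g b t)"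
        by (rule sum.swap)
      also have "\<dots> = (\<Sum>c<N. \<Sum>s'<n. \<Sum>t'<n. \<Sum>s<m. \<Sum>t<m.
          cnj (g a s) * (cnj (entry (K c) s' s) * ?X a b s' t' * entry (K c) t' t) * g b t)"
        by (rule sum.cong[OF refl], rule sum_swap4)
      also have "\<dots> = (\<Sum>c<N. \<Sum>s'<n. \<Sum>t'<n. cnj (w c a s') * ?X a b s' t' * w c b t')"
      proof (intro sum.cong refl)
        fix c s' t'
        have "cnj (w c a s') * ?X a b s' t' * w c b t' =
            (\<Sum>s<m. cnj (entry (K c) s' s * g a s) * ?X a b s' t') * (\<Sum>t<m. entry (K c) t' t * g b t)"
          by (simp add: w_def sum_distrib_right)
        also have "\<dots> = (\<Sum>s<m. \<Sum>t<m. (cnj (entry (K c) s' s * g a s) * ?X a b s' t') * (entry (K c) t' t * g b t))"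
          by (rule sum_product)
        finally show "(\<Sum>s<m. \<Sum>t<m. cnj (g a s) * (cnj (entry (K c) s' s) * ?X a b s' t' *
            entry (K c) t' t) * g b t) = cnj (w c a s') * ?X a b s' t' * w c b t'"
          by (simp add: mult_ac)
      qed
      finally show "(\<Sum>s<m. \<Sum>t<m. cnj (g a s) *
          ampliation k n m (kraus_map N K m) X $$ (a * m + s, b * m + t) * g b t) =
        (\<Sum>c<N. \<Sum>s'<n. \<Sum>t'<n. cnj (w c a s') * ?X a b s' t' * w c b t')" .
    qed
    also have "\<dots> = (\<Sum>a<k. \<Sum>c<N. \<Sum>b<k. \<Sum>s'<n. \<Sum>t'<n. cnj (w c a s') * ?X a b s' t' * w c b t')"
      by (rule sum.cong[OF refl], rule sum.swap)
    also have "\<dots> = (\<Sum>c<N. \<Sum>a<k. \<Sum>b<k. \<Sum>s'<n. \<Sum>t'<n. cnj (w c a s') * ?X a b s' t' * w c b t')"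
      by (rule sum.swap)
    also have "0 \<le> \<dots>"
    proof (rule sum_nonneg)
      fix c
      show "0 \<le> (\<Sum>a<k. \<Sum>b<k. \<Sum>s'<n. \<Sum>t'<n. cnj (w c a s') * ?X a b s' t' * w c b t')"
        using X[unfolded positive_semidefinite_block_iff] by blast
    qed
    finally show ?thesis .
  qed
  then show "positive_semidefinite (k * m) (ampliation k n m (kraus_map N K m) X)"
    unfolding positive_semidefinite_block_iff using ampliation_carrier by blast
qed

lemma supported_kraus_sum:
  assumes K: "\<And>c. c < N \<Longrightarrow> supported n m (K c)"
  shows "supported m m (\<Sum>c<N. adj (K c) * z * K c)"
  by (intro supported_sum supported_times[OF supported_times[OF supported_adj[OF K] supported_fdim] K]) auto

lemma quantum_channel_kraus_map:
  assumes K: "\<And>c. c < N \<Longrightarrow> supported n m (K c)" and id: "(\<Sum>c<N. K c * adj (K c)) = fid n"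
  shows "quantum_channel n m (kraus_map N K m)"
  unfolding quantum_channel_def mat_linear_def
proof (intro conjI ballI allI completely_positive_kraus_map K)
  fix X Y :: "complex mat" assume X: "X \<in> carrier_mat n n" and Y: "Y \<in> carrier_mat n n"
  then show "kraus_map N K m (X + Y) = kraus_map N K m X + kraus_map N K m Y"
    by (simp add: kraus_map_def of_mat_add[of _ n n] algebra_simps sum.distrib flip: to_mat_add)
next
  fix X :: "complex mat" and c assume X: "X \<in> carrier_mat n n"
  show "kraus_map N K m X \<in> carrier_mat m m" by (simp add: kraus_map_def)
  show "kraus_map N K m (c \<cdot>\<^sub>m X) = c \<cdot>\<^sub>m kraus_map N K m X"
    by (simp add: kraus_map_def fmat.scale_sum_right flip: to_mat_scale)
  have "mat_trace (kraus_map N K m X) = ftrace (of_mat (kraus_map N K m X))"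
    by (subst ftrace_of_mat[of _ m m]) (auto simp: kraus_map_def)
  also have "\<dots> = ftrace (\<Sum>c<N. adj (K c) * of_mat X * K c)"
    unfolding kraus_map_def by (subst of_mat_to_mat) (auto intro: supported_kraus_sum K)
  also have "\<dots> = (\<Sum>c<N. ftrace (K c * adj (K c) * of_mat X))"
    unfolding ftrace_sum by (intro sum.cong refl) (subst ftrace_commute, simp add: mult.assoc)
  also have "\<dots> = ftrace (fid n * of_mat X)"
    by (simp add: ftrace_sum sum_distrib_right flip: id)
  also have "\<dots> = mat_trace X"
    using X by (simp add: fid_times[OF supported_of_mat] ftrace_of_mat)
  finally show "mat_trace (kraus_map N K m X) = mat_trace X" .
qed

section \<open>Transmittability passes to subalgebras\<close>

lemma full_matrix_star_algebra: "matrix_star_algebra n {x. supported n n x} (fid n)"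
  by unfold_locales
    (auto simp: fid_times times_fid supported_fid intro: supported_add supported_scale supported_times supported_adj)

lemma corner_matrix_star_algebra:
  assumes q: "supported n n q" "adj q = q" "q * q = q"
  shows "matrix_star_algebra n {x. supported n n x \<and> q * x = x \<and> x * q = x} q"
proof unfold_locales
  fix x y assume xy: "x \<in> {x. supported n n x \<and> q * x = x \<and> x * q = x}"
    "y \<in> {x. supported n n x \<and> q * x = x \<and> x * q = x}"
  then have "q * (x * y) = x * y" "x * y * q = x * y"
    by (simp_all add: mult.assoc) (simp add: mult.assoc[symmetric])
  then show "x * y \<in> {x. supported n n x \<and> q * x = x \<and> x * q = x}"
    using xy by (auto intro: supported_times)
next
  fix x assume x: "x \<in> {x. supported n n x \<and> q * x = x \<and> x * q = x}"
  then have "adj (q * x) = adj x" "adj (x * q) = adj x" by simp_all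
  then have "adj x * q = adj x" "q * adj x = adj x" using q by simp_all
  then show "adj x \<in> {x. supported n n x \<and> q * x = x \<and> x * q = x}"
    using x by (auto intro: supported_adj)
qed (use q in \<open>auto simp: distrib_left distrib_right intro: supported_add supported_scale\<close>)

text \<open>A minimal projection in the corner of \<open>q\<close> has rank one, expressed here as
  equivalence with \<open>munit 0 0\<close>: the partial isometry between them is a single column.
  The columns of a decomposition of \<open>q\<close> make up the isometry.\<close>

lemma projection_factorization:
  assumes q: "supported n n q" "adj q = q" "q * q = q"
  obtains r v where "supported n r v" "adj v * v = fid r" "v * adj v = q"
proof -
  interpret C: matrix_star_algebra n "{x. supported n n x \<and> q * x = x \<and> x * q = x}" q
    using q by (rule corner_matrix_star_algebra)
  interpret M: matrix_star_algebra n "{x. supported n n x}" "fid n"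
    by (rule full_matrix_star_algebra)
  obtain F where F: "C.decomposition F" "\<And>p. p \<in> F \<Longrightarrow> C.minimal p"
    using C.minimal_decomposition by blast
  then have pr: "supported n n p" "q * p = p" "p * q = p" "adj p = p" "p * p = p" "p \<noteq> 0"
    if "p \<in> F" for p
    using that by (auto simp: C.decomposition_def C.projections_def)
  \<comment> \<open>Every compression by \<open>p\<close> factors through the corner because
    \<open>p\<close> lies below \<open>q\<close>; minimality there is minimality among all matrices
    of size \<open>n\<close>.\<close>
  have minimal: "M.minimal p" if p: "p \<in> F" for p
    unfolding M.minimal_def
  proof
    fix x assume x: "x \<in> {x. supported n n x}"
    have "q * (q * x * q) = q * x * q" "q * x * q * q = q * x * q"
      using q by (simp_all add: mult.assoc) (simp add: mult.assoc[symmetric])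
    then have "\<exists>c. p * (q * x * q) * p = c *\<^sub>C p"
      using F(2)[OF p] x q unfolding C.minimal_def by (auto intro!: supported_times)
    moreover have "p * (q * x * q) * p = p * x * p"
      using pr[OF p] by (simp add: mult.assoc) (simp add: mult.assoc[symmetric])
    ultimately show "\<exists>c. p * x * p = c *\<^sub>C p" by simp
  qed
  have "\<exists>w. supported n 1 w \<and> p * w = w \<and> w * munit 0 0 = w \<and> w * adj w = p \<and> adj w * w = munit 0 0"
    if p: "p \<in> F" for p
  proof -
    obtain a b where ab: "entry p a b \<noteq> 0" using pr[OF p] by (metis entry_zero fmat_eqI)
    then have "a < n" "b < n" using pr(1)[OF p] unfolding supported_def by (meson not_le)+
    then have n: "0 < n" by simp
    have "munit 0 0 \<in> M.projections"
      using n by (auto simp: M.projections_def supported_munit munit_times_munit) (metis entry_munit entry_zero zero_neq_one)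
    moreover have "M.minimal (munit 0 0)"
      unfolding M.minimal_def
    proof
      fix x
      have "munit 0 0 * x * munit 0 0 = entry x 0 0 *\<^sub>C munit 0 0"
        by (rule fmat_eqI) (simp add: entry_times_munit entry_munit_times entry_munit)
      then show "\<exists>c. munit 0 0 * x * munit 0 0 = c *\<^sub>C munit 0 0" by blast
    qed
    moreover have "p * munit b 0 * munit 0 0 \<noteq> 0"
    proof -
      have "entry (p * munit b 0 * munit 0 0) a 0 = entry p a b"
        by (simp add: entry_times_munit)
      then show ?thesis using ab by (metis entry_zero)
    qed
    moreover have "p \<in> M.projections" using pr[OF p] by (simp add: M.projections_def)
    ultimately obtain w where w: "p * w = w" "w * munit 0 0 = w" "w * adj w = p"
        "adj w * w = munit 0 0" "supported n n w"
      using M.partial_isometry[OF _ minimal[OF p], of "munit 0 0" "munit b 0"] n \<open>b < n\<close>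
      by (auto simp: supported_munit)
    then have "supported n 1 (w * munit 0 0)"
      by (intro supported_times[OF w(5) supported_munit[of 0 1 0 1]]) auto
    then show ?thesis using w by auto
  qed
  then obtain w where w: "\<And>p. p \<in> F \<Longrightarrow> supported n 1 (w p)" "\<And>p. p \<in> F \<Longrightarrow> p * w p = w p"
    "\<And>p. p \<in> F \<Longrightarrow> w p * munit 0 0 = w p" "\<And>p. p \<in> F \<Longrightarrow> w p * adj (w p) = p"
    "\<And>p. p \<in> F \<Longrightarrow> adj (w p) * w p = munit 0 0"
    by metis
  have fin: "finite F" and orth: "\<And>p p'. p \<in> F \<Longrightarrow> p' \<in> F \<Longrightarrow> p \<noteq> p' \<Longrightarrow> p * p' = 0" and sum: "\<Sum>F = q"
    using F(1) by (auto simp: C.decomposition_def)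
  define r where "r = card F"
  obtain b where b: "bij_betw b {..<r} F"
    unfolding r_def lessThan_atLeast0 using fin ex_bij_betw_nat_finite by blast
  have bF: "b i \<in> F" if "i < r" for i using b that by (auto simp: bij_betw_def)
  have ww: "adj (w (b i)) * w (b j) = (if i = j then munit 0 0 else 0)" if "i < r" "j < r" for i j
  proof (cases "i = j")
    case False
    then have "b i \<noteq> b j" using b that by (auto simp: bij_betw_def inj_on_def)
    then have "b i * b j = 0" using orth bF that by simp
    have "adj (w (b i)) * b i = adj (w (b i))"
      using arg_cong[OF w(2)[OF bF[OF that(1)]], of adj] pr(4)[OF bF[OF that(1)]] by simp
    then have "adj (w (b i)) * w (b j) = adj (w (b i)) * b i * (b j * w (b j))"
      using w(2) bF that by simp
    also have "\<dots> = adj (w (b i)) * (b i * b j) * w (b j)" by (simp add: mult.assoc)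
    finally show ?thesis using False \<open>b i * b j = 0\<close> by simp
  qed (use w(5) bF that in simp)
  \<comment> \<open>The factor \<open>munit 0 i\<close> shifts the column \<open>w (b i)\<close>
    into position \<open>i\<close>.\<close>
  define v where "v = (\<Sum>i<r. w (b i) * munit 0 i)"
  have "supported n r v"
    unfolding v_def by (intro supported_sum supported_times[OF w(1) supported_munit[of 0 1]]) (auto simp: bF)
  moreover have "adj v * v = fid r"
  proof -
    have "adj v * v = (\<Sum>i<r. \<Sum>j<r. munit i 0 * (adj (w (b i)) * w (b j)) * munit 0 j)"
      by (simp add: v_def sum_product mult.assoc)
    also have "\<dots> = (\<Sum>i<r. \<Sum>j<r. if j = i then munit i i else 0)"
      by (intro sum.cong refl) (auto simp: ww munit_times_munit)
    finally show ?thesis by (simp add: fid_eq_sum)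
  qed
  moreover have "v * adj v = q"
  proof -
    have "v * adj v = (\<Sum>i<r. \<Sum>j<r. w (b i) * (munit 0 i * munit j 0) * adj (w (b j)))"
      by (simp add: v_def sum_product mult.assoc)
    also have "\<dots> = (\<Sum>i<r. \<Sum>j<r. if j = i then w (b i) * munit 0 0 * adj (w (b i)) else 0)"
      by (intro sum.cong refl) (auto simp: munit_times_munit)
    also have "\<dots> = (\<Sum>i<r. b i)" using w(3,4) bF by simp
    also have "\<dots> = q" using sum.reindex_bij_betw[OF b, of "\<lambda>p. p"] sum by simp
    finally show ?thesis .
  qed
  ultimately show thesis by (rule that)
qed

section \<open>Correctability as a trace identity\<close>

lemma mat_linear_compress:
  assumes \<Phi>: "mat_linear n m \<Phi>" and V: "V \<in> carrier_mat n r"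
  shows "mat_linear r m (\<lambda>Y. \<Phi> (V * Y * mat_adjoint V))"
proof -
  have car: "V * Y * mat_adjoint V \<in> carrier_mat n n" if "Y \<in> carrier_mat r r" for Y
    using V that by (metis mat_adjoint_carrier mult_carrier_mat)
  have add: "V * (X + Y) * mat_adjoint V = V * X * mat_adjoint V + V * Y * mat_adjoint V"
    if "X \<in> carrier_mat r r" "Y \<in> carrier_mat r r" for X Y
    using V that by (simp add: mult_add_distrib_mat[of _ n r _ r] add_mult_distrib_mat[of _ n r _ _ n])
  have scale: "V * (c \<cdot>\<^sub>m X) * mat_adjoint V = c \<cdot>\<^sub>m (V * X * mat_adjoint V)"
    if "X \<in> carrier_mat r r" for X c
    using V that by (simp add: mult_smult_distrib[of _ n r _ r] mult_smult_assoc_mat[of _ n r _ n])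
  show ?thesis using \<Phi> car by (simp add: mat_linear_def add scale)
qed

text \<open>The matrices enter through \<open>of_mat\<close>, so that products may be rearranged without dimension
  constraints.\<close>

lemma correctable_iff:
  assumes \<Phi>: "quantum_channel n m \<Phi>"
  shows "correctable n m \<Phi> S \<longleftrightarrow> star_subalgebra n S \<and>
    (\<exists>P\<in>S. (\<forall>X\<in>S. P * X = X \<and> X * P = X) \<and>
      (\<exists>r v. supported n r v \<and> adj v * v = fid r \<and> v * adj v = of_mat P \<and>
        (\<exists>D. quantum_channel m r D \<and> (\<forall>X\<in>S. \<forall>y. supported r r y \<longrightarrow>
          ftrace (adj v * of_mat X * v * of_mat (D (\<Phi> (to_mat n n (v * y * adj v))))) =
          ftrace (adj v * of_mat X * v * y)))))"
proof -
  have key: "(\<forall>X\<in>(\<lambda>Z. mat_adjoint V * Z * V) ` S. adjoint_map r r (D \<circ> (\<lambda>Y. \<Phi> (V * Y * mat_adjoint V))) X = X)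
    \<longleftrightarrow> (\<forall>X\<in>S. \<forall>y. supported r r y \<longrightarrow>
      ftrace (adj v * of_mat X * v * of_mat (D (\<Phi> (to_mat n n (v * y * adj v))))) =
      ftrace (adj v * of_mat X * v * y))"
    if S: "S \<subseteq> carrier_mat n n" and D: "quantum_channel m r D" and V: "V \<in> carrier_mat n r" and v: "v = of_mat V"
    for r D V v
  proof -
    let ?L = "\<lambda>Y. \<Phi> (V * Y * mat_adjoint V)"
    have "mat_linear r m ?L"
      by (rule mat_linear_compress[OF quantum_channelD(2)[OF \<Phi>] V])
    then have L: "mat_linear r r (D \<circ> ?L)"
      using quantum_channelD(2)[OF D] by (rule mat_linear_comp)
    have "adjoint_map r r (D \<circ> ?L) (mat_adjoint V * X * V) = mat_adjoint V * X * V \<longleftrightarrow>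
        (\<forall>y. supported r r y \<longrightarrow>
          ftrace (adj v * of_mat X * v * of_mat (D (\<Phi> (to_mat n n (v * y * adj v))))) =
          ftrace (adj v * of_mat X * v * y))" if X: "X \<in> S" for X
    proof -
      have Xc: "X \<in> carrier_mat n n" using X S by auto
      have c: "mat_adjoint V * X * V \<in> carrier_mat r r"
        using V Xc by (metis mat_adjoint_carrier mult_carrier_mat)
      have of: "of_mat (mat_adjoint V * X * V) = adj v * of_mat X * v"
        using V Xc by (simp add: v of_mat_mult[of _ r n _ r] of_mat_mult[of _ r n _ n]
            mult_carrier_mat[of _ r n _ n] del: assoc_mult_mat)
      have "(\<forall>Z\<in>carrier_mat r r. mat_trace (mat_adjoint V * X * V * (D \<circ> ?L) Z) =
            mat_trace (mat_adjoint V * X * V * Z)) \<longleftrightarrow>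
          (\<forall>y. supported r r y \<longrightarrow>
          ftrace (adj v * of_mat X * v * of_mat (D (\<Phi> (to_mat n n (v * y * adj v))))) =
          ftrace (adj v * of_mat X * v * y))" (is "?A \<longleftrightarrow> ?B")
      proof -
        have one: "mat_trace (mat_adjoint V * X * V * (D \<circ> ?L) (to_mat r r y)) =
          ftrace (adj v * of_mat X * v * of_mat (D (\<Phi> (to_mat n n (v * y * adj v)))))"
          "mat_trace (mat_adjoint V * X * V * to_mat r r y) = ftrace (adj v * of_mat X * v * y)"
          if y: "supported r r y" for y
        proof -
          have "V * to_mat r r y * mat_adjoint V = to_mat n n (v * y * adj v)"
            using V y supported_of_mat[OF V]
            by (simp add: v to_mat_times[of _ r] to_mat_adj supported_times[of n r _ r r] supported_adj)
          moreover have "(D \<circ> ?L) (to_mat r r y) \<in> carrier_mat r r"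
            using L by (simp add: mat_linear_def)
          ultimately show "mat_trace (mat_adjoint V * X * V * (D \<circ> ?L) (to_mat r r y)) =
            ftrace (adj v * of_mat X * v * of_mat (D (\<Phi> (to_mat n n (v * y * adj v)))))"
            using mat_trace_times[OF c] of by (simp del: assoc_mult_mat)
          show "mat_trace (mat_adjoint V * X * V * to_mat r r y) = ftrace (adj v * of_mat X * v * y)"
            using mat_trace_times[OF c, of "to_mat r r y"] of y by (simp del: assoc_mult_mat)
        qed
        show ?thesis
        proof
          assume A: ?A
          show ?B
          proof (intro allI impI)
            fix y assume y: "supported r r y"
            show "ftrace (adj v * of_mat X * v * of_mat (D (\<Phi> (to_mat n n (v * y * adj v))))) =
              ftrace (adj v * of_mat X * v * y)"
              using A[rule_format, of "to_mat r r y"] one[OF y] by (simp only: to_mat_carrier simp_thms)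
          qed
        next
          assume B: ?B
          show ?A
          proof
            fix Z :: "complex mat" assume Z: "Z \<in> carrier_mat r r"
            then have y: "supported r r (of_mat Z)" by (rule supported_of_mat)
            show "mat_trace (mat_adjoint V * X * V * (D \<circ> ?L) Z) = mat_trace (mat_adjoint V * X * V * Z)"
              using B[rule_format, OF y] one[OF y] Z by (simp only: to_mat_of_mat)
          qed
        qed
      qed
      then show ?thesis unfolding adjoint_map_eq_iff[OF L c c] .
    qed
    then show ?thesis by (simp only: ball_simps) (metis (no_types, lifting))
  qed
  have iso: "mat_adjoint V * V = 1\<^sub>m r \<longleftrightarrow> adj v * v = fid r" "V * mat_adjoint V = P \<longleftrightarrow> v * adj v = of_mat P"
    if "V \<in> carrier_mat n r" "v = of_mat V" "P \<in> carrier_mat n n" for V r v P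
  proof -
    have "adj v * v = of_mat (mat_adjoint V * V)" "v * adj v = of_mat (V * mat_adjoint V)"
      using that by (simp_all add: of_mat_mult[of _ r n _ r] of_mat_mult[of _ n r _ n])
    moreover have "mat_adjoint V * V \<in> carrier_mat r r" "V * mat_adjoint V \<in> carrier_mat n n"
      using that by (metis mat_adjoint_carrier mult_carrier_mat)+
    ultimately show "mat_adjoint V * V = 1\<^sub>m r \<longleftrightarrow> adj v * v = fid r"
      "V * mat_adjoint V = P \<longleftrightarrow> v * adj v = of_mat P"
      using of_mat_inject[of _ r r "1\<^sub>m r"] of_mat_inject[of _ n n P] that by simp_all
  qed
  have bridge: "(\<exists>V. V \<in> carrier_mat n r \<and> mat_adjoint V * V = 1\<^sub>m r \<and> V * mat_adjoint V = P \<and>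
         (\<exists>D. quantum_channel m r D \<and>
           (\<forall>X\<in>(\<lambda>Z. mat_adjoint V * Z * V) ` S.
              adjoint_map r r (D \<circ> (\<lambda>Y. \<Phi> (V * Y * mat_adjoint V))) X = X))) \<longleftrightarrow>
     (\<exists>v. supported n r v \<and> adj v * v = fid r \<and> v * adj v = of_mat P \<and>
        (\<exists>D. quantum_channel m r D \<and> (\<forall>X\<in>S. \<forall>y. supported r r y \<longrightarrow>
          ftrace (adj v * of_mat X * v * of_mat (D (\<Phi> (to_mat n n (v * y * adj v))))) =
          ftrace (adj v * of_mat X * v * y))))" (is "(\<exists>V. ?L V) \<longleftrightarrow> (\<exists>v. ?R v)")
    if S: "S \<subseteq> carrier_mat n n" "P \<in> S" for P r
  proof
    assume "\<exists>V. ?L V"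
    then obtain V where V: "?L V" by blast
    then have "?R (of_mat V)"
      using key[OF S(1) _ _ refl, of r _ V] iso[OF _ refl, of V r P] S supported_of_mat[of V n r] by blast
    then show "\<exists>v. ?R v" by blast
  next
    assume "\<exists>v. ?R v"
    then obtain v where v: "?R v" by blast
    then have "v = of_mat (to_mat n r v)" by simp
    then have "?L (to_mat n r v)"
      using v key[OF S(1) _ to_mat_carrier[of n r v], of _ v] iso[OF to_mat_carrier[of n r v], of v P] S
        to_mat_carrier[of n r v] by blast
    then show "\<exists>V. ?L V" by blast
  qed
  show ?thesis
    unfolding correctable_def
    by (rule conj_cong[OF refl], rule bex_cong[OF refl], rule conj_cong[OF refl], rule iff_exI, rule bridge)
      (auto simp: star_subalgebra_def)
qed

text \<open>Cyclicity of the trace moves the Kraus operators onto the observable \<open>a\<close>,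
  which gives the dual map.\<close>

lemma ftrace_times_kraus_map:
  assumes "\<And>c. c < N \<Longrightarrow> supported r s (K c)"
  shows "ftrace (a * of_mat (kraus_map N K s Z)) = ftrace ((\<Sum>c<N. K c * a * adj (K c)) * of_mat Z)"
proof -
  have "ftrace (a * of_mat (kraus_map N K s Z)) = (\<Sum>c<N. ftrace (a * (adj (K c) * of_mat Z * K c)))"
    unfolding kraus_map_def using supported_kraus_sum[OF assms, of N "\<lambda>c. c" "of_mat Z"]
    by (simp add: sum_distrib_left ftrace_sum)
  also have "\<dots> = (\<Sum>c<N. ftrace (K c * a * adj (K c) * of_mat Z))"
  proof (rule sum.cong[OF refl])
    fix c
    have "ftrace (a * (adj (K c) * of_mat Z * K c)) = ftrace (a * adj (K c) * of_mat Z * K c)"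
      by (simp add: mult.assoc)
    also have "\<dots> = ftrace (K c * (a * adj (K c) * of_mat Z))" by (rule ftrace_commute)
    finally show "ftrace (a * (adj (K c) * of_mat Z * K c)) = ftrace (K c * a * adj (K c) * of_mat Z)"
      by (simp add: mult.assoc)
  qed
  finally show ?thesis by (simp add: sum_distrib_right ftrace_sum)
qed

text \<open>A channel that compresses by an isometry \<open>w\<close> and sends the rest of the state, which lies on
  the orthogonal complement of the range of \<open>w\<close>, to a fixed pure state.\<close>

lemma compression_channel:
  assumes w: "supported r s w" "adj w * w = fid s" and s: "0 < s"
  obtains \<Lambda> where "quantum_channel r s \<Lambda>"
    "\<And>a Z. ftrace (a * of_mat (\<Lambda> Z)) =
       ftrace ((w * a * adj w + entry a 0 0 *\<^sub>C (fid r - w * adj w)) * of_mat Z)"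
proof -
  define R where "R = fid r - w * adj w"
  \<comment> \<open>The adjoint of \<open>R * munit c 0\<close> takes the \<open>c\<close>-th
    coordinate after projecting by \<open>R\<close> and places it on the basis vector with index
    \<open>0\<close>. This vector is the fixed pure state; it exists because \<open>0 < s\<close>,
    and it is why observables contribute only their entry \<open>(0, 0)\<close>.\<close>
  define K where "K c = (case c of 0 \<Rightarrow> w | Suc c \<Rightarrow> R * munit c 0)" for c
  have wf: "fid r * w = w" "w * fid s = w" "fid s * adj w = adj w" "adj w * fid r = adj w"
    using w supported_adj[OF w(1)] by (simp_all add: fid_times times_fid)
  have R: "supported r r R" "adj R = R"
    unfolding R_def using supported_fid[of r] supported_times[OF w(1) supported_adj[OF w(1)]]
    by (auto simp: supported_def fid_eq_sum)
  have "w * adj w * (w * adj w) = w * (adj w * w) * adj w" by (simp add: mult.assoc)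
  also have "\<dots> = w * adj w" by (simp add: w wf)
  finally have RR: "R * R = R"
    using wf fid_times[OF supported_fid[of r]] unfolding R_def by (simp add: algebra_simps flip: mult.assoc)
      (simp add: mult.assoc wf)
  have K: "supported r s (K c)" if "c < Suc r" for c
    using that s w(1) R(1) unfolding K_def by (auto split: nat.split intro!: supported_times supported_munit)
  have Ksum: "(\<Sum>c<Suc r. K c * a * adj (K c)) = w * a * adj w + entry a 0 0 *\<^sub>C R" for a
  proof -
    have "munit c 0 * a * munit 0 c = entry a 0 0 *\<^sub>C munit c c" for c
      by (rule fmat_eqI) (simp add: entry_times_munit entry_munit_times entry_munit)
    then have "R * munit c 0 * a * adj (R * munit c 0) = entry a 0 0 *\<^sub>C (R * munit c c * R)" for c
      by (simp add: R mult.assoc) (metis mult.assoc scale_mult_left scale_mult_right)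
    then have "(\<Sum>c<r. R * munit c 0 * a * adj (R * munit c 0)) = entry a 0 0 *\<^sub>C (R * fid r * R)"
      by (simp add: fid_eq_sum sum_distrib_left sum_distrib_right fmat.scale_sum_right)
    then show ?thesis
      using times_fid[OF R(1)] RR by (simp add: sum.lessThan_Suc_shift K_def del: sum.lessThan_Suc)
  qed
  \<comment> \<open>This is \<open>Ksum\<close> at the identity, whose entry \<open>(0, 0)\<close>
    is \<open>1\<close>; the result is \<open>w * adj w + R\<close>.\<close>
  have "(\<Sum>c<Suc r. K c * adj (K c)) = fid r"
  proof -
    have "K c * fid s * adj (K c) = K c * adj (K c)" if "c < Suc r" for c
      using times_fid[OF K[OF that]] by simp
    then have "(\<Sum>c<Suc r. K c * adj (K c)) = (\<Sum>c<Suc r. K c * fid s * adj (K c))"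
      by (intro sum.cong) auto
    also have "\<dots> = fid r" unfolding Ksum using s wf by (simp add: R_def)
    finally show ?thesis .
  qed
  then have "quantum_channel r s (kraus_map (Suc r) K s)"
    using K by (intro quantum_channel_kraus_map) auto
  then show thesis
    by (rule that) (simp only: ftrace_times_kraus_map[OF K] Ksum R_def)
qed

text \<open>The old decoder \<open>D\<close> is followed by the channel \<open>\<Lambda>\<close>
  that compresses to the range of \<open>Q\<close>. The dual of \<open>\<Lambda>\<close> leads back
  to compressions of elements of \<open>S\<close>, to which the recovery property of
  \<open>D\<close> applies. That \<open>Q\<close> is nonzero leaves room for the pure state.\<close>

theorem correctable_subset:
  assumes \<Phi>: "quantum_channel n m \<Phi>" and S: "correctable n m \<Phi> S"
    and T: "star_subalgebra n T" "T \<subseteq> S"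
    and Q: "Q \<in> T" "\<And>X. X \<in> T \<Longrightarrow> Q * X = X \<and> X * Q = X" "Q \<noteq> 0\<^sub>m n n"
  shows "correctable n m \<Phi> T"
proof -
  obtain P r v D where P: "P \<in> S" "\<And>X. X \<in> S \<Longrightarrow> P * X = X \<and> X * P = X"
    and v: "supported n r v" "adj v * v = fid r" "v * adj v = of_mat P" and D: "quantum_channel m r D"
    and rec: "\<And>X y. X \<in> S \<Longrightarrow> supported r r y \<Longrightarrow>
      ftrace (adj v * of_mat X * v * of_mat (D (\<Phi> (to_mat n n (v * y * adj v))))) =
      ftrace (adj v * of_mat X * v * y)"
    using S unfolding correctable_iff[OF \<Phi>] by blast
  have subS: "star_subalgebra n S" using S by (simp add: correctable_def)
  have Sc: "S \<subseteq> carrier_mat n n" using subS by (simp add: star_subalgebra_def)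
  have Tc: "T \<subseteq> carrier_mat n n" using T Sc by blast
  define q where "q = of_mat Q"
  have Qc: "Q \<in> carrier_mat n n" and Pc: "P \<in> carrier_mat n n" using Q P Sc Tc by auto
  have unit: "q * of_mat X = of_mat X" "of_mat X * q = of_mat X" if "X \<in> T" for X
    using Q(2)[OF that] that Tc Qc by (auto simp: q_def subset_iff simp flip: of_mat_mult[of _ n n _ n])
  have Punit: "of_mat P * of_mat X = of_mat X" "of_mat X * of_mat P = of_mat X" if "X \<in> S" for X
    using P(2)[OF that] that Sc Pc by (auto simp: subset_iff simp flip: of_mat_mult[of _ n n _ n])
  have "mat_adjoint Q \<in> T" using T Q by (simp add: star_subalgebra_def)
  then have aq: "adj q * q = adj q" using unit(2)[of "mat_adjoint Q"] by (simp add: q_def)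
  then have q: "adj q = q" by (metis adj_adj adj_times)
  have qq: "q * q = q" using aq by (simp add: q)
  obtain s v' where v': "supported n s v'" "adj v' * v' = fid s" "v' * adj v' = q"
    using projection_factorization[of n q] q qq Qc by (metis q_def supported_of_mat)
  have "q \<noteq> 0"
    using Q(3) Qc of_mat_inject[OF Qc, of "0\<^sub>m n n"] by (simp add: q_def)
  have "s \<noteq> 0"
  proof
    assume "s = 0"
    then have "v' = 0" using v'(1) by (intro fmat_eqI) (simp add: supported_def)
    then show False using v'(3) \<open>q \<noteq> 0\<close> by simp
  qed
  \<comment> \<open>The inclusion of the new code space in the old one, in the coordinates given by
    the isometries.\<close>
  define w where "w = adj v * v'"
  have ws: "supported r s w" unfolding w_def using v(1) v'(1) by (intro supported_times supported_adj)
  have qv': "q * v' = v'"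
    using v'(2) times_fid[OF v'(1)] by (simp add: mult.assoc flip: v'(3))
  have vw: "v * w = v'"
  proof -
    have "v * w = of_mat P * (q * v')" by (simp add: w_def qv' flip: v(3) mult.assoc)
    also have "\<dots> = of_mat P * of_mat Q * v'" by (simp add: q_def mult.assoc)
    also have "\<dots> = v'" using Punit(1)[of Q] Q(1) T(2) qv' by (auto simp: q_def)
    finally show ?thesis .
  qed
  have ww: "adj w * w = fid s"
  proof -
    have "adj w * w = adj v' * (v * w)" by (simp add: w_def mult.assoc)
    then show ?thesis by (simp add: vw v')
  qed
  obtain \<Lambda> where \<Lambda>: "quantum_channel r s \<Lambda>"
    "\<And>a Z. ftrace (a * of_mat (\<Lambda> Z)) =
       ftrace ((w * a * adj w + entry a 0 0 *\<^sub>C (fid r - w * adj w)) * of_mat Z)"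
    using compression_channel[OF ws ww] \<open>s \<noteq> 0\<close> by blast
  have main: "ftrace (adj v' * of_mat X * v' * of_mat ((\<Lambda> \<circ> D) (\<Phi> (to_mat n n (v' * y * adj v'))))) =
      ftrace (adj v' * of_mat X * v' * y)" if X: "X \<in> T" and y: "supported s s y" for X y
  proof -
    define a where "a = adj v' * of_mat X * v'"
    define \<alpha> where "\<alpha> = entry a 0 0"
    \<comment> \<open>The element of \<open>S\<close> whose compression is the dual of
      \<open>\<Lambda>\<close> at \<open>a\<close>; membership uses that \<open>S\<close> contains
      both units.\<close>
    define X' where "X' = X + \<alpha> \<cdot>\<^sub>m (P + (- 1) \<cdot>\<^sub>m Q)"
    have "\<And>X Y. X \<in> S \<Longrightarrow> Y \<in> S \<Longrightarrow> X + Y \<in> S" "\<And>c X. X \<in> S \<Longrightarrow> c \<cdot>\<^sub>m X \<in> S"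
      using subS by (simp_all add: star_subalgebra_def)
    then have X': "X' \<in> S"
      using X Q(1) T(2) P(1) by (simp add: X'_def subset_iff)
    have ofX': "of_mat X' = of_mat X + \<alpha> *\<^sub>C (of_mat P - q)"
      using X Tc Pc Qc by (auto simp: X'_def q_def of_mat_add[of _ n n] subset_iff)
    have as: "supported s s a"
      unfolding a_def using v'(1) X Tc by (intro supported_times[of _ n] supported_adj supported_of_mat) auto
    have ys: "supported r r (w * y * adj w)"
      by (intro supported_times[OF supported_times[OF ws y] supported_adj[OF ws]])
    have waw: "w * a * adj w = adj v * of_mat X * v"
    proof -
      have "w * a * adj w = adj v * (v' * adj v') * of_mat X * (v' * adj v') * v"
        by (simp add: w_def a_def mult.assoc)
      also have "\<dots> = adj v * (q * of_mat X * q) * v" by (simp add: v' mult.assoc)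
      finally show ?thesis by (simp add: unit X mult.assoc)
    qed
    moreover have "w * adj w = adj v * q * v"
      by (simp add: w_def mult.assoc flip: v'(3))
    moreover have "fid r = adj v * of_mat P * v"
    proof -
      have "adj v * of_mat P * v = (adj v * v) * (adj v * v)" by (simp add: mult.assoc flip: v(3))
      then show ?thesis by (simp add: v fid_times[OF supported_fid])
    qed
    ultimately have eq: "w * a * adj w + \<alpha> *\<^sub>C (fid r - w * adj w) = adj v * of_mat X' * v"
      by (simp add: ofX' algebra_simps)
    have "v * (w * y * adj w) * adj v = v' * y * adj v'"
    proof -
      have "v * (w * y * adj w) * adj v = (v * w) * y * adj (v * w)" by (simp add: mult.assoc)
      then show ?thesis by (simp add: vw)
    qed
    then have "ftrace (a * of_mat ((\<Lambda> \<circ> D) (\<Phi> (to_mat n n (v' * y * adj v'))))) =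
        ftrace (adj v * of_mat X' * v * (w * y * adj w))"
      using rec[OF X' ys] by (simp add: \<Lambda>(2) flip: \<alpha>_def eq)
    \<comment> \<open>The added term disappears on states of the new code space, since
      \<open>fid r - w * adj w\<close> annihilates \<open>w\<close>.\<close>
    also have "\<dots> = ftrace (w * (a * fid s * y * adj w))"
    proof -
      have "w * adj w * w = w" using ww times_fid[OF ws] by (simp add: mult.assoc)
      then have "(w * a * adj w + \<alpha> *\<^sub>C (fid r - w * adj w)) * w = w * a * fid s"
        using ww fid_times[OF ws] by (simp add: distrib_right left_diff_distrib mult.assoc)
      then have "adj v * of_mat X' * v * (w * y * adj w) = w * a * fid s * y * adj w"
        unfolding eq by (simp add: mult.assoc[symmetric])
      then show ?thesis by (simp add: mult.assoc)
    qed
    also have "\<dots> = ftrace (a * y * (adj w * w))"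
      using times_fid[OF as] by (subst ftrace_commute) (simp add: mult.assoc)
    also have "\<dots> = ftrace (a * y)"
      using times_fid[OF y] by (simp add: ww mult.assoc)
    finally show ?thesis by (simp add: a_def)
  qed
  show ?thesis
    unfolding correctable_iff[OF \<Phi>]
    using T(1) Q(1,2) v' main quantum_channel_comp[OF D \<Lambda>(1)] unfolding q_def by blast
qed

text \<open>The image of the composite embedding is a subalgebra of a correctable algebra. As
  \<open>B\<close> is a bare record, closure and a unit are asked for explicitly; that
  \<open>0\<close> times \<open>e\<close> differs from \<open>e\<close> says that this unit is
  nonzero.\<close>

theorem transmittable_embeds:
  assumes \<Phi>: "quantum_channel n m \<Phi>" and A: "transmittable n m \<Phi> A" and B: "star_embeds B A"
    and closed: "operations_closed B" and e: "e \<in> carrier B"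
      "\<And>x. x \<in> carrier B \<Longrightarrow> e \<otimes>\<^bsub>B\<^esub> x = x \<and> x \<otimes>\<^bsub>B\<^esub> e = x" "0 \<odot>\<^bsub>B\<^esub> e \<noteq> e"
  shows "transmittable n m \<Phi> B"
proof -
  obtain f where f: "star_hom A (matrix_algebra n) f" "inj_on f (carrier A)"
    "correctable n m \<Phi> (f ` carrier A)"
    using A by (auto simp: transmittable_def)
  obtain h where h: "star_hom B A h" "inj_on h (carrier B)" using B by (auto simp: star_embeds_def)
  define g where "g = f \<circ> h"
  have g: "star_hom B (matrix_algebra n) g" unfolding g_def using h(1) f(1) by (rule star_hom_comp)
  have hA: "h ` carrier B \<subseteq> carrier A" using h(1) by (auto simp: star_hom_def)
  have inj: "inj_on g (carrier B)"
    unfolding g_def using h(2) inj_on_subset[OF f(2) hA] by (rule comp_inj_on)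
  note g' = g[unfolded star_hom_def, simplified]
  note c' = closed[unfolded operations_closed_def]
  have zero: "g (0 \<odot>\<^bsub>B\<^esub> e) = 0\<^sub>m n n" using g' e(1) by (auto intro!: eq_matI)
  have "star_subalgebra n (g ` carrier B)"
    unfolding star_subalgebra_def
  proof (intro conjI ballI allI)
    show "g ` carrier B \<subseteq> carrier_mat n n" using g' by auto
    show "0\<^sub>m n n \<in> g ` carrier B"
      using imageI[of "0 \<odot>\<^bsub>B\<^esub> e" "carrier B" g] zero c' e(1) by auto
  next
    fix X Y c assume "X \<in> g ` carrier B" "Y \<in> g ` carrier B"
    then obtain x y where xy: "x \<in> carrier B" "y \<in> carrier B" "X = g x" "Y = g y" by auto
    show "X + Y \<in> g ` carrier B"
      using xy g' c' by (intro image_eqI[of _ _ "x \<oplus>\<^bsub>B\<^esub> y"]) auto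
    show "X * Y \<in> g ` carrier B"
      using xy g' c' by (intro image_eqI[of _ _ "x \<otimes>\<^bsub>B\<^esub> y"]) auto
  next
    fix X c assume "X \<in> g ` carrier B"
    then obtain x where x: "x \<in> carrier B" "X = g x" by auto
    show "c \<cdot>\<^sub>m X \<in> g ` carrier B"
      using x g' c' by (intro image_eqI[of _ _ "c \<odot>\<^bsub>B\<^esub> x"]) auto
    show "mat_adjoint X \<in> g ` carrier B"
      using x g' c' by (intro image_eqI[of _ _ "star B x"]) auto
  qed
  moreover have "g ` carrier B \<subseteq> f ` carrier A" using hA by (auto simp: g_def)
  moreover have "g e \<in> g ` carrier B" using e by simp
  moreover have "g e * X = X \<and> X * g e = X" if "X \<in> g ` carrier B" for X
    using that e g' by (metis (no_types, lifting) imageE)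
  moreover have "g e \<noteq> 0\<^sub>m n n"
    using inj_onD[OF inj, of "0 \<odot>\<^bsub>B\<^esub> e" e] zero e c' by auto
  ultimately have "correctable n m \<Phi> (g ` carrier B)"
    by (rule correctable_subset[OF \<Phi> f(3)])
  then show ?thesis using g inj by (auto simp: transmittable_def)
qed

section \<open>The capacity algebra\<close>

text \<open>The definition of \<open>d_max\<close> speaks of single matrix algebras and that of
  \<open>hybrid_capacity\<close> of lists; this connects them at one summand.\<close>

lemma star_embeds_singleton:
  "star_embeds (matrix_algebra d) (matrix_algebra_sum [d])"
  "star_embeds (matrix_algebra_sum [d]) (matrix_algebra d)"
proof -
  have "star_hom (matrix_algebra d) (matrix_algebra_sum [d]) (\<lambda>X. [X])"
    by (auto simp: star_hom_def matrix_algebra_sum_simps)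
  then show "star_embeds (matrix_algebra d) (matrix_algebra_sum [d])"
    by (auto simp: star_embeds_def inj_on_def)
  have carrier: "\<exists>X. Xs = [X] \<and> X \<in> carrier_mat d d" if "Xs \<in> carrier (matrix_algebra_sum [d])" for Xs
    using that by (auto simp: matrix_algebra_sum_simps length_Suc_conv)
  have "star_hom (matrix_algebra_sum [d]) (matrix_algebra d) hd"
    by (auto simp: star_hom_def matrix_algebra_sum_simps(2-) dest!: carrier)
  then show "star_embeds (matrix_algebra_sum [d]) (matrix_algebra d)"
    by (auto simp: star_embeds_def inj_on_def dest!: carrier)
qed

lemma zero_smult_one_neq: "0 < d \<Longrightarrow> 0 \<cdot>\<^sub>m 1\<^sub>m d \<noteq> (1\<^sub>m d :: complex mat)"
proof
  assume "0 < d" and "0 \<cdot>\<^sub>m 1\<^sub>m d = (1\<^sub>m d :: complex mat)"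
  then have "(0 \<cdot>\<^sub>m 1\<^sub>m d) $$ (0, 0) = (1\<^sub>m d :: complex mat) $$ (0, 0)" by simp
  with \<open>0 < d\<close> show False by simp
qed

lemma transmittable_matrix_algebra:
  assumes "quantum_channel n m \<Phi>" "transmittable n m \<Phi> A" "star_embeds (matrix_algebra d) A" "0 < d"
  shows "transmittable n m \<Phi> (matrix_algebra d)"
  by (rule transmittable_embeds[OF assms(1-3) operations_closed_matrix_algebra, of "1\<^sub>m d"])
    (use zero_smult_one_neq[OF assms(4)] in auto)

lemma transmittable_matrix_algebra_sum:
  assumes "quantum_channel n m \<Phi>" "transmittable n m \<Phi> A" "star_embeds (matrix_algebra_sum ds) A"
    and ds: "ds \<noteq> []" "0 \<notin> set ds"
  shows "transmittable n m \<Phi> (matrix_algebra_sum ds)"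
proof (rule transmittable_embeds[OF assms(1-3) operations_closed_matrix_algebra_sum])
  let ?e = "map (\<lambda>d. 1\<^sub>m d) ds :: complex mat list"
  show "?e \<in> carrier (matrix_algebra_sum ds)" by (simp add: matrix_algebra_sum_simps)
  show "?e \<otimes>\<^bsub>matrix_algebra_sum ds\<^esub> x = x \<and> x \<otimes>\<^bsub>matrix_algebra_sum ds\<^esub> ?e = x"
    if "x \<in> carrier (matrix_algebra_sum ds)" for x
    using that by (auto simp: matrix_algebra_sum_simps intro!: nth_equalityI)
  have "0 < hd ds" using ds by (metis gr0I list.set_sel(1))
  then have "hd (0 \<odot>\<^bsub>matrix_algebra_sum ds\<^esub> ?e) \<noteq> hd ?e"
    using zero_smult_one_neq ds by (simp add: matrix_algebra_sum_simps hd_map)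
  then show "0 \<odot>\<^bsub>matrix_algebra_sum ds\<^esub> ?e \<noteq> ?e" by metis
qed

section \<open>Transmittable algebras as concrete algebras, and the recursion for
  multiplicities\<close>

lemma star_hom_of_mat_comp:
  assumes f: "star_hom A (matrix_algebra n) f" and inj: "inj_on f (carrier A)"
  shows "star_hom A (fmat_algebra (of_mat ` f ` carrier A)) (of_mat \<circ> f)"
    and "inj_on (of_mat \<circ> f) (carrier A)"
proof -
  have car: "f x \<in> carrier_mat n n" if "x \<in> carrier A" for x using f that by (simp add: star_hom_def)
  show "star_hom A (fmat_algebra (of_mat ` f ` carrier A)) (of_mat \<circ> f)"
    using f by (simp add: star_hom_def of_mat_add[of _ n n] of_mat_mult[of _ n n _ n])
  show "inj_on (of_mat \<circ> f) (carrier A)"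
    using inj of_mat_inject[OF car car] by (auto simp: inj_on_def)
qed

lemma transmittable_replicate_le:
  assumes "transmittable n m \<Phi> (matrix_algebra_sum (replicate c d))"
  shows "c * d \<le> n"
proof (rule embeds_full_matrix_le)
  let ?A = "matrix_algebra_sum (replicate c d)"
  obtain f where f: "star_hom ?A (matrix_algebra n) f" "inj_on f (carrier ?A)"
    using assms by (auto simp: transmittable_def)
  have "f x \<in> carrier_mat n n" if "x \<in> carrier ?A" for x using f that by (simp add: star_hom_def)
  then have "star_hom ?A (fmat_algebra {x. supported n n x}) (of_mat \<circ> f)"
    using star_hom_of_mat_comp(1)[OF f] supported_of_mat by (simp add: star_hom_def)
  then show "star_embeds ?A (fmat_algebra {x. supported n n x})"
    using star_hom_of_mat_comp(2)[OF f] by (auto simp: star_embeds_def)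
qed

lemma star_subalgebra_matrix_star_algebra:
  assumes S: "star_subalgebra n S" and P: "P \<in> S" "\<And>X. X \<in> S \<Longrightarrow> P * X = X \<and> X * P = X"
  shows "matrix_star_algebra n (of_mat ` S) (of_mat P)"
proof -
  note S' = S[unfolded star_subalgebra_def]
  have car: "X \<in> carrier_mat n n" if "X \<in> S" for X using S' that by auto
  show ?thesis
  proof unfold_locales
    show "0 \<in> of_mat ` S" using S' by (metis image_eqI of_mat_zero)
  next
    fix x y assume "x \<in> of_mat ` S" "y \<in> of_mat ` S"
    then obtain X Y where "X \<in> S" "Y \<in> S" "x = of_mat X" "y = of_mat Y" by auto
    then have "x + y = of_mat (X + Y)" "X + Y \<in> S" "x * y = of_mat (X * Y)" "X * Y \<in> S"
      using S' car by (auto simp: of_mat_add[of _ n n] of_mat_mult[of _ n n _ n])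
    then show "x + y \<in> of_mat ` S" "x * y \<in> of_mat ` S" by blast+
  next
    fix x c assume "x \<in> of_mat ` S"
    then obtain X where "X \<in> S" "x = of_mat X" by auto
    then have "c *\<^sub>C x = of_mat (c \<cdot>\<^sub>m X)" "c \<cdot>\<^sub>m X \<in> S" "adj x = of_mat (mat_adjoint X)" "mat_adjoint X \<in> S"
      using S' by auto
    then show "c *\<^sub>C x \<in> of_mat ` S" "adj x \<in> of_mat ` S" by blast+
    show "supported n n x" "of_mat P * x = x" "x * of_mat P = x"
      using \<open>X \<in> S\<close> \<open>x = of_mat X\<close> car P by (auto intro: supported_of_mat simp flip: of_mat_mult[of _ n n _ n])
  qed (use P in auto)
qed

text \<open>The concrete image, whose structure is known, can thus take the place of the abstract
  algebra as a source of transmittable subalgebras.\<close>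

lemma transmittable_fmat_algebra:
  assumes "correctable n m \<Phi> S"
  shows "transmittable n m \<Phi> (fmat_algebra (of_mat ` S))"
proof -
  have car: "X \<in> carrier_mat n n" if "X \<in> S" for X
    using assms that by (auto simp: correctable_def star_subalgebra_def)
  have "star_hom (fmat_algebra (of_mat ` S)) (matrix_algebra n) (to_mat n n)"
    using supported_of_mat[OF car]
    by (auto simp: star_hom_def to_mat_add to_mat_scale to_mat_adj to_mat_times[of n n])
  moreover have "inj_on (to_mat n n) (of_mat ` S)"
    using car by (auto simp: inj_on_def)
  moreover have "to_mat n n ` of_mat ` S = S"
    using car by (force simp: image_image)
  ultimately show ?thesis using assms by (auto simp: transmittable_def)
qed

lemma count_concat_replicate:
  "count (mset (concat (map (\<lambda>d. replicate (g d) d) [1..<Suc N]))) x = (if 1 \<le> x \<and> x \<le> N then g x else 0)"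
  by (induction N) (auto simp: le_Suc_eq)

text \<open>Indices are grouped by the value of \<open>f\<close>: values below \<open>d\<close> have
  quotient \<open>0\<close>, and \<open>d\<close> itself has quotient \<open>1\<close>. For block
  sizes this is the recursion of \<open>capacity_multiplicity\<close>.\<close>

lemma sum_div_eq:
  fixes f :: "'a \<Rightarrow> nat"
  assumes "finite R" "\<And>r. r \<in> R \<Longrightarrow> f r \<le> N" "1 \<le> d" "d \<le> N"
  shows "(\<Sum>r\<in>R. f r div d) = card {r \<in> R. f r = d} + (\<Sum>k\<in>{d<..N}. card {r \<in> R. f r = k} * (k div d))"
proof -
  have "(\<Sum>r\<in>R. f r div d) = (\<Sum>r\<in>R. \<Sum>k\<in>{d..N}. if f r = k then k div d else 0)"
    by (intro sum.cong refl) (use assms in auto)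
  also have "\<dots> = (\<Sum>k\<in>{d..N}. \<Sum>r\<in>R. if f r = k then k div d else 0)" by (rule sum.swap)
  also have "\<dots> = (\<Sum>k\<in>{d..N}. card {r \<in> R. f r = k} * (k div d))"
    using assms(1) by (intro sum.cong refl) (simp add: sum.If_cases Int_def)
  also have "{d..N} = insert d {d<..N}" using assms by auto
  finally show ?thesis using assms by simp
qed

theorem theorem4p6:
  fixes n m :: nat and \<Phi> :: "complex mat \<Rightarrow> complex mat" and A :: "'a star_algebra"
  assumes "quantum_channel n m \<Phi>"
    and "fin_dim_cstar_algebra A"
    and "transmittable n m \<Phi> A"
    and "\<forall>d\<in>{1..d_max n m \<Phi>}.
      star_embeds (matrix_algebra_sum (replicate (hybrid_capacity n m \<Phi> d) d)) A"
  shows "(\<forall>d\<in>{1..d_max n m \<Phi>}. 0 \<le> capacity_multiplicity n m \<Phi> d) \<and>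
    star_isomorphic A (capacity_algebra n m \<Phi>)"
proof -
  note \<Phi> = assms(1)
  interpret A: fin_dim_cstar_algebra A by (rule assms(2))
  obtain f where f: "star_hom A (matrix_algebra n) f" "inj_on f (carrier A)"
    "correctable n m \<Phi> (f ` carrier A)"
    using assms(3) by (auto simp: transmittable_def)
  let ?S = "of_mat ` f ` carrier A"
  note S_trans = transmittable_fmat_algebra[OF f(3)]
  have A_iso: "star_isomorphic A (fmat_algebra ?S)"
    using star_hom_of_mat_comp[OF f(1,2)] by (auto simp: star_isomorphic_def bij_betw_def image_comp)
  obtain P where P: "P \<in> f ` carrier A" "\<And>X. X \<in> f ` carrier A \<Longrightarrow> P * X = X \<and> X * P = X"
    and sub: "star_subalgebra n (f ` carrier A)"
    using f(3) unfolding correctable_def by blast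
  interpret matrix_star_algebra n ?S "of_mat P"
    using sub P by (rule star_subalgebra_matrix_star_algebra)
  obtain F rep v where "matrix_unit_system n ?S (of_mat P) F rep v"
    using ex_matrix_unit_system by blast
  then interpret U: matrix_unit_system n ?S "of_mat P" F rep v .
  define R where "R = rep ` F"
  define b where "b = U.block_size"
  define C where "C d = (\<Sum>r\<in>R. b r div d)" for d
  have finR: "finite R" using U.finite_F by (simp add: R_def)
  have b_pos: "1 \<le> b r" if "r \<in> R" for r
    using that U.finite_F by (force simp: b_def R_def U.block_size_def card_gt_0_iff Suc_le_eq)
  have copies: "transmittable n m \<Phi> (matrix_algebra_sum (replicate c d))"
    if "1 \<le> d" "1 \<le> c" "c \<le> C d" for c d
    using that U.embeds_replicate[of c d]
    by (intro transmittable_matrix_algebra_sum[OF \<Phi> S_trans]) (auto simp: C_def R_def b_def)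
  have copies_le: "c \<le> C d" if "star_embeds (matrix_algebra_sum (replicate c d)) A" "1 \<le> d" for c d
    using U.replicate_embeds_le[OF star_embeds_trans[OF that(1) star_isomorphic_imp_embeds[OF A_iso]] that(2)]
    by (simp add: C_def R_def b_def)
  define D where "D = {d. 1 \<le> d \<and> transmittable n m \<Phi> (matrix_algebra d)}"
  define H where "H d = {c. 1 \<le> c \<and> transmittable n m \<Phi> (matrix_algebra_sum (replicate c d))}" for d
  let ?N = "d_max n m \<Phi>"
  have D_iff: "d \<in> D \<longleftrightarrow> 1 \<in> H d" if "1 \<le> d" for d
    using transmittable_matrix_algebra_sum[OF \<Phi> _ star_embeds_singleton(2), of d]
      transmittable_matrix_algebra[OF \<Phi> _ star_embeds_singleton(1), of d] that
    by (auto simp: D_def H_def)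
  have H_sub: "H d \<subseteq> {..n}" if "1 \<le> d" for d
  proof
    fix c assume "c \<in> H d"
    then have "c * d \<le> n" by (intro transmittable_replicate_le) (auto simp: H_def)
    moreover have "c * 1 \<le> c * d" using that by (rule mult_le_mono2)
    ultimately show "c \<in> {..n}" by (metis atMost_iff le_trans mult_1_right)
  qed
  have "D \<subseteq> {..n}"
  proof
    fix d assume d: "d \<in> D"
    then have "1 \<in> H d" using D_iff[of d] by (auto simp: D_def)
    then have "1 * d \<le> n" by (intro transmittable_replicate_le) (auto simp: H_def)
    then show "d \<in> {..n}" by simp
  qed
  then have finD: "finite D" using finite_subset by blast
  have finH: "finite (H d)" if "1 \<le> d" for d using H_sub[OF that] finite_subset by blast
  have C_ge: "b r div d \<le> C d" if "r \<in> R" for r d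
    unfolding C_def using finR that by (intro member_le_sum) auto
  \<comment> \<open>A block contains the full matrix algebra of its own size, so its size is a
    transmittable dimension.\<close>
  have bD: "b r \<in> D" if "r \<in> R" for r
  proof -
    have "1 \<le> C (b r)" using C_ge[OF that, of "b r"] b_pos[OF that] by simp
    then have "1 \<in> H (b r)" using copies[of "b r" 1] b_pos[OF that] by (simp add: H_def)
    then show ?thesis using D_iff[of "b r"] b_pos[OF that] by simp
  qed
  \<comment> \<open>Without projections the unit of the image would be zero, and injectivity would
    force \<open>A\<close> to be zero.\<close>
  have "F \<noteq> {}"
  proof
    assume "F = {}"
    then have P0: "of_mat P = 0" using U.v_sum by simp
    have "x = \<zero>\<^bsub>A\<^esub>" if "x \<in> carrier A" for x
    proof -
      have "of_mat (f y) = 0" if "y \<in> carrier A" for y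
        using unit_left[of "of_mat (f y)"] that P0 by simp
      then have "(of_mat \<circ> f) x = (of_mat \<circ> f) \<zero>\<^bsub>A\<^esub>" using that A.zero_closed by simp
      then show ?thesis
        using inj_onD[OF star_hom_of_mat_comp(2)[OF f(1,2)]] that A.zero_closed by blast
    qed
    then show False using A.nonzero A.zero_closed by blast
  qed
  then have "D \<noteq> {}" using bD by (auto simp: R_def)
  have N: "?N = Max D" by (simp add: d_max_def D_def)
  have ND: "?N \<in> D" unfolding N using finD \<open>D \<noteq> {}\<close> by (rule Max_in)
  then have N1: "1 \<le> ?N" by (simp add: D_def)
  have b_le: "b r \<le> ?N" if "r \<in> R" for r
    unfolding N using finD bD[OF that] by (rule Max_ge)
  have hc: "hybrid_capacity n m \<Phi> d = Max (H d)" for d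
    by (simp add: hybrid_capacity_def H_def)
  \<comment> \<open>The embedding hypothesis enters here: \<open>copies_le\<close> bounds every
    number of copies that embeds into \<open>A\<close>.\<close>
  have hc_le: "hybrid_capacity n m \<Phi> d \<le> C d" if "1 \<le> d" "d \<le> ?N" for d
    using assms(4) that by (intro copies_le) auto
  have "1 \<in> H ?N" using D_iff[OF N1] ND by simp
  then have "1 \<le> hybrid_capacity n m \<Phi> ?N"
    unfolding hc using finH[OF N1] by (intro Max_ge)
  \<comment> \<open>A positive capacity at the largest dimension needs a block of at least that
    size.\<close>
  then have "C ?N \<noteq> 0" using hc_le[OF N1] by simp
  then obtain r where r: "r \<in> R" "b r div ?N \<noteq> 0" unfolding C_def by (meson sum.neutral)
  then have rN: "?N \<le> b r" by (metis div_less not_le)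
  have capacity: "hybrid_capacity n m \<Phi> d = C d" if d: "1 \<le> d" "d \<le> ?N" for d
  proof (rule antisym[OF hc_le[OF d]])
    \<comment> \<open>Only positive numbers compete in the maximum \<open>Max (H d)\<close>; the
      large block \<open>r\<close> makes \<open>C d\<close> one of them.\<close>
    have "1 \<le> b r div d" using rN d by (simp add: Suc_le_eq div_greater_zero_iff)
    then have "1 \<le> C d" using C_ge[OF r(1), of d] by simp
    then have "C d \<in> H d" using copies[of d "C d"] d by (simp add: H_def)
    then show "C d \<le> hybrid_capacity n m \<Phi> d" unfolding hc using finH[OF d(1)] by (intro Max_ge)
  qed
  have mult: "capacity_multiplicity n m \<Phi> d = int (card {r \<in> R. b r = d})" if "1 \<le> d" "d \<le> ?N" for d
    using that
  proof (induction "?N - d" arbitrary: d rule: less_induct)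
    case less
    have "(\<Sum>k\<in>{d<..?N}. capacity_multiplicity n m \<Phi> k * int (k div d)) =
        (\<Sum>k\<in>{d<..?N}. int (card {r \<in> R. b r = k}) * int (k div d))"
    proof (rule sum.cong[OF refl])
      fix k assume "k \<in> {d<..?N}"
      then have "capacity_multiplicity n m \<Phi> k = int (card {r \<in> R. b r = k})"
        using less.prems by (intro less.hyps) auto
      then show "capacity_multiplicity n m \<Phi> k * int (k div d) = int (card {r \<in> R. b r = k}) * int (k div d)"
        by simp
    qed
    then show ?case
      using capacity[OF less.prems] sum_div_eq[of R b ?N d] finR b_le less.prems
      by (subst capacity_multiplicity.simps) (simp add: C_def)
  qed
  define ts where "ts = concat (map (\<lambda>d. replicate (nat (capacity_multiplicity n m \<Phi> d)) d) [1..<Suc ?N])"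
  have "mset ts = image_mset b (mset_set R)"
  proof (rule multiset_eqI)
    fix x
    have "count (image_mset b (mset_set R)) x = card {r \<in> R. b r = x}"
      using finR by (simp add: count_image_mset Int_def vimage_def conj_commute)
    \<comment> \<open>The list \<open>ts\<close> contains only dimensions between \<open>1\<close>
      and \<open>d_max\<close>, so no block may have a size outside this range.\<close>
    moreover have "card {r \<in> R. b r = x} = 0" if "\<not> (1 \<le> x \<and> x \<le> ?N)"
    proof -
      have "{r \<in> R. b r = x} = {}" using that b_pos b_le by blast
      then show ?thesis by (simp only: card.empty)
    qed
    ultimately show "count (mset ts) x = count (image_mset b (mset_set R)) x"
      unfolding ts_def count_concat_replicate using mult[of x] by simp
  qed
  then have "star_isomorphic (matrix_algebra_sum ts) (fmat_algebra ?S)"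
    unfolding b_def R_def by (rule U.isomorphic_matrix_algebra_sum)
  then have "star_isomorphic (fmat_algebra ?S) (matrix_algebra_sum ts)"
    by (rule star_isomorphic_sym[OF operations_closed_matrix_algebra_sum])
  then have "star_isomorphic A (matrix_algebra_sum ts)"
    using A_iso star_isomorphic_trans by blast
  then have "star_isomorphic A (capacity_algebra n m \<Phi>)"
    by (simp add: capacity_algebra_def ts_def)
  moreover have "\<forall>d\<in>{1..?N}. 0 \<le> capacity_multiplicity n m \<Phi> d" using mult by simp
  ultimately show ?thesis by blast
qed

end
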